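(* Let $\mu_1,\mu_2$ be Borel probability measures on $\mathbb{R}_+=[0,+\infty)$, both different from $\delta_0$, and let $\alpha<\beta$ be two positive real numbers such that $\alpha$ and $\beta$ are both atoms of the free multiplicative convolution $\mu_{1}\boxtimes\mu_{2}$. If $(\mu_{1}\boxtimes\mu_{2})((\alpha,\beta))=0$, then either $\mu_{1}$ or $\mu_{2}$ is a point mass.
   Context: A point mass is a measure $\delta_t$ (unit mass at a single point $t$); an atom of $\mu$ is a point $t$ with $\mu(\{t\})>0$. For a Borel probability measure $\mu\neq\delta_0$ on $\mathbb{R}_+=[0,+\infty)$ set $$\psi_{\mu}(z)=\int\frac{tz}{1-tz}\,d\mu(t),\qquad \eta_{\mu}(z)=\frac{\psi_{\mu}(z)}{1+\psi_{\mu}(z)},\qquad z\in\mathbb{C}\setminus\mathbb{R}_{+}.$$ The function $\eta_\mu$ is strictly increasing on $(-\infty,0)$ with $\lim_{t\uparrow0}\eta_\mu(t)=0$, so it has an inverse with respect to composition $\eta_\mu^{-1}(w)\in(-\infty,0)$ for $w<0$ sufficiently close to $0$. The free multiplicative convolution $\mu_1\boxtimes\mu_2$ is the distribution of $x^{1/2}yx^{1/2}$, where $x,y$ are freely independent positive random variables with distributions $\mu_1$ and $\mu_2$. Equivalently, it is the unique Borel probability measure on $\mathbb{R}_+$, different from $\delta_0$, such that $$\eta_{\mu_{1}\boxtimes\mu_{2}}^{-1}(w)=\frac{1}{w}\,\eta_{\mu_{1}}^{-1}(w)\,\eta_{\mu_{2}}^{-1}(w)$$ for all $w<0$ sufficiently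 close to $0$. *)

theory Defs
  imports "HOL-Probability.Probability"
begin

(* Borel probability measures on [0, infinity) are represented by Borel probability
   measures on the whole real line that give no mass to the negative half-line. *)
definition nonneg_distribution :: "real measure \<Rightarrow> bool" where
  "nonneg_distribution \<mu> \<longleftrightarrow> real_distribution \<mu> \<and> emeasure \<mu> {..<0} = 0"

definition point_mass :: "real measure \<Rightarrow> bool" where
  "point_mass \<mu> \<longleftrightarrow> (\<exists>t. \<mu> = return borel t)"

definition atom :: "real measure \<Rightarrow> real \<Rightarrow> bool" where
  "atom \<mu> t \<longleftrightarrow> 0 < emeasure \<mu> {t}"

(* The transforms psi and eta are meaningful for z outside [0, infinity) only. *)
definition psi_transform :: "real measure \<Rightarrow> complex \<Rightarrow> complex" where
  "psi_transform \<mu> z = (LINT t|\<mu>. complex_of_real t * z / (1 - complex_of_real t * z))"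

definition eta_transform :: "real measure \<Rightarrow> complex \<Rightarrow> complex" where
  "eta_transform \<mu> z = psi_transform \<mu> z / (1 + psi_transform \<mu> z)"

(* Inverse of eta as a function on the negative half-line. For \<mu> different from the unit mass
   at 0, eta is injective there and its values cover an interval (-e, 0), so the result is the
   unique preimage for w < 0 close to 0; for other w it is unspecified. *)
definition eta_inverse :: "real measure \<Rightarrow> real \<Rightarrow> real" where
  "eta_inverse \<mu> w =
     inv_into {..<0} (\<lambda>x::real. eta_transform \<mu> (complex_of_real x)) (complex_of_real w)"

(* The relation "\<nu> is the free multiplicative convolution of \<mu>1 and \<mu>2". It determines \<nu>
   uniquely (Voiculescu; Bercovici-Voiculescu) for \<mu>1, \<mu>2 nonnegative distributions different
   from the unit mass at 0. *)
definition free_mult_convolution :: "real measure \<Rightarrow> real measure \<Rightarrow> real measure \<Rightarrow> bool" where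
  "free_mult_convolution \<mu>1 \<mu>2 \<nu> \<longleftrightarrow>
     nonneg_distribution \<nu> \<and> \<nu> \<noteq> return borel 0 \<and>
     (\<forall>\<^sub>F w in at_left 0.
        eta_inverse \<nu> w = 1 / w * eta_inverse \<mu>1 w * eta_inverse \<mu>2 w)"

end

theory Submission
  imports Defs "HOL-Complex_Analysis.Complex_Analysis" "HOL-Real_Asymp.Real_Asymp"
begin

text \<open>
  Write \<open>N\<^sub>\<mu>(z) = \<integral> 1 / (1 - t z) d\<mu>(t)\<close>, so that \<open>\<eta>\<^sub>\<mu> = 1 - 1 / N\<^sub>\<mu>\<close>, and
  \<open>k\<^sub>\<mu>(z) = \<eta>\<^sub>\<mu>(z) / z\<close>. The maps \<open>\<omega> \<mapsto> z k\<^sub>2(z k\<^sub>1(\<omega>))\<close>, iterated from \<open>\<omega> = z\<close>, stay in the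
  cone \<open>arg z \<le> arg \<omega> < \<pi>\<close>; for negative \<open>z\<close> near \<open>0\<close> they converge monotonically to
  \<open>\<eta>\<^sub>1\<close>-inverse of \<open>\<eta>\<^sub>\<nu>(z)\<close>, so by Montel's theorem they converge to subordination functions
  \<open>\<omega>\<^sub>1, \<omega>\<^sub>2\<close> on the whole slit plane, with \<open>N\<^sub>j(\<omega>\<^sub>j(z)) = N\<^sub>\<nu>(z)\<close> and
  \<open>\<omega>\<^sub>1 \<omega>\<^sub>2 = z \<eta>\<^sub>\<nu>\<close>.

  If \<open>z\<close> tends to \<open>1/\<alpha>\<close> from inside the gap \<open>(1/\<beta>, 1/\<alpha>)\<close>, then \<open>|\<omega>\<^sub>1| \<rightarrow> 1/a\<close> and
  \<open>|\<omega>\<^sub>2| \<rightarrow> 1/b\<close>, where \<open>a b = \<alpha>\<close> and \<open>\<mu>\<^sub>1{a} + \<mu>\<^sub>2{b} > 1\<close>; similarly at \<open>1/\<beta>\<close> with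
  \<open>a' b' = \<beta>\<close>. Total mass forces \<open>a = a'\<close> or \<open>b = b'\<close>, say \<open>b = b'\<close> and \<open>a < a'\<close>. Over compact
  parts of the gap on which \<open>\<eta>\<^sub>\<nu> > 0\<close> the arguments of \<open>\<omega>\<^sub>j\<close> are \<open>O(Im z)\<close>, and \<open>\<mu>\<^sub>j\<close> has no mass on
  the reciprocals of the moduli that \<open>\<omega>\<^sub>j\<close> takes there. Moving from \<open>1/\<alpha>\<close> towards the zero of
  \<open>\<eta>\<^sub>\<nu>\<close>, or from \<open>1/\<beta>\<close> towards its pole, \<open>|\<omega>\<^sub>1 \<omega>\<^sub>2|\<close> tends to \<open>0\<close> or \<open>\<infinity>\<close>; \<open>|\<omega>\<^sub>1|\<close> cannot follow,
  since it would pass \<open>1/a'\<close> or \<open>1/a\<close>. Hence \<open>|\<omega>\<^sub>2|\<close> passes every value except \<open>1/b\<close>, and \<open>\<mu>\<^sub>2\<close> lives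
  on \<open>{0, b}\<close>. As \<open>N\<^sub>\<nu>\<close> vanishes at the pole of \<open>\<eta>\<^sub>\<nu>\<close>, there is no mass at \<open>0\<close> either.
\<close>

section \<open>The transforms on the slit plane\<close>

text \<open>The subordination functions are never extended to the real axis. Over the gap only their
  moduli at height \<open>y\<close> are compared, and conclusions are drawn as \<open>y\<close>
  tends to 0. This suffices because for every modulus \<open>r\<close> met in a sweep the window of
  all \<open>t\<close> with \<open>|t r - 1| \<le> y\<close> has mass \<open>O(y^2)\<close>, while
  \<open>O(1/y)\<close> such windows cover an interval.

  The obstacle is the middle of the gap, where \<open>0 < N < 1\<close> for the resolvent of \<nu>:
  there \<eta> is negative, the two arguments add up to nearly \<pi>, and no window estimate is
  available. Hence two separate sweeps, one over \<open>N > 1\<close> and one over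
  \<open>N < 0\<close>; the former yields the moduli below \<open>1/b\<close>, the latter those
  above.

  The inequality for the two masses is an identity of arguments in disguise. Near an endpoint each
  \<open>arg \<omega>\<^sub>j\<close>, divided by \<open>Im N / |N|^2\<close>, is asymptotically at
  most the mass of \<open>\<mu>\<^sub>j\<close> near \<open>1 / |\<omega>\<^sub>j|\<close>, whereas
  in the same unit \<open>arg \<eta>\<close> counts 1 and \<open>arg z\<close> at least a fixed
  \<open>k > 0\<close>.\<close>

definition slit :: "complex set" where
  "slit = {z. Im z \<noteq> 0 \<or> Re z < 0}"

definition resolvent :: "real measure \<Rightarrow> complex \<Rightarrow> complex" where
  "resolvent M z = (LINT t|M. 1 / (1 - complex_of_real t * z))"

definition eta_quotient :: "real measure \<Rightarrow> complex \<Rightarrow> complex" where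
  "eta_quotient M z = eta_transform M z / z"

lemma open_slit: "open slit"
proof -
  have "slit = {z. Im z \<noteq> 0} \<union> {z. Re z < 0}" by (auto simp: slit_def)
  moreover have "open {z. Im z \<noteq> 0}" "open {z. Re z < 0}"
    by (auto intro!: open_Collect_neq open_Collect_less continuous_intros)
  ultimately show ?thesis by (metis open_Un)
qed

lemma slit_nz: "z \<in> slit \<Longrightarrow> z \<noteq> 0"
  by (auto simp: slit_def)

lemma slit_neg: "x < 0 \<Longrightarrow> complex_of_real x \<in> slit"
  by (auto simp: slit_def)

lemma slit_upper: "Im z > 0 \<Longrightarrow> z \<in> slit"
  by (auto simp: slit_def)

lemma slit_cnj: "cnj z \<in> slit \<longleftrightarrow> z \<in> slit"
  by (auto simp: slit_def)

lemma connected_slit: "connected slit"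
proof -
  have "starlike slit"
    unfolding starlike_def
  proof (intro bexI[of _ "-1"] ballI)
    fix z assume z: "z \<in> slit"
    show "closed_segment (-1) z \<subseteq> slit"
    proof
      fix w assume "w \<in> closed_segment (-1) z"
      then obtain u where u: "0 \<le> u" "u \<le> 1" "w = (1 - u) *\<^sub>R (-1) + u *\<^sub>R z"
        by (auto simp: in_segment)
      show "w \<in> slit"
      proof (cases "Im z = 0")
        case True
        then have *: "Re z < 0" using z by (auto simp: slit_def)
        have "Re w = -(1-u) + u * Re z" using u by simp
        also have "\<dots> < 0"
        proof (cases "u = 1")
          case False
          then have "u < 1" using u by simp
          moreover have "u * Re z \<le> 0" using u * by (simp add: mult_nonneg_nonpos)
          ultimately show ?thesis by simp
        qed (use * in simp)
        finally show ?thesis by (simp add: slit_def)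
      next
        case False
        show ?thesis
        proof (cases "u = 0")
          case True then show ?thesis using u by (simp add: slit_def)
        next
          case f: False
          have "Im w = u * Im z" using u by simp
          then show ?thesis using False f by (simp add: slit_def)
        qed
      qed
    qed
  qed (simp add: slit_def)
  then show ?thesis by (rule starlike_imp_connected)
qed

lemma slit_denom: "z \<in> slit \<Longrightarrow> 0 \<le> t \<Longrightarrow> 1 - complex_of_real t * z \<noteq> 0"
proof
  assume z: "z \<in> slit" "0 \<le> t" "1 - complex_of_real t * z = 0"
  then have "t * Re z = 1" "t * Im z = 0" by (auto simp: complex_eq_iff)
  then have "Re z > 0" "Im z = 0" using z(2)
    by (metis mult_eq_0_iff mult_le_0_iff not_le zero_less_one, metis mult_eq_0_iff zero_neq_one)
  then show False using z(1) by (auto simp: slit_def)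
qed

lemma slit_denom': "z \<in> slit \<Longrightarrow> 0 \<le> t \<Longrightarrow> complex_of_real t * z \<noteq> 1"
  using slit_denom[of z t] by auto

text \<open>For \<open>t > 0\<close> the first kernel is \<open>1 / (1/t - w)\<close>, controlled by
  the distance from \<open>w\<close> to the half-line; the second is
  \<open>1 + w t / (1 - t w)\<close>. The bound is uniform in \<open>t\<close> and locally uniform
  in \<open>w\<close>, as integrability and holomorphy of the resolvent require.\<close>

lemma slit_bounds:
  assumes "z \<in> slit"
  obtains r B where "r > 0" "ball z r \<subseteq> slit"
    "\<And>w t. w \<in> ball z r \<Longrightarrow> 0 \<le> t \<Longrightarrow> cmod (of_real t / (1 - of_real t * w)) \<le> B"
    "\<And>w t. w \<in> ball z r \<Longrightarrow> 0 \<le> t \<Longrightarrow> cmod (1 / (1 - of_real t * w)) \<le> B"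
proof -
  obtain d where d: "d > 0" "ball z d \<subseteq> slit"
    using open_slit assms by (meson open_contains_ball)
  \<comment> \<open>Half the radius, so that every point of \<open>ball z r\<close> still has
    distance at least \<open>r\<close> from the half-line.\<close>
  define r where "r = d / 2"
  have r: "r > 0" "ball z r \<subseteq> slit" using d by (auto simp: r_def)
  have far: "cmod (of_real s - w) \<ge> r" if "w \<in> ball z r" "0 \<le> s" for s w
  proof (rule ccontr)
    assume "\<not> ?thesis"
    then have "dist z (of_real s) < d"
      using that dist_triangle[of z "of_real s" w] by (auto simp: r_def dist_norm norm_minus_commute)
    then have "complex_of_real s \<in> slit" using d by auto
    then show False using that by (auto simp: slit_def)
  qed
  have b1: "cmod (of_real t / (1 - of_real t * w)) \<le> 1 / r" if w: "w \<in> ball z r" and t: "0 \<le> t" for w t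
  proof (cases "t = 0")
    case False
    have eq: "1 - of_real t * w = of_real t * (of_real (1/t) - w)"
      using False by (simp add: field_simps)
    have "cmod (of_real t / (1 - of_real t * w)) = 1 / cmod (of_real (1/t) - w)"
      unfolding eq norm_divide norm_mult using False by simp
    also have "\<dots> \<le> 1 / r" using far[OF w, of "1/t"] t r by (intro divide_left_mono mult_pos_pos) auto
    finally show ?thesis .
  qed (use r in simp)
  define B where "B = max (1/r) (1 + (cmod z + r) / r)"
  have b2: "cmod (1 / (1 - of_real t * w)) \<le> 1 + (cmod z + r) / r" if w: "w \<in> ball z r" and t: "0 \<le> t" for w t
  proof -
    have nz: "1 - complex_of_real t * w \<noteq> 0" using slit_denom w r t by blast
    have "1 / (1 - of_real t * w) = 1 + w * (of_real t / (1 - of_real t * w))"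
      using nz by (simp add: field_simps)
    then have "cmod (1 / (1 - of_real t * w)) \<le> 1 + cmod w * cmod (of_real t / (1 - of_real t * w))"
      by (metis norm_triangle_ineq norm_one norm_mult)
    also have "\<dots> \<le> 1 + (cmod z + r) * (1 / r)"
    proof -
      have "cmod w \<le> cmod z + r"
        using w norm_triangle_ineq2[of w z] by (simp add: dist_norm norm_minus_commute)
      then show ?thesis using b1[OF w t] r by (intro add_left_mono mult_mono) auto
    qed
    finally show ?thesis by simp
  qed
  show thesis
    by (rule that[of r B]) (use r b1 b2 in \<open>auto simp: B_def max.coboundedI1 max.coboundedI2\<close>)
qed

lemma slit_bound_at:
  assumes "z \<in> slit"
  obtains B where "\<And>t. 0 \<le> t \<Longrightarrow> cmod (of_real t / (1 - of_real t * z)) \<le> B"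
    "\<And>t. 0 \<le> t \<Longrightarrow> cmod (1 / (1 - of_real t * z)) \<le> B"
proof (rule slit_bounds[OF assms])
  fix r B
  assume "r > 0" "\<And>w t. w \<in> ball z r \<Longrightarrow> 0 \<le> t \<Longrightarrow> cmod (of_real t / (1 - of_real t * w)) \<le> B"
    "\<And>w t. w \<in> ball z r \<Longrightarrow> 0 \<le> t \<Longrightarrow> cmod (1 / (1 - of_real t * w)) \<le> B"
  then show thesis by (intro that[of B]) auto
qed

lemma measure_eq_return:
  assumes "real_distribution M" "AE t in M. t = c"
  shows "M = return borel c"
proof -
  interpret real_distribution M by fact
  show ?thesis
  proof (rule measure_eqI)
    fix A assume A: "A \<in> sets M"
    show "emeasure M A = emeasure (return borel c) A"
    proof (cases "c \<in> A")
      case True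
      have "AE t in M. t \<in> A" using assms(2) True by auto
      then have "emeasure M A = 1" using A by (simp add: emeasure_eq_1_AE)
      then show ?thesis using True A by (simp add: indicator_def)
    next
      case False
      have "AE t in M. t \<notin> A" using assms(2) False by auto
      then have "emeasure M A = 0" using A by (subst (asm) AE_iff_measurable[of A]) auto
      then show ?thesis using False A by (simp add: indicator_def)
    qed
  qed simp
qed

text \<open>Cauchy--Schwarz, stated for a nonnegative quadratic polynomial in \<open>l\<close>, so
  that degenerate weights with \<open>P = 0\<close> are covered.\<close>

lemma discriminant_nonpos:
  fixes P Q R :: real
  assumes quad: "\<And>l. 0 \<le> R - 2 * l * Q + l\<^sup>2 * P" and P0: "P \<ge> 0"
  shows "Q\<^sup>2 \<le> R * P"
proof (cases "P = 0")
  case True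
  have "Q = 0"
  proof (rule ccontr)
    assume "Q \<noteq> 0"
    \<comment> \<open>With \<open>P = 0\<close> the polynomial is linear in \<open>l\<close> and
      equals -1 at this point.\<close>
    then show False using quad[of "(R + 1) / (2 * Q)"] True by simp
  qed
  then show ?thesis using True by simp
next
  case False
  then have "P > 0" using P0 by simp
  then have "0 \<le> P * (R - 2 * (Q/P) * Q + (Q/P)\<^sup>2 * P)" using quad[of "Q/P"] by simp
  also have "\<dots> = R * P - Q\<^sup>2" using \<open>P > 0\<close> by (simp add: field_simps power2_eq_square)
  finally show ?thesis by simp
qed

section \<open>The resolvent of a distribution on the half-line\<close>

locale nonneg_dist =
  fixes M :: "real measure"
  assumes nonneg: "nonneg_distribution M"

sublocale nonneg_dist \<subseteq> real_distribution M
  using nonneg by (simp add: nonneg_distribution_def)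

context nonneg_dist
begin

lemma AE_nonneg: "AE t in M. 0 \<le> t"
  using nonneg AE_iff_measurable[of "{..<0}" M "\<lambda>t. 0 \<le> t"]
  by (auto simp: nonneg_distribution_def not_le)

lemma prob_UNIV [simp]: "prob UNIV = 1"
  using prob_space by simp

lemma integrable_resolvent:
  assumes "z \<in> slit"
  shows "integrable M (\<lambda>t. 1 / (1 - complex_of_real t * z))"
    and "integrable M (\<lambda>t. complex_of_real t / (1 - of_real t * z))"
proof -
  obtain B where B:
    "\<And>t. 0 \<le> t \<Longrightarrow> cmod (of_real t / (1 - of_real t * z)) \<le> B"
    "\<And>t. 0 \<le> t \<Longrightarrow> cmod (1 / (1 - of_real t * z)) \<le> B"
    using slit_bound_at[OF assms] by blast
  show "integrable M (\<lambda>t. 1 / (1 - complex_of_real t * z))"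
    using AE_nonneg B(2) by (intro integrable_const_bound[of _ B]) (auto elim!: eventually_mono)
  show "integrable M (\<lambda>t. complex_of_real t / (1 - of_real t * z))"
    using AE_nonneg B(1) by (intro integrable_const_bound[of _ B]) (auto elim!: eventually_mono)
qed

lemma integrable_resolvent2:
  assumes "z \<in> slit" "w \<in> slit"
  shows "integrable M (\<lambda>t. 1 / ((1 - complex_of_real t * z) * (1 - of_real t * w)))"
    and "integrable M (\<lambda>t. complex_of_real t / ((1 - of_real t * z) * (1 - of_real t * w)))"
    and "integrable M (\<lambda>t. (complex_of_real t)\<^sup>2 / ((1 - of_real t * z) * (1 - of_real t * w)))"
proof -
  obtain B where B:
    "\<And>t. 0 \<le> t \<Longrightarrow> cmod (of_real t / (1 - of_real t * z)) \<le> B"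
    "\<And>t. 0 \<le> t \<Longrightarrow> cmod (1 / (1 - of_real t * z)) \<le> B"
    using slit_bound_at[OF assms(1)] by blast
  obtain C where C:
    "\<And>t. 0 \<le> t \<Longrightarrow> cmod (of_real t / (1 - of_real t * w)) \<le> C"
    "\<And>t. 0 \<le> t \<Longrightarrow> cmod (1 / (1 - of_real t * w)) \<le> C"
    using slit_bound_at[OF assms(2)] by blast
  have B0: "B \<ge> 0" using B(1)[of 0] by simp
  have 1: "cmod (1 / ((1 - complex_of_real t * z) * (1 - of_real t * w))) \<le> B * C"
    and 2: "cmod (of_real t / ((1 - complex_of_real t * z) * (1 - of_real t * w))) \<le> B * C"
    and 3: "cmod ((of_real t)\<^sup>2 / ((1 - complex_of_real t * z) * (1 - of_real t * w))) \<le> B * C"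
    if "0 \<le> t" for t
    using mult_mono[OF B(2)[OF that] C(2)[OF that] B0] mult_mono[OF B(1)[OF that] C(2)[OF that] B0]
      mult_mono[OF B(1)[OF that] C(1)[OF that] B0]
    by (auto simp: norm_mult norm_divide power2_eq_square)
  show "integrable M (\<lambda>t. 1 / ((1 - complex_of_real t * z) * (1 - of_real t * w)))"
    using AE_nonneg 1 by (intro integrable_const_bound[of _ "B*C"]) (auto elim!: eventually_mono)
  show "integrable M (\<lambda>t. complex_of_real t / ((1 - of_real t * z) * (1 - of_real t * w)))"
    using AE_nonneg 2 by (intro integrable_const_bound[of _ "B*C"]) (auto elim!: eventually_mono)
  show "integrable M (\<lambda>t. (complex_of_real t)\<^sup>2 / ((1 - of_real t * z) * (1 - of_real t * w)))"
    using AE_nonneg 3 by (intro integrable_const_bound[of _ "B*C"]) (auto elim!: eventually_mono)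
qed

lemma psi_eq: "z \<in> slit \<Longrightarrow> psi_transform M z = resolvent M z - 1"
proof -
  assume z: "z \<in> slit"
  have "psi_transform M z = (LINT t|M. 1 / (1 - complex_of_real t * z) - 1)"
    unfolding psi_transform_def
    using AE_nonneg by (intro integral_cong_AE) (auto elim!: eventually_mono simp: slit_denom'[OF z] divide_simps)
  also have "\<dots> = resolvent M z - 1"
    using integrable_resolvent[OF z] by (simp add: resolvent_def)
  finally show ?thesis .
qed

lemma eta_eq: "z \<in> slit \<Longrightarrow> eta_transform M z = (resolvent M z - 1) / resolvent M z"
  by (simp add: eta_transform_def psi_eq)

lemma resolvent_cnj: "resolvent M (cnj z) = cnj (resolvent M z)"
  unfolding resolvent_def by (subst Bochner_Integration.integral_cnj[symmetric]) simp

lemma eta_cnj: "eta_transform M (cnj z) = cnj (eta_transform M z)"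
proof -
  have "psi_transform M (cnj z) = cnj (psi_transform M z)"
    unfolding psi_transform_def by (subst Bochner_Integration.integral_cnj[symmetric]) simp
  then show ?thesis by (simp add: eta_transform_def)
qed

lemma eta_quotient_cnj: "eta_quotient M (cnj z) = cnj (eta_quotient M z)"
  by (simp add: eta_quotient_def eta_cnj)

text \<open>Multiply numerator and denominator by \<open>1 - t w\<close>. Both integrals are
  symmetric in \<open>z\<close> and \<open>w\<close>, so the resolvent values at \<open>z\<close>
  and at \<open>w\<close> are expressed through the same two moments.\<close>

lemma resolvent_split:
  assumes "z \<in> slit" "w \<in> slit"
  shows "resolvent M z = (LINT t|M. 1 / ((1 - of_real t * z) * (1 - of_real t * w)))
    - w * (LINT t|M. of_real t / ((1 - of_real t * z) * (1 - of_real t * w)))"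
proof -
  have "resolvent M z = (LINT t|M. 1 / ((1 - of_real t * z) * (1 - of_real t * w))
    - w * (of_real t / ((1 - of_real t * z) * (1 - of_real t * w))))"
    unfolding resolvent_def
  proof (intro integral_cong_AE)
    show "AE t in M. 1 / (1 - complex_of_real t * z) = 1 / ((1 - of_real t * z) * (1 - of_real t * w))
      - w * (of_real t / ((1 - of_real t * z) * (1 - of_real t * w)))"
      using AE_nonneg
    proof eventually_elim
      case (elim t)
      define a b where "a = 1 - of_real t * z" and "b = 1 - of_real t * w"
      have "a \<noteq> 0" "b \<noteq> 0" "w * of_real t = 1 - b" using slit_denom assms elim by (auto simp: a_def b_def)
      then show ?case unfolding a_def[symmetric] b_def[symmetric] by (simp add: field_simps)
    qed
  qed auto
  also have "\<dots> = (LINT t|M. 1 / ((1 - of_real t * z) * (1 - of_real t * w)))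
    - (LINT t|M. w * (of_real t / ((1 - of_real t * z) * (1 - of_real t * w))))"
    by (intro Bochner_Integration.integral_diff integrable_mult_right integrable_resolvent2[OF assms])
  finally show ?thesis by (simp del: times_divide_eq_right)
qed

lemma resolvent_diff:
  assumes "z \<in> slit" "w \<in> slit"
  shows "resolvent M z - resolvent M w = (z - w) * (LINT t|M. of_real t / ((1 - of_real t * z) * (1 - of_real t * w)))"
  using resolvent_split[OF assms] resolvent_split[OF assms(2,1)]
  by (simp add: algebra_simps)

text \<open>The difference quotient minus the candidate derivative \<open>D\<close> is the integral
  of \<open>q\<close>, that is of \<open>(w - z) t^2 / ((1 - t w) (1 - t z)^2)\<close>, and the
  kernel bounds make it at most \<open>B^3 |w - z|\<close>.\<close>

lemma resolvent_holomorphic: "resolvent M holomorphic_on slit"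
proof (subst holomorphic_on_def, intro ballI)
  fix z assume z: "z \<in> slit"
  define D where "D = (LINT t|M. of_real t / ((1 - of_real t * z) * (1 - of_real t * z)))"
  obtain r B where r: "r > 0" "ball z r \<subseteq> slit" and
    B: "\<And>w t. w \<in> ball z r \<Longrightarrow> 0 \<le> t \<Longrightarrow> cmod (of_real t / (1 - of_real t * w)) \<le> B"
    "\<And>w t. w \<in> ball z r \<Longrightarrow> 0 \<le> t \<Longrightarrow> cmod (1 / (1 - of_real t * w)) \<le> B"
    using slit_bounds[OF z] by blast
  have B0: "B \<ge> 0" using B(1)[of z 0] r by simp
  have bound: "cmod ((resolvent M w - resolvent M z) / (w - z) - D) \<le> cmod (w - z) * (B * B * B)"
    if w: "w \<in> ball z r" "w \<noteq> z" for w
  proof -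
    have ws: "w \<in> slit" using w r by auto
    define q where "q t = (w - z) * ((of_real t / (1 - of_real t * w)) * (of_real t / (1 - of_real t * z)) * (1 / (1 - of_real t * z)))" for t
    have q_meas [measurable]: "q \<in> borel_measurable borel" unfolding q_def by measurable
    have "(resolvent M w - resolvent M z) / (w - z) - D =
       (LINT t|M. of_real t / ((1 - of_real t * w) * (1 - of_real t * z)))  - D"
      using resolvent_diff[OF ws z] w by simp
    also have "\<dots> = (LINT t|M. of_real t / ((1 - of_real t * w) * (1 - of_real t * z))
        - of_real t / ((1 - of_real t * z) * (1 - of_real t * z)))"
      using integrable_resolvent2[OF ws z] integrable_resolvent2[OF z z] by (simp add: D_def)
    also have "\<dots> = (LINT t|M. q t)"
    proof (intro integral_cong_AE)
      show "AE t in M. of_real t / ((1 - of_real t * w) * (1 - of_real t * z))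
        - of_real t / ((1 - of_real t * z) * (1 - of_real t * z)) =
        q t"
        using AE_nonneg
      proof eventually_elim
        case (elim t)
        define a b where "a = 1 - of_real t * z" and "b = 1 - of_real t * w"
        have "a \<noteq> 0" "b \<noteq> 0" using slit_denom z ws elim by (auto simp: a_def b_def)
        moreover have "of_real t * (w - z) = a - b" by (simp add: a_def b_def algebra_simps)
        moreover have "of_real t / (b * a) - of_real t / (a * a) = of_real t * (a - b) / (b * a * a)"
          using calculation by (simp add: divide_simps algebra_simps)
        moreover have "(w - z) * ((of_real t / b) * (of_real t / a) * (1 / a)) = of_real t * (of_real t * (w - z)) / (b * a * a)"
          by (simp add: mult_ac)
        ultimately show ?case unfolding q_def a_def[symmetric] b_def[symmetric] by argo
      qed
    qed auto
    also have "cmod \<dots> \<le> (LINT t|M. cmod (w - z) * (B * B * B))"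
    proof -
      have ae: "AE t in M. cmod (q t) \<le> cmod (w - z) * (B * B * B)"
        using AE_nonneg
      proof eventually_elim
        case (elim t)
        have "cmod (of_real t / (1 - of_real t * w)) * cmod (of_real t / (1 - of_real t * z)) * cmod (1 / (1 - of_real t * z)) \<le> B * B * B"
          using B(1)[OF w(1) elim] B(1)[of z t] B(2)[of z t] elim r B0 by (intro mult_mono) auto
        then show ?case unfolding q_def norm_mult by (intro mult_left_mono) auto
      qed
      then have "integrable M (\<lambda>t. q t)"
        by (intro integrable_const_bound) auto
      then have "(LINT t|M. cmod (q t)) \<le> (LINT t|M. cmod (w - z) * (B * B * B))"
        using ae by (intro integral_mono_AE) auto
      then show ?thesis by (rule order_trans[OF integral_norm_bound])
    qed
    also have "\<dots> = cmod (w - z) * (B * B * B)" by simp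
    finally show ?thesis .
  qed
  have "((\<lambda>w. (resolvent M w - resolvent M z) / (w - z) - D) \<longlongrightarrow> 0) (at z)"
  proof (rule Lim_null_comparison)
    have "\<forall>\<^sub>F w in at z. w \<in> ball z r \<and> w \<noteq> z"
      using r by (auto simp: eventually_at dist_commute)
    then show "\<forall>\<^sub>F w in at z. cmod ((resolvent M w - resolvent M z) / (w - z) - D) \<le> cmod (w - z) * (B * B * B)"
      by eventually_elim (use bound in auto)
    have "((\<lambda>w. cmod (w - z) * (B * B * B)) \<longlongrightarrow> cmod (z - z) * (B * B * B)) (at z)"
      by (intro tendsto_intros)
    then show "((\<lambda>w. cmod (w - z) * (B * B * B)) \<longlongrightarrow> 0) (at z)" by simp
  qed
  then have "(resolvent M has_field_derivative D) (at z)"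
    unfolding has_field_derivative_iff by (simp add: LIM_zero_iff)
  then show "resolvent M field_differentiable at z within slit"
    using has_field_derivative_at_within field_differentiable_def by blast
qed

text \<open>The weight \<open>g\<close> is real for \<open>w = cnj z\<close> and for negative \<open>z, w\<close>; the constant \<open>D\<close> is a Cauchy--Schwarz defect.\<close>

lemma eta_quotient_diff:
  assumes z: "z \<in> slit" and w: "w \<in> slit"
    and g: "\<And>t. 0 \<le> t \<Longrightarrow> 1 / ((1 - of_real t * z) * (1 - of_real t * w)) = complex_of_real (g t)"
    and gm [measurable]: "g \<in> borel_measurable borel"
    and g0: "\<And>t. 0 \<le> t \<Longrightarrow> 0 \<le> g t"
  obtains D where "D \<ge> 0" "(resolvent M z - 1) / z * resolvent M w - (resolvent M w - 1) / w * resolvent M z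
     = (z - w) * complex_of_real D"
proof -
  define P where "P = (LINT t|M. g t)"
  define Q where "Q = (LINT t|M. t * g t)"
  define R where "R = (LINT t|M. t\<^sup>2 * g t)"
  have gm' [measurable]: "g \<in> borel_measurable M" by simp
  have ae: "AE t in M. 1 / ((1 - of_real t * z) * (1 - of_real t * w)) = complex_of_real (g t)"
     "AE t in M. of_real t / ((1 - of_real t * z) * (1 - of_real t * w)) = complex_of_real (t * g t)"
     "AE t in M. (of_real t)\<^sup>2 / ((1 - of_real t * z) * (1 - of_real t * w)) = complex_of_real (t\<^sup>2 * g t)"
    using AE_nonneg by (eventually_elim, simp flip: g)+
  have i: "integrable M (\<lambda>t. complex_of_real (g t))" "integrable M (\<lambda>t. complex_of_real (t * g t))"
    "integrable M (\<lambda>t. complex_of_real (t\<^sup>2 * g t))"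
    using integrable_resolvent2[OF z w] ae
    by (auto intro: integrable_cong_AE_imp)
  then have ir: "integrable M g" "integrable M (\<lambda>t. t * g t)" "integrable M (\<lambda>t. t\<^sup>2 * g t)"
    using complex_of_real_integrable_eq by blast+
  have P: "(LINT t|M. 1 / ((1 - of_real t * z) * (1 - of_real t * w))) = complex_of_real P"
    and Q: "(LINT t|M. of_real t / ((1 - of_real t * z) * (1 - of_real t * w))) = complex_of_real Q"
    unfolding P_def Q_def integral_complex_of_real[symmetric]
    using ae by (intro integral_cong_AE; simp)+
  have R: "(LINT t|M. (of_real t)\<^sup>2 / ((1 - of_real t * z) * (1 - of_real t * w))) = complex_of_real R"
    unfolding R_def integral_complex_of_real[symmetric]
    using ae by (intro integral_cong_AE) auto
  \<comment> \<open>Integrates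
    \<open>1 / (1 - t z) - 1 = z t (1 - t w) / ((1 - t z) (1 - t w))\<close>. The points are
    quantified anew because the formula is needed with \<open>z\<close> and \<open>w\<close>
    exchanged as well.\<close>
  have A: "(resolvent M z - 1) / z = Q - w * R" if z: "z \<in> slit" and w: "w \<in> slit" and
     QR: "(LINT t|M. of_real t / ((1 - of_real t * z) * (1 - of_real t * w))) = complex_of_real Q"
     "(LINT t|M. (of_real t)\<^sup>2 / ((1 - of_real t * z) * (1 - of_real t * w))) = complex_of_real R"
    for z w :: complex
  proof -
    have "(LINT t|M. 1 / (1 - of_real t * z)) - 1 = (LINT t|M. 1 / (1 - of_real t * z) - 1)"
      using integrable_resolvent[OF z] by simp
    also have "\<dots> = (LINT t|M. z * (of_real t / ((1 - of_real t * z) * (1 - of_real t * w))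
        - w * ((of_real t)\<^sup>2 / ((1 - of_real t * z) * (1 - of_real t * w)))))"
    proof (intro integral_cong_AE)
      show "AE t in M. 1 / (1 - of_real t * z) - 1 = z * (of_real t / ((1 - of_real t * z) * (1 - of_real t * w))
        - w * ((of_real t)\<^sup>2 / ((1 - of_real t * z) * (1 - of_real t * w))))"
        using AE_nonneg
      proof eventually_elim
        case (elim t)
        define a b where "a = 1 - of_real t * z" and "b = 1 - of_real t * w"
        have nz: "a \<noteq> 0" "b \<noteq> 0" using slit_denom z w elim by (auto simp: a_def b_def)
        have "z * (of_real t / (a * b) - w * ((of_real t)\<^sup>2 / (a * b))) = (z * of_real t) * (1 - w * of_real t) / (a * b)"
          by (simp add: power2_eq_square algebra_simps diff_divide_distrib)
        also have "\<dots> = (1 - a) * b / (a * b)" by (simp add: a_def b_def mult.commute)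
        also have "\<dots> = 1 / a - 1" using nz by (simp add: field_simps)
        finally show ?case unfolding a_def b_def by simp
      qed
    qed auto
    also have "\<dots> = z * ((LINT t|M. of_real t / ((1 - of_real t * z) * (1 - of_real t * w)))
        - w * (LINT t|M. (of_real t)\<^sup>2 / ((1 - of_real t * z) * (1 - of_real t * w))))"
      by (simp only: Bochner_Integration.integral_mult_right_zero
          Bochner_Integration.integral_diff[OF integrable_resolvent2(2)[OF z w] integrable_mult_right[OF integrable_resolvent2(3)[OF z w]]])
    also have "\<dots> = z * (Q - w * R)" by (simp only: QR)
    finally show ?thesis using slit_nz[OF z] by (simp add: resolvent_def)
  qed
  have comm: "(1 - of_real t * w) * (1 - of_real t * z) = (1 - of_real t * z) * (1 - of_real t * w)" for t
    by (rule mult.commute)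
  have N: "resolvent M z = P - w * Q" using resolvent_split[OF z w] P Q by simp
  have N': "resolvent M w = P - z * Q" using resolvent_split[OF w z] by (simp only: comm P Q)
  have Az: "(resolvent M z - 1) / z = Q - w * R" by (rule A[OF z w Q R])
  have Aw: "(resolvent M w - 1) / w = Q - z * R"
  proof (rule A[OF w z])
    show "(LINT t|M. of_real t / ((1 - of_real t * w) * (1 - of_real t * z))) = complex_of_real Q"
      by (simp only: comm Q)
    show "(LINT t|M. (of_real t)\<^sup>2 / ((1 - of_real t * w) * (1 - of_real t * z))) = complex_of_real R"
      by (simp only: comm R)
  qed
  have quad: "0 \<le> R - 2 * l * Q + l\<^sup>2 * P" for l
  proof -
    have "0 \<le> (LINT t|M. (t - l)\<^sup>2 * g t)"
      by (rule integral_nonneg_AE, use AE_nonneg in eventually_elim) (simp add: g0)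
    also have "(\<lambda>t. (t - l)\<^sup>2 * g t) = (\<lambda>t. t\<^sup>2 * g t - (2 * l) * (t * g t) + l\<^sup>2 * g t)"
      by (auto simp: power2_eq_square algebra_simps)
    finally show ?thesis using ir by (simp add: P_def Q_def R_def)
  qed
  have P0: "P \<ge> 0" unfolding P_def
    by (rule integral_nonneg_AE, use AE_nonneg in eventually_elim) (simp add: g0)
  have "Q\<^sup>2 \<le> R * P" by (rule discriminant_nonpos[OF quad P0])
  \<comment> \<open>After inserting the moments, the terms in \<open>P Q\<close> and in
    \<open>Q R\<close> cancel and the Gram determinant \<open>R P - Q^2\<close> is left.\<close>
  moreover have "(resolvent M z - 1) / z * resolvent M w - (resolvent M w - 1) / w * resolvent M z
     = (z - w) * complex_of_real (R * P - Q\<^sup>2)"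
    unfolding Az Aw unfolding N N' by (simp add: algebra_simps power2_eq_square)
  ultimately show thesis by (intro that[of "R * P - Q\<^sup>2"]) simp_all
qed

lemma kernel_of_real:
  "1 / ((1 - of_real t * z) * (1 - of_real t * cnj z)) = complex_of_real (1 / (cmod (1 - of_real t * z))\<^sup>2)"
proof -
  have "(1 - of_real t * z) * (1 - of_real t * cnj z) = complex_of_real ((cmod (1 - of_real t * z))\<^sup>2)"
    using complex_norm_square[of "1 - of_real t * z"] by simp
  then show ?thesis by simp
qed

lemma integrable_kernel:
  assumes "z \<in> slit"
  shows "integrable M (\<lambda>t. 1 / (cmod (1 - of_real t * z))\<^sup>2)"
    and "integrable M (\<lambda>t. t / (cmod (1 - of_real t * z))\<^sup>2)"
proof -
  have "integrable M (\<lambda>t. complex_of_real (1 / (cmod (1 - of_real t * z))\<^sup>2))"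
    using integrable_resolvent2(1)[OF assms, of "cnj z"] assms
    by (simp only: kernel_of_real slit_cnj)
  then show "integrable M (\<lambda>t. 1 / (cmod (1 - of_real t * z))\<^sup>2)"
    by (simp only: complex_of_real_integrable_eq)
  have "complex_of_real t / ((1 - of_real t * z) * (1 - of_real t * cnj z)) = complex_of_real (t / (cmod (1 - of_real t * z))\<^sup>2)" for t
    using kernel_of_real[of t z] by (metis divide_inverse inverse_eq_divide of_real_mult)
  then have "integrable M (\<lambda>t. complex_of_real (t / (cmod (1 - of_real t * z))\<^sup>2))"
    using integrable_resolvent2(2)[OF assms, of "cnj z"] assms
    by (simp only: slit_cnj)
  then show "integrable M (\<lambda>t. t / (cmod (1 - of_real t * z))\<^sup>2)"
    by (simp only: complex_of_real_integrable_eq)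
qed

lemma Im_resolvent:
  assumes "z \<in> slit"
  shows "Im (resolvent M z) = Im z * (LINT t|M. t / (cmod (1 - of_real t * z))\<^sup>2)"
proof -
  have "Im (resolvent M z) = (LINT t|M. Im (1 / (1 - of_real t * z)))"
    unfolding resolvent_def by (rule integral_Im[symmetric]) (rule integrable_resolvent[OF assms])
  also have "\<dots> = (LINT t|M. Im z * (t / (cmod (1 - of_real t * z))\<^sup>2))"
    by (rule Bochner_Integration.integral_cong) (simp_all add: Im_divide cmod_power2)
  also have "\<dots> = Im z * (LINT t|M. t / (cmod (1 - of_real t * z))\<^sup>2)"
    by (rule Bochner_Integration.integral_mult_right_zero)
  finally show ?thesis .
qed

lemma resolvent_of_real: "Im (resolvent M (of_real x)) = 0"
  using resolvent_cnj[of "of_real x"] by (simp add: complex_eq_iff)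

lemma eta_of_real: "Im (eta_transform M (of_real x)) = 0"
  using eta_cnj[of "of_real x"] by (simp add: complex_eq_iff)

lemma Re_resolvent_neg:
  assumes "x < 0"
  shows "Re (resolvent M (of_real x)) = (LINT t|M. 1 / (1 - t * x))"
    and "integrable M (\<lambda>t. 1 / (1 - t * x))"
proof -
  have *: "Re (1 / (1 - complex_of_real t * complex_of_real x)) = 1 / (1 - t * x)" for t
    by (metis Re_complex_of_real of_real_1 of_real_diff of_real_divide of_real_mult)
  have i: "integrable M (\<lambda>t. Re (1 / (1 - complex_of_real t * complex_of_real x)))"
    by (intro integrable_Re integrable_resolvent slit_neg assms)
  then show "integrable M (\<lambda>t. 1 / (1 - t * x))" by (simp only: *)
  have "Re (resolvent M (of_real x)) = (LINT t|M. Re (1 / (1 - of_real t * of_real x)))"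
    unfolding resolvent_def by (rule integral_Re[symmetric]) (intro integrable_resolvent slit_neg assms)
  then show "Re (resolvent M (of_real x)) = (LINT t|M. 1 / (1 - t * x))" by (simp only: *)
qed

end

lemma real_denom: "x < 0 \<Longrightarrow> 0 \<le> t \<Longrightarrow> 1 \<le> 1 - t * (x::real)"
  by (simp add: mult_nonneg_nonpos)

section \<open>Distributions other than the unit mass at 0: signs and monotonicity\<close>

locale nontrivial_dist = nonneg_dist +
  assumes nz: "M \<noteq> return borel 0"
begin

text \<open>Here the assumption that \<open>M\<close> is not the unit mass at 0 enters: a vanishing
  integral would force \<open>t = 0\<close> almost surely.\<close>

lemma integral_pos:
  assumes "integrable M f" "\<And>t. 0 \<le> t \<Longrightarrow> 0 \<le> f t" "\<And>t. 0 < t \<Longrightarrow> 0 < f t"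
  shows "0 < (LINT t|M. f t :: real)"
proof -
  have ae: "AE t in M. 0 \<le> f t" using AE_nonneg by eventually_elim (rule assms)
  then have "0 \<le> (LINT t|M. f t)" by (rule integral_nonneg_AE)
  moreover have "(LINT t|M. f t) \<noteq> 0"
  proof
    assume "(LINT t|M. f t) = 0"
    then have "AE t in M. f t = 0" using integral_nonneg_eq_0_iff_AE[OF assms(1) ae] by simp
    then have "AE t in M. t = 0" using AE_nonneg
      by eventually_elim (use assms(3) in \<open>fastforce simp: less_le\<close>)
    then show False using measure_eq_return[OF real_distribution_axioms] nz by blast
  qed
  ultimately show ?thesis by linarith
qed

lemma kernel_pos:
  assumes "z \<in> slit"
  shows "0 < (LINT t|M. t / (cmod (1 - of_real t * z))\<^sup>2)"
  using assms by (intro integral_pos integrable_kernel) (auto intro!: divide_pos_pos simp: slit_denom')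

lemma Im_resolvent_pos: "Im z > 0 \<Longrightarrow> Im (resolvent M z) > 0"
  using Im_resolvent kernel_pos slit_upper by simp

lemma resolvent_neg_bounds:
  assumes "x < 0"
  shows "0 < Re (resolvent M (of_real x))" "Re (resolvent M (of_real x)) < 1"
proof -
  note i = Re_resolvent_neg(2)[OF assms]
  show "0 < Re (resolvent M (of_real x))"
    unfolding Re_resolvent_neg(1)[OF assms] using real_denom[OF assms]
    by (intro integral_pos i) (auto intro!: divide_pos_pos divide_nonneg_pos, (smt (verit))+)
  have "0 < (LINT t|M. 1 - 1 / (1 - t * x))"
  proof (rule integral_pos)
    show "integrable M (\<lambda>t. 1 - 1 / (1 - t * x))" using i by simp
    show "0 \<le> 1 - 1 / (1 - t * x)" if "0 \<le> t" for t
      using real_denom[OF assms that] by simp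
    show "0 < 1 - 1 / (1 - t * x)" if "0 < t" for t
      using mult_pos_neg[OF that assms] by simp
  qed
  then show "Re (resolvent M (of_real x)) < 1"
    unfolding Re_resolvent_neg(1)[OF assms] using i by simp
qed

lemma resolvent_neg: "x < 0 \<Longrightarrow> resolvent M (of_real x) = of_real (Re (resolvent M (of_real x)))"
  by (simp add: complex_eq_iff resolvent_of_real)

lemma resolvent_nz: "z \<in> slit \<Longrightarrow> resolvent M z \<noteq> 0"
proof (cases "Im z = 0")
  case True
  assume "z \<in> slit"
  then have "Re z < 0" "z = of_real (Re z)" using True by (auto simp: slit_def complex_eq_iff)
  then show ?thesis using resolvent_neg_bounds(1)[of "Re z"] by (metis less_irrefl zero_complex.simps(1))
next
  case False
  assume z: "z \<in> slit"
  have "Im (resolvent M z) \<noteq> 0" using Im_resolvent[OF z] kernel_pos[OF z] False by simp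
  then show ?thesis by auto
qed

lemma eta_eq': "z \<in> slit \<Longrightarrow> eta_transform M z = 1 - 1 / resolvent M z"
  using eta_eq resolvent_nz by (simp add: diff_divide_distrib)

lemma eta_holomorphic: "eta_transform M holomorphic_on slit"
proof -
  have "(\<lambda>z. 1 - 1 / resolvent M z) holomorphic_on slit"
    by (intro holomorphic_intros resolvent_holomorphic) (auto simp: resolvent_nz)
  then show ?thesis by (rule holomorphic_transform) (simp add: eta_eq')
qed

lemma eta_quotient_holomorphic: "eta_quotient M holomorphic_on slit"
  unfolding eta_quotient_def[abs_def] by (intro holomorphic_intros eta_holomorphic) (auto simp: slit_nz)

lemma Im_eta: "z \<in> slit \<Longrightarrow> Im (eta_transform M z) = Im (resolvent M z) / (cmod (resolvent M z))\<^sup>2"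
  by (simp add: eta_eq' Im_divide cmod_power2)

lemma Im_eta_pos: "Im z > 0 \<Longrightarrow> Im (eta_transform M z) > 0"
  using Im_eta[OF slit_upper] Im_resolvent_pos resolvent_nz[OF slit_upper] by simp

lemma eta_quotient_eq: "z \<in> slit \<Longrightarrow> eta_quotient M z = (resolvent M z - 1) / z / resolvent M z"
  by (simp add: eta_quotient_def eta_eq)

text \<open>The case \<open>w = cnj z\<close> of \<open>eta_quotient_diff\<close>: dividing by
  \<open>|N(z)|^2\<close> gives \<open>k - cnj k = (z - cnj z) D / |N(z)|^2\<close> with
  \<open>D \<ge> 0\<close>. In terms of arguments, \<open>arg \<eta>(z) \<ge> arg z\<close> on the
  upper half-plane; this is what keeps the iteration inside a cone.\<close>

lemma Im_eta_quotient:
  assumes "Im z > 0" shows "Im (eta_quotient M z) \<ge> 0"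
proof -
  note z = slit_upper[OF assms]
  have n: "resolvent M z \<noteq> 0" by (rule resolvent_nz[OF z])
  obtain D where D: "D \<ge> 0" "(resolvent M z - 1) / z * resolvent M (cnj z) - (resolvent M (cnj z) - 1) / cnj z * resolvent M z
     = (z - cnj z) * complex_of_real D"
  proof (rule eta_quotient_diff[OF z _ kernel_of_real])
    show "cnj z \<in> slit" using z by (simp add: slit_cnj)
  qed auto
  have "eta_quotient M z - cnj (eta_quotient M z) =
    ((resolvent M z - 1) / z * resolvent M (cnj z) - (resolvent M (cnj z) - 1) / cnj z * resolvent M z) / (resolvent M z * cnj (resolvent M z))"
    using n slit_nz[OF z] by (simp add: eta_quotient_eq[OF z] resolvent_cnj diff_divide_distrib)
  also have "\<dots> = (z - cnj z) * complex_of_real D / of_real ((cmod (resolvent M z))\<^sup>2)"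
    unfolding D(2) complex_norm_square by simp
  finally have *: "eta_quotient M z - cnj (eta_quotient M z) = (z - cnj z) * complex_of_real (D / (cmod (resolvent M z))\<^sup>2)" by simp
  have "2 * Im (eta_quotient M z) = 2 * Im z * (D / (cmod (resolvent M z))\<^sup>2)"
    using arg_cong[OF *, of Im] by simp
  moreover have "Im z * (D / (cmod (resolvent M z))\<^sup>2) \<ge> 0" using D assms by auto
  ultimately show ?thesis by linarith
qed

definition eta_re :: "real \<Rightarrow> real" where "eta_re x = Re (eta_transform M (of_real x))"
definition quot_re :: "real \<Rightarrow> real" where "quot_re x = eta_re x / x"

lemma eta_real: "eta_transform M (of_real x) = of_real (eta_re x)"
  by (simp add: complex_eq_iff eta_of_real eta_re_def)

lemma eta_quotient_real: "eta_quotient M (of_real x) = of_real (quot_re x)"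
  by (simp add: eta_quotient_def quot_re_def eta_real)

lemma eta_re_eq: "x < 0 \<Longrightarrow> eta_re x = 1 - 1 / Re (resolvent M (of_real x))"
proof -
  assume x: "x < 0"
  have "complex_of_real (eta_re x) = of_real (1 - 1 / Re (resolvent M (of_real x)))"
    unfolding eta_real[symmetric] eta_eq'[OF slit_neg[OF x]] using resolvent_neg[OF x] by simp
  then show ?thesis using of_real_eq_iff by blast
qed

lemma eta_re_neg: "x < 0 \<Longrightarrow> eta_re x < 0"
  using resolvent_neg_bounds[of x] by (simp add: eta_re_eq)

lemma quot_re_pos: "x < 0 \<Longrightarrow> quot_re x > 0"
  using eta_re_neg by (simp add: quot_re_def divide_neg_neg)

lemma eta_re_strict_mono:
  assumes "u < v" "v < 0" shows "eta_re u < eta_re v"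
proof -
  have u: "u < 0" using assms by simp
  have "0 < (LINT t|M. 1 / (1 - t * v) - 1 / (1 - t * u))"
  proof (rule integral_pos)
    show "integrable M (\<lambda>t. 1 / (1 - t * v) - 1 / (1 - t * u))"
      using Re_resolvent_neg(2) u assms by simp
    show "0 \<le> 1 / (1 - t * v) - 1 / (1 - t * u)" if "0 \<le> t" for t
      using real_denom[OF u that] real_denom[OF assms(2) that] mult_left_mono[of u v t] assms that
      by (simp add: frac_le)
    show "0 < 1 / (1 - t * v) - 1 / (1 - t * u)" if "0 < t" for t
      using real_denom[OF u, of t] real_denom[OF assms(2), of t] assms that
      by (simp add: frac_less2)
  qed
  then have "Re (resolvent M (of_real u)) < Re (resolvent M (of_real v))"
    using Re_resolvent_neg u assms by simp
  then show ?thesis using resolvent_neg_bounds[OF u] resolvent_neg_bounds[OF assms(2)]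
    by (simp add: eta_re_eq u assms frac_less2)
qed

text \<open>The case of two negative points of \<open>eta_quotient_diff\<close>, where the weight is
  positive; division by the positive product \<open>U V\<close> of the resolvent values turns the
  identity into a comparison of the quotients.\<close>

lemma quot_re_mono:
  assumes "u \<le> v" "v < 0" shows "quot_re u \<le> quot_re v"
proof -
  have u: "u < 0" using assms by simp
  define U where "U = Re (resolvent M (of_real u))"
  define V where "V = Re (resolvent M (of_real v))"
  have U: "resolvent M (of_real u) = of_real U" "0 < U" unfolding U_def using resolvent_neg[OF u] resolvent_neg_bounds[OF u] by auto
  have V: "resolvent M (of_real v) = of_real V" "0 < V" unfolding V_def using resolvent_neg[of v] resolvent_neg_bounds[of v] assms by auto
  obtain D where D: "D \<ge> 0" "(resolvent M (of_real v) - 1) / of_real v * resolvent M (of_real u) - (resolvent M (of_real u) - 1) / of_real u * resolvent M (of_real v)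
     = (of_real v - of_real u) * complex_of_real D"
  proof (rule eta_quotient_diff[of "of_real v" "of_real u" "\<lambda>t. 1 / ((1 - t * v) * (1 - t * u))"])
    show "0 \<le> 1 / ((1 - t * v) * (1 - t * u))" if "0 \<le> t" for t
      using real_denom[OF u that] real_denom[OF assms(2) that] by simp
  qed (use slit_neg u assms in auto)
  then have "complex_of_real ((V - 1) / v * U - (U - 1) / u * V) = of_real ((v - u) * D)"
    by (simp add: U V)
  then have "(V - 1) / v * U - (U - 1) / u * V = (v - u) * D" using of_real_eq_iff by blast
  also have "\<dots> \<ge> 0" using D assms by simp
  finally have *: "(U - 1) / u * V \<le> (V - 1) / v * U" by simp
  have "quot_re u = (1 - 1 / U) / u" "quot_re v = (1 - 1 / V) / v"
    using u assms by (simp_all add: quot_re_def eta_re_eq U_def V_def)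
  moreover have "(1 - 1 / U) / u = (U - 1) / u * V / (U * V)" "(1 - 1 / V) / v = (V - 1) / v * U / (U * V)"
    using U(2) V(2) u assms by (simp_all add: diff_divide_distrib)
  moreover have "(U - 1) / u * V / (U * V) \<le> (V - 1) / v * U / (U * V)"
    using * U(2) V(2) by (intro divide_right_mono) auto
  ultimately show ?thesis by simp
qed

lemma eta_re_continuous: "continuous_on {..<0} eta_re"
proof -
  have "continuous_on slit (eta_transform M)"
    using eta_holomorphic holomorphic_on_imp_continuous_on by blast
  then have "continuous_on {..<0} (\<lambda>x. eta_transform M (complex_of_real x))"
    by (rule continuous_on_compose2) (auto simp: slit_neg intro: continuous_on_of_real_id)
  then show ?thesis unfolding eta_re_def by (rule continuous_on_Re)
qed

lemma eta_re_tendsto_0: "(eta_re \<longlongrightarrow> 0) (at_left 0)"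
proof -
  have "((\<lambda>x. Re (resolvent M (of_real x))) \<longlongrightarrow> 1) (at_left 0)"
    unfolding tendsto_at_iff_sequentially
  proof (intro allI impI)
    fix X :: "nat \<Rightarrow> real" assume X: "\<forall>i. X i \<in> {..<0} - {0}" "X \<longlonglongrightarrow> 0"
    then have neg: "X i < 0" for i by auto
    have "(\<lambda>i. LINT t|M. 1 / (1 - t * X i)) \<longlonglongrightarrow> (LINT t|M. 1)"
    proof (rule integral_dominated_convergence[where w="\<lambda>_. 1"])
      show "AE t in M. (\<lambda>i. 1 / (1 - t * X i)) \<longlonglongrightarrow> 1"
      proof (rule AE_I2)
        fix t
        have "(\<lambda>i. 1 / (1 - t * X i)) \<longlonglongrightarrow> 1 / (1 - t * 0)" by (intro tendsto_intros X) auto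
        then show "(\<lambda>i. 1 / (1 - t * X i)) \<longlonglongrightarrow> 1" by simp
      qed
      show "AE t in M. norm (1 / (1 - t * X i)) \<le> 1" for i
        using AE_nonneg
      proof eventually_elim
        case (elim t)
        show ?case using real_denom[OF neg[of i] elim] by simp
      qed
    qed auto
    then show "((\<lambda>x. Re (resolvent M (of_real x))) \<circ> X) \<longlonglongrightarrow> 1"
      by (simp add: o_def Re_resolvent_neg(1)[OF neg])
  qed
  then have "((\<lambda>x. 1 - 1 / Re (resolvent M (of_real x))) \<longlongrightarrow> 1 - 1 / 1) (at_left 0)"
    by (intro tendsto_intros) auto
  moreover have "\<forall>\<^sub>F x in at_left 0. 1 - 1 / Re (resolvent M (of_real x)) = eta_re x"
    by (auto simp: eventually_at_left_field eta_re_eq intro!: exI[of _ "-1"])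
  ultimately have "(eta_re \<longlongrightarrow> 1 - 1 / 1) (at_left 0)" by (rule Lim_transform_eventually)
  then show ?thesis by simp
qed

end

section \<open>Subordination functions\<close>

context nontrivial_dist
begin

lemma eta_inverse_eta_re: "x < 0 \<Longrightarrow> eta_inverse M (eta_re x) = x"
proof -
  assume x: "x < 0"
  have "inj_on (\<lambda>x::real. eta_transform M (complex_of_real x)) {..<0}"
    by (rule linorder_inj_onI) (use eta_re_strict_mono in \<open>force simp: eta_real\<close>)+
  then show ?thesis
    unfolding eta_inverse_def eta_real[symmetric] using x by (intro inv_into_f_f) auto
qed

lemma eta_re_inj: "u < 0 \<Longrightarrow> v < 0 \<Longrightarrow> eta_re u = eta_re v \<Longrightarrow> u = v"
  using eta_re_strict_mono[of u v] eta_re_strict_mono[of v u] by (cases u v rule: linorder_cases) auto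

lemma eta_re_mono: "u \<le> v \<Longrightarrow> v < 0 \<Longrightarrow> eta_re u \<le> eta_re v"
  using eta_re_strict_mono[of u v] by (cases "u = v") auto

text \<open>Intermediate value theorem between -1 and a point close to 0. The abscissa -1 is an
  arbitrary choice that makes the range of values explicit.\<close>

lemma eta_re_surj:
  assumes "eta_re (-1) < w" "w < 0"
  obtains x where "x < 0" "eta_re x = w"
proof -
  have "\<forall>\<^sub>F x in at_left 0. eta_re x > w" using order_tendstoD(1)[OF eta_re_tendsto_0] assms by auto
  then obtain b where b: "b < 0" "\<And>y. b < y \<Longrightarrow> y < 0 \<Longrightarrow> eta_re y > w"
    unfolding eventually_at_left_field by auto
  define v where "v = max (b/2) (-1/2)"
  have v: "v < 0" "-1 \<le> v" "eta_re v > w" using b by (auto simp: v_def max_def)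
  have "\<exists>x. -1 \<le> x \<and> x \<le> v \<and> eta_re x = w"
    using v assms by (intro IVT' continuous_on_subset[OF eta_re_continuous]) auto
  then obtain x where "x \<le> v" "eta_re x = w" by blast
  then show thesis using that[of x] v by auto
qed

lemma quot_re_continuous: "continuous_on {..<0} quot_re"
  unfolding quot_re_def by (intro continuous_on_divide eta_re_continuous continuous_on_id) auto

end

text \<open>For \<open>z\<close> in the upper half-plane this says \<open>arg z \<le> arg w < \<pi>\<close>; the lower half-plane is the mirror image.\<close>

definition cone :: "complex \<Rightarrow> complex \<Rightarrow> bool" where
  "cone z w \<longleftrightarrow> w \<in> slit \<and> (Im z > 0 \<longrightarrow> Im w > 0 \<and> Im (w * cnj z) \<ge> 0)
     \<and> (Im z < 0 \<longrightarrow> Im w < 0 \<and> Im (w * cnj z) \<le> 0) \<and> (Im z = 0 \<longrightarrow> Im w = 0)"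

lemma slit_real: "z \<in> slit \<Longrightarrow> Im z = 0 \<Longrightarrow> \<exists>x<0. z = of_real x"
  by (intro exI[of _ "Re z"]) (auto simp: slit_def complex_eq_iff)

lemma cone_cnj: "cone (cnj z) (cnj w) \<longleftrightarrow> cone z w"
  by (auto simp: cone_def slit_cnj algebra_simps)

context nontrivial_dist
begin

text \<open>The cone condition on \<open>w\<close> says that \<open>z = s + t w\<close> with real
  \<open>s \<ge> 0\<close> and \<open>t > 0\<close>. Therefore
  \<open>Im (z k) = s Im k + t Im (w k)\<close>, where \<open>Im k \<ge> 0\<close> and
  \<open>w k = \<eta>(w)\<close> lies in the open upper half-plane. The second claim is
  \<open>Im (z k cnj z) = |z|^2 Im k\<close>.\<close>

lemma cone_step_upper:
  assumes z: "Im z > 0" and w: "Im w > 0" "Im (w * cnj z) \<ge> 0"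
  shows "Im (z * eta_quotient M w) > 0" "Im (z * eta_quotient M w * cnj z) \<ge> 0"
proof -
  define k where "k = eta_quotient M w"
  have k: "Im k \<ge> 0" unfolding k_def by (rule Im_eta_quotient[OF w(1)])
  have wk: "Im (w * k) > 0" using Im_eta_pos[OF w(1)] slit_nz[OF slit_upper[OF w(1)]] by (simp add: k_def eta_quotient_def)
  define t where "t = Im z / Im w"
  have t: "t > 0" using z w by (simp add: t_def)
  have zw: "z = of_real (Im (w * cnj z) / Im w) + of_real t * w"
    using w z by (auto simp: complex_eq_iff t_def field_simps)
  have "Im (z * k) = Im (w * cnj z) / Im w * Im k + t * Im (w * k)"
    by (subst zw) (simp add: algebra_simps)
  also have "\<dots> > 0" using k wk t w by (intro add_nonneg_pos mult_nonneg_nonneg) auto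
  finally show "Im (z * eta_quotient M w) > 0" by (simp add: k_def)
  have "Im (z * k * cnj z) = (cmod z)\<^sup>2 * Im k"
    unfolding cmod_power2 by (simp add: power2_eq_square algebra_simps)
  then show "Im (z * eta_quotient M w * cnj z) \<ge> 0" using k by (simp add: k_def)
qed

lemma cone_step:
  assumes z: "z \<in> slit" and c: "cone z w"
  shows "cone z (z * eta_quotient M w)"
proof -
  consider "Im z > 0" | "Im z < 0" | "Im z = 0" by linarith
  then show ?thesis
  proof cases
    case 1
    then have "Im w > 0" "Im (w * cnj z) \<ge> 0" using c unfolding cone_def by auto
    from cone_step_upper[OF 1 this] 1 show ?thesis by (auto simp: cone_def slit_upper)
  next
    case 2
    then have "Im (cnj z) > 0" "Im (cnj w) > 0" "Im (cnj w * cnj (cnj z)) \<ge> 0"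
      using c by (auto simp: cone_def algebra_simps)
    from cone_step_upper[OF this] 2 have "cone (cnj z) (cnj z * eta_quotient M (cnj w))"
      by (auto simp: cone_def slit_upper)
    then have "cone (cnj z) (cnj (z * eta_quotient M w))" by (simp add: eta_quotient_cnj)
    then show ?thesis by (simp only: cone_cnj)
  next
    case 3
    then have "Im w = 0" "w \<in> slit" using c by (auto simp: cone_def)
    then obtain u where u: "w = of_real u" "u < 0" using slit_real by blast
    obtain x where x: "z = of_real x" "x < 0" using 3 z slit_real by blast
    have "z * eta_quotient M w = of_real (x * quot_re u)" by (simp add: u x eta_quotient_real)
    moreover have "x * quot_re u < 0" using quot_re_pos[OF u(2)] x by (simp add: mult_neg_pos)
    ultimately show ?thesis using 3 slit_neg[of "x * quot_re u"] by (auto simp: cone_def)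
  qed
qed

end

section \<open>The Riemann map of the slit plane onto the unit disc, with -1 sent to 0\<close>

definition cayley :: "complex \<Rightarrow> complex" where
  "cayley w = (csqrt (-w) - 1) / (csqrt (-w) + 1)"

definition cayley_inv :: "complex \<Rightarrow> complex" where
  "cayley_inv u = - ((1 + u) / (1 - u))\<^sup>2"

lemma slit_nonpos: "w \<in> slit \<Longrightarrow> -w \<notin> \<real>\<^sub>\<le>\<^sub>0"
  by (auto simp: slit_def complex_nonpos_Reals_iff)

lemma Re_csqrt_slit: "w \<in> slit \<Longrightarrow> Re (csqrt (-w)) > 0"
proof -
  assume w: "w \<in> slit"
  define c where "c = csqrt (-w)"
  have "c\<^sup>2 = -w" by (simp add: c_def)
  then have c: "(Re c)\<^sup>2 - (Im c)\<^sup>2 = - Re w" "2 * Re c * Im c = - Im w"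
    by (auto simp: complex_eq_iff power2_eq_square mult_ac)
  have "Re c \<ge> 0" by (simp add: c_def complex_Re_le_cmod)
  moreover have "Re c \<noteq> 0"
  proof
    assume "Re c = 0"
    then have "Re w = (Im c)\<^sup>2" "Im w = 0" using c by auto
    then have "Re w \<ge> 0" "Im w = 0" by simp_all
    then show False using w by (simp add: slit_def)
  qed
  ultimately show ?thesis by (simp add: c_def)
qed

lemma csqrt_plus_1: "w \<in> slit \<Longrightarrow> csqrt (-w) + 1 \<noteq> 0"
proof
  assume "w \<in> slit" "csqrt (-w) + 1 = 0"
  then have "Re (csqrt (-w)) + 1 = 0" "Re (csqrt (-w)) > 0"
    using Re_csqrt_slit by (metis plus_complex.sel(1) one_complex.sel(1) zero_complex.sel(1), blast)
  then show False by linarith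
qed

lemma cayley_holomorphic: "cayley holomorphic_on slit"
  unfolding cayley_def[abs_def]
proof (intro holomorphic_intros)
  show "- z \<notin> \<real>\<^sub>\<le>\<^sub>0" if "z \<in> slit" for z using slit_nonpos that by auto
  then show "- z \<notin> \<real>\<^sub>\<le>\<^sub>0" if "z \<in> slit" for z using that by auto
  show "csqrt (- z) + 1 \<noteq> 0" if "z \<in> slit" for z
    by (rule csqrt_plus_1[OF that])
qed

text \<open>The square root lies in the right half-plane, whose points are closer to 1 than to -1.
  The map serves to make the iterates uniformly bounded, as Montel's theorem requires; of the
  iterates themselves only the region in which they stay is known.\<close>

lemma norm_cayley: "w \<in> slit \<Longrightarrow> cmod (cayley w) < 1"
proof -
  assume w: "w \<in> slit"
  define s where "s = csqrt (-w)"
  have s: "Re s > 0" unfolding s_def by (rule Re_csqrt_slit[OF w])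
  have "(cmod (s - 1))\<^sup>2 < (cmod (s + 1))\<^sup>2" unfolding cmod_power2 using s by (simp add: power2_eq_square algebra_simps)
  then have "cmod (s - 1) < cmod (s + 1)" by (rule power2_less_imp_less) simp
  then show ?thesis unfolding cayley_def s_def[symmetric] norm_divide by (simp add: divide_less_eq_1)
qed

lemma cayley_inv_cayley: "w \<in> slit \<Longrightarrow> cayley_inv (cayley w) = w"
proof -
  assume w: "w \<in> slit"
  define s where "s = csqrt (-w)"
  have s: "Re s > 0" unfolding s_def by (rule Re_csqrt_slit[OF w])
  have nz: "s + 1 \<noteq> 0" unfolding s_def by (rule csqrt_plus_1[OF w])
  have "1 + (s - 1) / (s + 1) = 2 * s / (s + 1)" "1 - (s - 1) / (s + 1) = 2 / (s + 1)"
    using nz by (simp_all add: field_simps)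
  then have "(1 + cayley w) / (1 - cayley w) = s" unfolding cayley_def s_def[symmetric] using nz by simp
  then show ?thesis by (simp add: cayley_inv_def s_def)
qed

lemma cayley_inv_holomorphic: "cayley_inv holomorphic_on ball 0 1"
  unfolding cayley_inv_def[abs_def] by (intro holomorphic_intros) auto

lemma cayley_inv_slit: "cmod u < 1 \<Longrightarrow> cayley_inv u \<in> slit"
proof -
  assume u: "cmod u < 1"
  define s where "s = (1 + u) / (1 - u)"
  have "u \<noteq> 1" using u by auto
  then have n: "(cmod (1 - u))\<^sup>2 > 0" by simp
  have "(cmod u)\<^sup>2 < 1" using u by (simp add: power_less_one_iff)
  then have "Re ((1 + u) * cnj (1 - u)) > 0"
    unfolding cmod_power2 by (simp add: power2_eq_square algebra_simps)
  then have s: "Re s > 0" unfolding s_def complex_div_cnj[of "1 + u"] using n by simp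
  have "Im (s\<^sup>2) = 2 * Re s * Im s" "Re (s\<^sup>2) = (Re s)\<^sup>2 - (Im s)\<^sup>2" by (simp_all add: power2_eq_square)
  then have "- s\<^sup>2 \<in> slit" using s by (auto simp: slit_def)
  then show ?thesis by (simp add: cayley_inv_def s_def)
qed

text \<open>The facts that the boundary analysis uses: the open upper half-plane only, and
  continuity in place of holomorphy. The assumptions are symmetric in the pairs
  \<open>\<mu>1\<close>, \<open>o1\<close> and \<open>\<mu>2\<close>, \<open>o2\<close>, so each
  result may be applied with the roles exchanged.\<close>

locale subord = A: nontrivial_dist \<mu>1 + B: nontrivial_dist \<mu>2 + C: nontrivial_dist \<nu>
  for \<mu>1 \<mu>2 \<nu> :: "real measure" +
  fixes o1 o2 :: "complex \<Rightarrow> complex"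
  assumes cont1: "continuous_on {z. Im z > 0} o1" and cont2: "continuous_on {z. Im z > 0} o2"
    and upper1: "Im z > 0 \<Longrightarrow> Im (o1 z) > 0" and upper2: "Im z > 0 \<Longrightarrow> Im (o2 z) > 0"
    and cone1: "Im z > 0 \<Longrightarrow> Im (o1 z * cnj z) \<ge> 0" and cone2: "Im z > 0 \<Longrightarrow> Im (o2 z * cnj z) \<ge> 0"
    and resolvent1: "Im z > 0 \<Longrightarrow> resolvent \<mu>1 (o1 z) = resolvent \<nu> z"
    and resolvent2: "Im z > 0 \<Longrightarrow> resolvent \<mu>2 (o2 z) = resolvent \<nu> z"
    and o_prod: "Im z > 0 \<Longrightarrow> o1 z * o2 z = z * eta_transform \<nu> z"

section \<open>Construction of the subordination functions by iteration\<close>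

locale mult_conv = A: nontrivial_dist \<mu>1 + B: nontrivial_dist \<mu>2 + C: nontrivial_dist \<nu>
  for \<mu>1 \<mu>2 \<nu> :: "real measure" +
  assumes conv: "free_mult_convolution \<mu>1 \<mu>2 \<nu>"
begin

text \<open>The relation between the inverses, rewritten through preimages \<open>p1\<close>,
  \<open>p2\<close>, \<open>x\<close> of one value \<open>w\<close>. From here on no inverse
  function is needed.\<close>

lemma conv_real:
  obtains e where "e > 0"
    "\<And>w. -e < w \<Longrightarrow> w < 0 \<Longrightarrow> \<exists>p1 p2 x. p1 < 0 \<and> p2 < 0 \<and> x < 0 \<and> A.eta_re p1 = w \<and> B.eta_re p2 = w \<and> C.eta_re x = w \<and> x * w = p1 * p2"
proof -
  have "\<forall>\<^sub>F w in at_left 0. eta_inverse \<nu> w = 1 / w * eta_inverse \<mu>1 w * eta_inverse \<mu>2 w"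
    using conv by (simp add: free_mult_convolution_def)
  then obtain b where b: "b < 0"
    "\<And>w. b < w \<Longrightarrow> w < 0 \<Longrightarrow> eta_inverse \<nu> w = 1 / w * eta_inverse \<mu>1 w * eta_inverse \<mu>2 w"
    unfolding eventually_at_left_field by auto
  \<comment> \<open>For \<open>-e < w < 0\<close> the relation holds and \<open>w\<close> exceeds
    all three values at -1, so that the three preimages exist.\<close>
  define e where "e = Min {-b, - A.eta_re (-1), - B.eta_re (-1), - C.eta_re (-1)}"
  have e: "e > 0" using b A.eta_re_neg[of "-1"] B.eta_re_neg[of "-1"] C.eta_re_neg[of "-1"] by (auto simp: e_def)
  have e': "e \<le> -b" "e \<le> - A.eta_re (-1)" "e \<le> - B.eta_re (-1)" "e \<le> - C.eta_re (-1)" by (auto simp: e_def)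
  show thesis
  proof (rule that[OF e])
    fix w assume w: "-e < w" "w < 0"
    obtain p1 where p1: "p1 < 0" "A.eta_re p1 = w" using A.eta_re_surj[of w] w e' by auto
    obtain p2 where p2: "p2 < 0" "B.eta_re p2 = w" using B.eta_re_surj[of w] w e' by auto
    obtain x where x: "x < 0" "C.eta_re x = w" using C.eta_re_surj[of w] w e' by auto
    have "x = 1 / w * p1 * p2"
      using b(2)[of w] w e' A.eta_inverse_eta_re[OF p1(1)] B.eta_inverse_eta_re[OF p2(1)] C.eta_inverse_eta_re[OF x(1)]
      by (simp add: p1 p2 x)
    then have "x * w = p1 * p2" using w by simp
    then show "\<exists>p1 p2 x. p1 < 0 \<and> p2 < 0 \<and> x < 0 \<and> A.eta_re p1 = w \<and> B.eta_re p2 = w \<and> C.eta_re x = w \<and> x * w = p1 * p2"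
      using p1 p2 x by blast
  qed
qed

text \<open>If \<open>p\<close> is a fixed point and \<open>q = x k1(p)\<close>, then
  \<open>p = x k2(q)\<close>, and the product \<open>p q\<close> equals both
  \<open>x \<eta>1(p)\<close> and \<open>x \<eta>2(q)\<close>. So fixed points are the pairs with
  \<open>\<eta>1(p) = \<eta>2(q)\<close> and \<open>p q = x \<eta>1(p)\<close>, the form in which
  the convolution relation appears.\<close>

definition fixpoint_map :: "real \<Rightarrow> real \<Rightarrow> real" where
  "fixpoint_map x u = x * B.quot_re (x * A.quot_re u)"

text \<open>The quotient \<open>k\<close> and \<open>\<eta>(x) = x k(x)\<close> are both increasing on the negative axis, so the map is increasing and
  does not expand ratios: every point moves towards the fixed point without passing it.\<close>

lemma fixpoint_map_step:
  assumes x: "x < 0" and p: "p < 0" "q < 0" "A.eta_re p = w" "B.eta_re q = w" "x * w = p * q" and u: "u < 0"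
  shows "fixpoint_map x p = p" "x * A.quot_re p = q"
    "u \<le> p \<Longrightarrow> u \<le> fixpoint_map x u \<and> fixpoint_map x u \<le> p" "p \<le> u \<Longrightarrow> p \<le> fixpoint_map x u \<and> fixpoint_map x u \<le> u"
proof -
  have w: "w < 0" using A.eta_re_neg p by auto
  show q: "x * A.quot_re p = q" using p by (simp add: A.quot_re_def field_simps)
  show fp: "fixpoint_map x p = p" unfolding fixpoint_map_def q using p by (simp add: B.quot_re_def field_simps)
  define c where "c = A.quot_re u"
  have c: "c > 0" unfolding c_def by (rule A.quot_re_pos[OF u])
  define v where "v = x * c"
  have v: "v < 0" using x c by (simp add: v_def mult_neg_pos)
  have f: "fixpoint_map x u = x * B.eta_re v / v" by (simp add: fixpoint_map_def v_def c_def B.quot_re_def)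
  \<comment> \<open>In this form monotonicity of \<open>B.eta_re\<close> compares the image with
    \<open>w / c\<close>, and \<open>A.eta_re u = u * c\<close> compares \<open>w / c\<close> with
    \<open>u\<close>.\<close>
  have f': "fixpoint_map x u = B.eta_re v / c" using f x c by (simp add: v_def)
  have cu: "A.eta_re u = u * c" using u by (simp add: c_def A.quot_re_def)
  { assume le: "u \<le> p"
    have "c \<le> A.quot_re p" unfolding c_def by (rule A.quot_re_mono) (use le p in auto)
    then have qv: "q \<le> v" using x by (simp add: v_def flip: q)
    have "B.quot_re q \<le> B.quot_re v" by (rule B.quot_re_mono[OF qv v])
    then have "fixpoint_map x u \<le> fixpoint_map x p" using x unfolding fixpoint_map_def q v_def c_def by simp
    moreover have "w \<le> B.eta_re v" using B.eta_re_mono[OF qv v] p by simp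
    then have "fixpoint_map x u \<ge> w / c" unfolding f' using c by (intro divide_right_mono) auto
    moreover have "w / c \<ge> u" using A.eta_re_mono[OF le p(1)] p cu c by (simp add: field_simps)
    ultimately show "u \<le> fixpoint_map x u \<and> fixpoint_map x u \<le> p" using fp by auto }
  { assume le: "p \<le> u"
    have "A.quot_re p \<le> c" unfolding c_def by (rule A.quot_re_mono[OF le u])
    then have qv: "v \<le> q" using x by (simp add: v_def flip: q)
    have "B.quot_re v \<le> B.quot_re q" by (rule B.quot_re_mono[OF qv p(2)])
    then have "fixpoint_map x p \<le> fixpoint_map x u" using x unfolding fixpoint_map_def q v_def c_def by simp
    moreover have "B.eta_re v \<le> w" using B.eta_re_mono[OF qv p(2)] p by simp
    then have "fixpoint_map x u \<le> w / c" unfolding f' using c by (intro divide_right_mono) auto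
    moreover have "w / c \<le> u" using A.eta_re_mono[OF le u] p cu c by (simp add: field_simps)
    ultimately show "p \<le> fixpoint_map x u \<and> fixpoint_map x u \<le> u" using fp by auto }
qed

lemma fixpoint_map_tendsto:
  assumes x: "x < 0" and X: "\<And>n. X n < 0" "X \<longlonglongrightarrow> L" "L < 0"
  shows "(\<lambda>n. fixpoint_map x (X n)) \<longlonglongrightarrow> fixpoint_map x L"
proof -
  have cA: "isCont A.quot_re y" if "y < 0" for y
    using A.quot_re_continuous that by (auto simp: continuous_on_eq_continuous_at)
  have cB: "isCont B.quot_re y" if "y < 0" for y
    using B.quot_re_continuous that by (auto simp: continuous_on_eq_continuous_at)
  have "(\<lambda>n. A.quot_re (X n)) \<longlonglongrightarrow> A.quot_re L" by (rule isCont_tendsto_compose[OF cA[OF X(3)] X(2)])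
  then have "(\<lambda>n. x * A.quot_re (X n)) \<longlonglongrightarrow> x * A.quot_re L" by (intro tendsto_intros)
  moreover have "x * A.quot_re L < 0" using x A.quot_re_pos[OF X(3)] by (simp add: mult_neg_pos)
  ultimately have "(\<lambda>n. B.quot_re (x * A.quot_re (X n))) \<longlonglongrightarrow> B.quot_re (x * A.quot_re L)"
    using isCont_tendsto_compose cB by blast
  then show ?thesis unfolding fixpoint_map_def by (intro tendsto_intros)
qed

text \<open>The iterates are monotone and bounded by \<open>p\<close>, hence tend to some fixed
  point \<open>L\<close>. To see \<open>L = p\<close>, apply the convolution relation at the level
  \<open>w' = A.eta_re L\<close>: its preimages under the first two maps are \<open>L\<close> and
  \<open>v\<close>, and \<open>L * v = x * w'\<close> shows that the third preimage is
  \<open>x\<close> itself, so \<open>w' = C.eta_re x\<close>.\<close>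

lemma iterates_converge:
  obtains s where "s > 0"
    "\<And>x. -s < x \<Longrightarrow> x < 0 \<Longrightarrow> \<exists>p<0. A.eta_re p = C.eta_re x \<and> B.eta_re (x * A.quot_re p) = C.eta_re x \<and> (\<lambda>n. (fixpoint_map x ^^ n) x) \<longlonglongrightarrow> p"
proof -
  obtain e where e: "e > 0"
    "\<And>w. -e < w \<Longrightarrow> w < 0 \<Longrightarrow> \<exists>p1 p2 x. p1 < 0 \<and> p2 < 0 \<and> x < 0 \<and> A.eta_re p1 = w \<and> B.eta_re p2 = w \<and> C.eta_re x = w \<and> x * w = p1 * p2"
    using conv_real by blast
  \<comment> \<open>The second bound is for the limit: iterates rising from \<open>x\<close> have a
    limit to the right of \<open>x\<close>, so the convolution relation is available at its level
    too.\<close>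
  have "\<forall>\<^sub>F x in at_left 0. C.eta_re x > -e \<and> A.eta_re x > -e"
    using order_tendstoD(1)[OF C.eta_re_tendsto_0, of "-e"] order_tendstoD(1)[OF A.eta_re_tendsto_0, of "-e"] e
    by (auto intro: eventually_conj)
  then obtain b where b: "b < 0" "\<And>x. b < x \<Longrightarrow> x < 0 \<Longrightarrow> C.eta_re x > -e \<and> A.eta_re x > -e"
    unfolding eventually_at_left_field by auto
  show thesis
  proof (rule that[of "-b"])
    fix x assume x: "- (- b) < x" "x < 0"
    define w where "w = C.eta_re x"
    have w: "-e < w" "w < 0" using b x C.eta_re_neg by (auto simp: w_def)
    obtain p q x' where p: "p < 0" "q < 0" "x' < 0" "A.eta_re p = w" "B.eta_re q = w" "C.eta_re x' = w" "x' * w = p * q"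
      using e(2)[OF w] by blast
    have "x' = x" using C.eta_re_inj[of x' x] p x by (simp add: w_def)
    with p have p5: "x * w = p * q" by simp
    note st = fixpoint_map_step[OF x(2) p(1,2,4,5) p5]
    define X where "X n = (fixpoint_map x ^^ n) x" for n
    have X0: "X 0 = x" and XS: "X (Suc n) = fixpoint_map x (X n)" for n by (simp_all add: X_def)
    have "\<exists>L. X \<longlonglongrightarrow> L \<and> L < 0 \<and> A.eta_re L > -e \<and> (\<forall>n. X n < 0)"
    proof (cases "x \<le> p")
      case True
      have inv: "x \<le> X n \<and> X n \<le> p" for n
      proof (induction n)
        case (Suc n)
        then show ?case using st(3)[of "X n"] p by (force simp: XS)
      qed (use True in \<open>simp add: X0\<close>)
      have neg: "X n < 0" for n using inv[of n] p by linarith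
      have "incseq X" unfolding incseq_Suc_iff XS using st(3)[OF neg] inv by blast
      then obtain L where L: "X \<longlonglongrightarrow> L" "\<And>n. X n \<le> L"
        using incseq_convergent[of X p] inv by blast
      have "L \<le> p" using LIMSEQ_le_const2[OF L(1), of p] inv by blast
      moreover have "x \<le> L" using L(2)[of 0] X0 by simp
      ultimately have "L < 0" "A.eta_re x \<le> A.eta_re L" using p by (auto intro!: A.eta_re_mono)
      then show ?thesis using L b x neg by force
    next
      case False
      have inv: "p \<le> X n \<and> X n \<le> x" for n
      proof (induction n)
        case (Suc n)
        then show ?case using st(4)[of "X n"] x by (force simp: XS)
      qed (use False in \<open>simp add: X0\<close>)
      have neg: "X n < 0" for n using inv[of n] x by linarith
      have "decseq X" unfolding decseq_Suc_iff XS using st(4)[OF neg] inv by blast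
      then obtain L where L: "X \<longlonglongrightarrow> L" "\<And>n. L \<le> X n"
        using decseq_convergent[of X p] inv by blast
      have "p \<le> L" using LIMSEQ_le_const[OF L(1), of p] inv by blast
      moreover have "L \<le> x" using L(2)[of 0] X0 by simp
      ultimately have "L < 0" "A.eta_re p \<le> A.eta_re L" using x by (auto intro!: A.eta_re_mono)
      then show ?thesis using L p w neg by force
    qed
    then obtain L where L: "X \<longlonglongrightarrow> L" "L < 0" "A.eta_re L > -e" "\<And>n. X n < 0" by blast
    have "(\<lambda>n. X (Suc n)) \<longlonglongrightarrow> fixpoint_map x L" unfolding XS by (rule fixpoint_map_tendsto) (use x L in auto)
    then have fL: "fixpoint_map x L = L" using LIMSEQ_unique LIMSEQ_Suc[OF L(1)] by blast
    define w' where "w' = A.eta_re L"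
    define v where "v = x * A.quot_re L"
    have v: "v < 0" using x A.quot_re_pos[OF L(2)] by (simp add: v_def mult_neg_pos)
    have Lv: "L * v = x * w'" using L by (simp add: v_def w'_def A.quot_re_def)
    have "L * v = x * B.eta_re v" using fL v by (simp add: fixpoint_map_def v_def[symmetric] B.quot_re_def field_simps)
    then have Bv: "B.eta_re v = w'" using Lv x by simp
    obtain p' q' x' where p': "p' < 0" "q' < 0" "x' < 0" "A.eta_re p' = w'" "B.eta_re q' = w'" "C.eta_re x' = w'" "x' * w' = p' * q'"
      using e(2)[of w'] L A.eta_re_neg[OF L(2)] by (auto simp: w'_def)
    have "p' = L" "q' = v" using A.eta_re_inj[of p' L] B.eta_re_inj[of q' v] p' L v Bv by (auto simp: w'_def)
    then have "x' * w' = x * w'" using Lv p' by simp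
    then have "x' = x" using A.eta_re_neg[OF L(2)] by (simp add: w'_def)
    then have "w' = w" using p' by (simp add: w_def)
    then have "L = p" using A.eta_re_inj[of L p] L p by (simp add: w'_def)
    then have "X \<longlonglongrightarrow> p" using L by simp
    then show "\<exists>p<0. A.eta_re p = C.eta_re x \<and> B.eta_re (x * A.quot_re p) = C.eta_re x \<and> (\<lambda>n. (fixpoint_map x ^^ n) x) \<longlonglongrightarrow> p"
      using p st(2)[OF p(1)] by (auto simp: X_def[abs_def] w_def)
  qed (use b in auto)
qed

fun subord_iterate :: "nat \<Rightarrow> complex \<Rightarrow> complex" where
  "subord_iterate 0 z = z"
| "subord_iterate (Suc n) z = z * eta_quotient \<mu>2 (z * eta_quotient \<mu>1 (subord_iterate n z))"

lemma subord_iterate_cone: "z \<in> slit \<Longrightarrow> cone z (subord_iterate n z)"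
proof (induction n)
  case 0
  then show ?case by (auto simp: cone_def)
next
  case (Suc n)
  then show ?case by (auto intro: A.cone_step B.cone_step)
qed

lemma subord_iterate_slit: "z \<in> slit \<Longrightarrow> subord_iterate n z \<in> slit"
  using subord_iterate_cone cone_def by blast

lemma subord_iterate_holomorphic: "subord_iterate n holomorphic_on slit"
proof (induction n)
  case (Suc n)
  have 1: "(\<lambda>z. eta_quotient \<mu>1 (subord_iterate n z)) holomorphic_on slit"
    using holomorphic_on_compose_gen[OF Suc A.eta_quotient_holomorphic] subord_iterate_slit by (auto simp: o_def)
  have 2: "(\<lambda>z. z * eta_quotient \<mu>1 (subord_iterate n z)) holomorphic_on slit" by (intro holomorphic_intros 1)
  have "(\<lambda>z. z * eta_quotient \<mu>1 (subord_iterate n z)) ` slit \<subseteq> slit"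
    using A.cone_step[OF _ subord_iterate_cone] by (auto simp: cone_def)
  then have "(\<lambda>z. eta_quotient \<mu>2 (z * eta_quotient \<mu>1 (subord_iterate n z))) holomorphic_on slit"
    using holomorphic_on_compose_gen[OF 2 B.eta_quotient_holomorphic] by (simp add: o_def)
  then show ?case by (auto intro!: holomorphic_intros)
qed (auto intro!: holomorphic_intros simp: fun_eq_iff cong: holomorphic_cong)

lemma subord_iterate_real: "subord_iterate n (of_real x) = of_real ((fixpoint_map x ^^ n) x)"
proof (induction n)
  case (Suc n)
  show ?case unfolding subord_iterate.simps Suc A.eta_quotient_real of_real_mult[symmetric] B.eta_quotient_real
    unfolding funpow.simps o_apply by (simp only: fixpoint_map_def[of x "(fixpoint_map x ^^ n) x"])
qed simp

text \<open>A subsequential limit is enough: its values on the interval \<open>(-s, 0)\<close> are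
  known, and both equations for \<eta> extend from there by the identity theorem. The cone condition
  passes to the limit because its inequalities become closed ones.\<close>

theorem subord_exists: "\<exists>o1 o2. subord \<mu>1 \<mu>2 \<nu> o1 o2"
proof -
  obtain s where s: "s > 0"
    "\<And>x. -s < x \<Longrightarrow> x < 0 \<Longrightarrow> \<exists>p<0. A.eta_re p = C.eta_re x \<and> B.eta_re (x * A.quot_re p) = C.eta_re x \<and> (\<lambda>n. (fixpoint_map x ^^ n) x) \<longlonglongrightarrow> p"
    using iterates_converge by blast
  define Gn where "Gn n = cayley \<circ> subord_iterate n" for n
  have Gh: "Gn n holomorphic_on slit" for n
    unfolding Gn_def using subord_iterate_slit by (intro holomorphic_on_compose_gen[OF subord_iterate_holomorphic cayley_holomorphic]) auto
  have Gb: "cmod (Gn n z) < 1" if "z \<in> slit" for n z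
    using norm_cayley subord_iterate_slit that by (simp add: Gn_def)
  obtain g r where g: "g holomorphic_on slit" "strict_mono (r :: nat \<Rightarrow> nat)"
    "\<And>z. z \<in> slit \<Longrightarrow> (\<lambda>n. Gn (r n) z) \<longlonglongrightarrow> g z"
  proof (rule Montel[of slit "range Gn" Gn])
    show "\<exists>B. \<forall>h\<in>range Gn. \<forall>z\<in>K. cmod (h z) \<le> B" if "compact K" "K \<subseteq> slit" for K
      using Gb that by (intro exI[of _ 1]) (force intro: less_imp_le)
  qed (use Gh open_slit in auto)
  have g1: "cmod (g z) \<le> 1" if "z \<in> slit" for z
    by (rule LIMSEQ_le_const2[OF tendsto_norm[OF g(3)[OF that]]]) (use Gb[OF that] in \<open>auto intro: less_imp_le\<close>)
  have cayley_cont: "isCont cayley w" if "w \<in> slit" for w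
    using cayley_holomorphic that open_slit by (metis continuous_on_eq_continuous_at holomorphic_on_imp_continuous_on)
  have cayley_inv_cont: "isCont cayley_inv w" if "cmod w < 1" for w
    using cayley_inv_holomorphic that by (metis continuous_on_eq_continuous_at holomorphic_on_imp_continuous_on open_ball mem_ball_0)
  have greal: "\<exists>p<0. A.eta_re p = C.eta_re x \<and> B.eta_re (x * A.quot_re p) = C.eta_re x \<and> g (of_real x) = cayley (of_real p)"
    if x: "-s < x" "x < 0" for x
  proof -
    obtain p where p: "p < 0" "A.eta_re p = C.eta_re x" "B.eta_re (x * A.quot_re p) = C.eta_re x" "(\<lambda>n. (fixpoint_map x ^^ n) x) \<longlonglongrightarrow> p"
      using s(2)[OF x] by blast
    have "(\<lambda>n. subord_iterate n (of_real x)) \<longlonglongrightarrow> of_real p" unfolding subord_iterate_real by (intro tendsto_intros p)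
    then have "(\<lambda>n. cayley (subord_iterate n (of_real x))) \<longlonglongrightarrow> cayley (of_real p)"
      by (rule isCont_tendsto_compose[OF cayley_cont[OF slit_neg[OF p(1)]]])
    then have "(\<lambda>n. Gn n (of_real x)) \<longlonglongrightarrow> cayley (of_real p)" by (simp add: Gn_def)
    then have "(\<lambda>n. Gn (r n) (of_real x)) \<longlonglongrightarrow> cayley (of_real p)"
      using LIMSEQ_subseq_LIMSEQ[OF _ g(2)] by (fastforce simp: o_def)
    then have "g (of_real x) = cayley (of_real p)" using LIMSEQ_unique g(3)[OF slit_neg[OF x(2)]] by blast
    then show ?thesis using p by blast
  qed
  \<comment> \<open>The limit could a priori reach the unit circle, which corresponds to iterates
    escaping to the slit or to infinity. By the maximum principle \<open>g\<close> would then be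
    constant of modulus 1, contrary to its value at \<open>-s/2\<close>.\<close>
  have glt: "cmod (g z) < 1" if z: "z \<in> slit" for z
  proof (rule ccontr)
    assume "\<not> cmod (g z) < 1"
    then have gz: "cmod (g z) = 1" using g1[OF z] by simp
    have "g constant_on slit"
      by (rule maximum_modulus_principle[OF g(1) open_slit connected_slit open_slit order_refl z]) (simp add: gz g1)
    then have "g (of_real (-s/2)) = g z" using z s slit_neg[of "-s/2"] by (auto simp: constant_on_def)
    moreover obtain p where "p < 0" "g (of_real (-s/2)) = cayley (of_real p)" using greal[of "-s/2"] s by auto
    ultimately show False using gz norm_cayley[OF slit_neg] by fastforce
  qed
  define o1 where "o1 z = cayley_inv (g z)" for z
  define o2 where "o2 z = z * eta_quotient \<mu>1 (o1 z)" for z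
  have o1h: "o1 holomorphic_on slit"
    using holomorphic_on_compose_gen[OF g(1) cayley_inv_holomorphic] glt
    by (force simp: o_def o1_def[abs_def])
  have o1s: "o1 z \<in> slit" if "z \<in> slit" for z using cayley_inv_slit glt that by (simp add: o1_def)
  have lim: "(\<lambda>n. subord_iterate (r n) z) \<longlonglongrightarrow> o1 z" if z: "z \<in> slit" for z
  proof -
    have "(\<lambda>n. cayley_inv (Gn (r n) z)) \<longlonglongrightarrow> cayley_inv (g z)"
      by (rule isCont_tendsto_compose[OF cayley_inv_cont[OF glt[OF z]] g(3)[OF z]])
    then show ?thesis using subord_iterate_slit[OF z] by (simp add: Gn_def o1_def cayley_inv_cayley)
  qed
  have isl: "(of_real (-s/2) :: complex) islimpt (of_real ` {-s<..<0})"
  proof -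
    have "(-s/2) islimpt {-s<..<0}" using s by (intro open_imp_islimpt) auto
    then show ?thesis
      unfolding islimpt_sequential
    proof (elim exE conjE)
      fix f :: "nat \<Rightarrow> real" assume f: "\<forall>n. f n \<in> {-s<..<0} - {-s/2}" "f \<longlonglongrightarrow> -s/2"
      show "\<exists>f. (\<forall>n. f n \<in> complex_of_real ` {-s<..<0} - {of_real (-s/2)}) \<and> f \<longlonglongrightarrow> of_real (-s/2)"
        using f by (intro exI[of _ "\<lambda>n. of_real (f n)"] conjI tendsto_of_real)
          (auto simp del: of_real_divide of_real_minus)
    qed
  qed
  have o1real: "\<exists>p<0. A.eta_re p = C.eta_re x \<and> B.eta_re (x * A.quot_re p) = C.eta_re x \<and> o1 (of_real x) = of_real p"
    if "-s < x" "x < 0" for x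
    using greal[OF that] cayley_inv_cayley slit_neg by (fastforce simp: o1_def)
  have eta1: "eta_transform \<mu>1 (o1 z) = eta_transform \<nu> z" if z: "z \<in> slit" for z
  proof -
    have "(\<lambda>z. eta_transform \<mu>1 (o1 z)) holomorphic_on slit"
      using holomorphic_on_compose_gen[OF o1h A.eta_holomorphic] o1s by (auto simp: o_def)
    then have h: "(\<lambda>z. eta_transform \<mu>1 (o1 z) - eta_transform \<nu> z) holomorphic_on slit"
      by (intro holomorphic_intros C.eta_holomorphic)
    have "eta_transform \<mu>1 (o1 z) - eta_transform \<nu> z = 0"
    proof (rule analytic_continuation[OF h open_slit connected_slit _ _ isl _ z])
      show "eta_transform \<mu>1 (o1 z) - eta_transform \<nu> z = 0" if zi: "z \<in> of_real ` {-s<..<0}" for z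
      proof -
        obtain x where x: "z = of_real x" "-s < x" "x < 0" using zi by auto
        obtain p where "p < 0" "A.eta_re p = C.eta_re x" "o1 z = of_real p" using o1real x by blast
        then show ?thesis by (simp add: x A.eta_real C.eta_real)
      qed
    qed (use s slit_neg[of "-s/2"] slit_neg in auto)
    then show ?thesis by simp
  qed
  have o1cone: "cone z (o1 z)" if z: "z \<in> slit" for z
  proof -
    \<comment> \<open>Restores the strict inequality lost in the limit: a real \<open>o1 z\<close>
      would give a real value of \<eta> at a nonreal \<open>z\<close>.\<close>
    have i0: "Im z = 0" if "Im (o1 z) = 0"
    proof (rule ccontr)
      assume "Im z \<noteq> 0"
      have "Im (eta_transform \<nu> z) \<noteq> 0"
        using \<open>Im z \<noteq> 0\<close> C.Im_eta[OF z] C.Im_resolvent[OF z] C.kernel_pos[OF z] C.resolvent_nz[OF z] by simp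
      moreover have "o1 z = of_real (Re (o1 z))" using that by (simp add: complex_eq_iff)
      then have "Im (eta_transform \<mu>1 (o1 z)) = 0" using A.eta_of_real by metis
      ultimately show False using eta1[OF z] by simp
    qed
    have l1: "(\<lambda>n. Im (subord_iterate (r n) z)) \<longlonglongrightarrow> Im (o1 z)" by (intro tendsto_intros lim z)
    have l2: "(\<lambda>n. Im (subord_iterate (r n) z * cnj z)) \<longlonglongrightarrow> Im (o1 z * cnj z)" by (intro tendsto_intros lim z)
    have c: "cone z (subord_iterate (r n) z)" for n by (rule subord_iterate_cone[OF z])
    have "Im (o1 z) \<ge> 0 \<and> Im (o1 z * cnj z) \<ge> 0" if "Im z > 0"
      using c that unfolding cone_def by (intro conjI LIMSEQ_le_const[OF l1] LIMSEQ_le_const[OF l2]) (auto intro: less_imp_le)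
    moreover have "Im (o1 z) \<le> 0 \<and> Im (o1 z * cnj z) \<le> 0" if "Im z < 0"
      using c that unfolding cone_def by (intro conjI LIMSEQ_le_const2[OF l1] LIMSEQ_le_const2[OF l2]) (auto intro: less_imp_le)
    moreover have "Im (o1 z) = 0" if "Im z = 0"
      using c that l1 unfolding cone_def by (auto simp: LIMSEQ_const_iff)
    ultimately show ?thesis using o1s[OF z] i0 unfolding cone_def by force
  qed
  have o2cone: "cone z (o2 z)" if "z \<in> slit" for z
    unfolding o2_def by (rule A.cone_step[OF that o1cone[OF that]])
  have o2h: "o2 holomorphic_on slit"
  proof -
    have "(\<lambda>z. eta_quotient \<mu>1 (o1 z)) holomorphic_on slit"
      using holomorphic_on_compose_gen[OF o1h A.eta_quotient_holomorphic] o1s by (auto simp: o_def)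
    then show ?thesis unfolding o2_def[abs_def] by (intro holomorphic_intros)
  qed
  have eta2: "eta_transform \<mu>2 (o2 z) = eta_transform \<nu> z" if z: "z \<in> slit" for z
  proof -
    have "(\<lambda>z. eta_transform \<mu>2 (o2 z)) holomorphic_on slit"
      using holomorphic_on_compose_gen[OF o2h B.eta_holomorphic] o2cone by (auto simp: o_def cone_def)
    then have h: "(\<lambda>z. eta_transform \<mu>2 (o2 z) - eta_transform \<nu> z) holomorphic_on slit"
      by (intro holomorphic_intros C.eta_holomorphic)
    have "eta_transform \<mu>2 (o2 z) - eta_transform \<nu> z = 0"
    proof (rule analytic_continuation[OF h open_slit connected_slit _ _ isl _ z])
      show "eta_transform \<mu>2 (o2 z) - eta_transform \<nu> z = 0" if zi: "z \<in> of_real ` {-s<..<0}" for z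
      proof -
        obtain x where x: "z = of_real x" "-s < x" "x < 0" using zi by auto
        obtain p where p: "p < 0" "B.eta_re (x * A.quot_re p) = C.eta_re x" "o1 z = of_real p" using o1real x by blast
        have "o2 z = of_real (x * A.quot_re p)" unfolding o2_def p(3) A.eta_quotient_real by (simp add: x(1))
        then have "eta_transform \<mu>2 (o2 z) = of_real (B.eta_re (x * A.quot_re p))" by (simp only: B.eta_real)
        then show ?thesis by (simp add: x p C.eta_real)
      qed
    qed (use s slit_neg[of "-s/2"] slit_neg in auto)
    then show ?thesis by simp
  qed
  have "subord \<mu>1 \<mu>2 \<nu> o1 o2"
  proof
    show "continuous_on {z. Im z > 0} o1" "continuous_on {z. Im z > 0} o2"
      using o1h o2h by (auto intro!: holomorphic_on_imp_continuous_on elim!: holomorphic_on_subset simp: slit_upper)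
    fix z :: complex assume z: "Im z > 0"
    note zs = slit_upper[OF z]
    show c: "Im (o1 z) > 0" "Im (o2 z) > 0" "Im (o1 z * cnj z) \<ge> 0" "Im (o2 z * cnj z) \<ge> 0"
      using o1cone[OF zs] o2cone[OF zs] z by (auto simp: cone_def)
    show "resolvent \<mu>1 (o1 z) = resolvent \<nu> z"
      using eta1[OF zs] A.eta_eq'[OF slit_upper[OF c(1)]] C.eta_eq'[OF zs] by simp
    show "resolvent \<mu>2 (o2 z) = resolvent \<nu> z"
      using eta2[OF zs] B.eta_eq'[OF slit_upper[OF c(2)]] C.eta_eq'[OF zs] by simp
    have "o1 z * o2 z = z * eta_transform \<mu>1 (o1 z)"
      using slit_nz[OF slit_upper[OF c(1)]] by (simp add: o2_def eta_quotient_def)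
    then show "o1 z * o2 z = z * eta_transform \<nu> z" using eta1[OF zs] by simp
  qed
  then show ?thesis by blast
qed

end

section \<open>Atoms and boundary behaviour\<close>

text \<open>Mean value theorem with the crude estimate
  \<open>cos y \<ge> 1 - y^2 / 2 \<ge> 1 - x\<close> for \<open>0 < y < x \<le> 1\<close>.\<close>

lemma sin_lower_bound:
  assumes "0 \<le> x" "x \<le> 1" shows "(1 - x) * x \<le> sin (x::real)"
proof (cases "x = 0")
  case False
  then have x: "0 < x" using assms by simp
  obtain y where y: "0 < y" "y < x" "sin x - sin 0 = (x - 0) * cos y"
    using MVT2[of 0 x sin cos] x by auto
  have "cos y = 1 - 2 * (sin (y/2))\<^sup>2" using cos_double_sin[of "y/2"] by simp
  moreover have "(sin (y/2))\<^sup>2 \<le> (y/2)\<^sup>2"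
    using abs_sin_x_le_abs_x[of "y/2"] abs_le_square_iff[of "sin (y/2)" "y/2"] by blast
  moreover have "2 * (y/2)\<^sup>2 \<le> y" using y assms by (simp add: power2_eq_square field_simps)
  ultimately have "cos y \<ge> 1 - x" using y by linarith
  then show ?thesis using y x mult_left_mono[of "1 - x" "cos y" x] by (simp add: mult.commute)
qed simp

text \<open>The chord from \<open>|w|\<close> to \<open>w\<close> is no longer than the circular
  arc.\<close>

lemma cmod_minus_modulus_le:
  assumes "Im w > 0" shows "cmod (of_real (cmod w) - w) \<le> cmod w * Arg w"
proof -
  have w: "w = rcis (cmod w) (Arg w)" by (simp add: rcis_cmod_Arg)
  have "cmod (1 - cis (Arg w)) = cmod (iexp (Arg w) - 1)" by (simp add: cis_conv_exp norm_minus_commute)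
  also have "\<dots> \<le> \<bar>Arg w\<bar>" using iexp_approx1[of "Arg w" 0] by simp
  also have "\<dots> = Arg w" using Arg_lt_pi[of w] assms by simp
  finally have *: "cmod (1 - cis (Arg w)) \<le> Arg w" .
  have "of_real (cmod w) - w = of_real (cmod w) * (1 - cis (Arg w))"
    by (subst (2) w) (simp add: rcis_def right_diff_distrib)
  then show ?thesis using * by (simp add: norm_mult mult_left_mono)
qed

section \<open>Mass near the reciprocal of a modulus\<close>

context nonneg_dist
begin

text \<open>Outside the window \<open>|1 - t w| \<ge> d\<close>, so the part of the integral carried
  by the window is at least \<open>|N| - 1/d\<close>. Cauchy--Schwarz compares its square with the
  mass of the window times the integral \<open>Y\<close> of \<open>|1 - t w|^-2\<close> over it.
  There \<open>t |w| > 1 - d\<close>, so \<open>Y\<close> is dominated by the integral representing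
  \<open>Im N\<close>.\<close>

lemma near_mass_lower:
  assumes w: "Im w > 0" and d: "0 < d" "d < 1" and N: "cmod (resolvent M w) \<ge> 1 / d"
  shows "(cmod (resolvent M w) - 1 / d)\<^sup>2 * (Im w / cmod w) * (1 - d)
     \<le> prob {t. \<bar>t * cmod w - 1\<bar> < d} * Im (resolvent M w)"
proof -
  define S where "S = {t. \<bar>t * cmod w - 1\<bar> < d}"
  have Sm [measurable]: "S \<in> sets borel" unfolding S_def by measurable
  define i where "i t = indicat_real S t" for t
  have im [measurable]: "i \<in> borel_measurable borel" unfolding i_def by measurable
  have i01: "i t = 0 \<or> i t = 1" "i t * i t = i t" for t by (auto simp: i_def indicator_def)
  define g where "g t = 1 / cmod (1 - of_real t * w)" for t
  have gm [measurable]: "g \<in> borel_measurable borel" unfolding g_def by measurable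
  have r: "cmod w > 0" using w by auto
  note ws = slit_upper[OF w]
  have ig: "integrable M g"
    using integrable_norm[OF integrable_resolvent(1)[OF ws]] by (simp add: g_def[abs_def] norm_divide)
  have igg: "integrable M (\<lambda>t. (g t)\<^sup>2)"
    using integrable_kernel(1)[OF ws] by (simp add: g_def power_divide)
  have itg: "integrable M (\<lambda>t. t * (g t)\<^sup>2)"
    using integrable_kernel(2)[OF ws] by (simp add: g_def power_divide)
  have igi: "integrable M (\<lambda>t. g t * i t)"
    by (rule Bochner_Integration.integrable_bound[OF ig]) (auto simp: i_def indicator_def)
  have iggi: "integrable M (\<lambda>t. (g t)\<^sup>2 * i t)"
    by (rule Bochner_Integration.integrable_bound[OF igg]) (auto simp: i_def indicator_def)
  have ii: "integrable M i" by (rule integrable_const_bound[of _ 1]) (auto simp: i_def indicator_def)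
  define X where "X = (LINT t|M. g t * i t)"
  define Y where "Y = (LINT t|M. (g t)\<^sup>2 * i t)"
  define p where "p = prob S"
  have p: "p = (LINT t|M. i t)" unfolding p_def i_def by simp
  have X: "cmod (resolvent M w) - 1 / d \<le> X"
  proof -
    have "cmod (resolvent M w) \<le> (LINT t|M. cmod (1 / (1 - of_real t * w)))"
      unfolding resolvent_def by (rule integral_norm_bound)
    also have "\<dots> = (LINT t|M. g t)" by (simp add: g_def norm_divide)
    also have "\<dots> \<le> (LINT t|M. g t * i t + 1 / d)"
    proof (rule integral_mono_AE)
      show "AE t in M. g t \<le> g t * i t + 1 / d" using AE_nonneg
      proof eventually_elim
        case (elim t)
        show ?case
        proof (cases "t \<in> S")
          case True then show ?thesis using d by (simp add: i_def)
        next
          case False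
          then have "d \<le> \<bar>t * cmod w - 1\<bar>" by (simp add: S_def)
          also have "\<dots> = \<bar>cmod 1 - cmod (of_real t * w)\<bar>" using elim by (simp add: norm_mult)
          also have "\<dots> \<le> cmod (1 - of_real t * w)" by (rule norm_triangle_ineq3)
          finally show ?thesis using False d by (simp add: i_def g_def frac_le)
        qed
      qed
    qed (use ig igi in auto)
    also have "\<dots> = X + 1 / d" using igi by (simp add: X_def)
    finally show ?thesis by simp
  qed
  have CS: "X\<^sup>2 \<le> Y * p"
  proof (rule discriminant_nonpos)
    fix l
    have "0 \<le> (LINT t|M. (g t - l)\<^sup>2 * i t)"
      by (rule integral_nonneg_AE) (auto simp: i_def)
    also have "\<dots> = (LINT t|M. (g t)\<^sup>2 * i t - 2 * l * (g t * i t) + l\<^sup>2 * i t)"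
      by (rule Bochner_Integration.integral_cong) (auto simp: power2_eq_square algebra_simps)
    also have "\<dots> = Y - 2 * l * X + l\<^sup>2 * p"
      using igi iggi ii by (simp add: X_def Y_def p)
    finally show "0 \<le> Y - 2 * l * X + l\<^sup>2 * p" .
  qed (simp add: p_def)
  have Y: "Y * (1 - d) \<le> cmod w * (LINT t|M. t * (g t)\<^sup>2)"
  proof -
    have "(LINT t|M. (1 - d) * ((g t)\<^sup>2 * i t)) \<le> (LINT t|M. cmod w * (t * (g t)\<^sup>2))"
    proof (rule integral_mono_AE)
      show "AE t in M. (1 - d) * ((g t)\<^sup>2 * i t) \<le> cmod w * (t * (g t)\<^sup>2)" using AE_nonneg
      proof eventually_elim
        case (elim t)
        show ?case
        proof (cases "t \<in> S")
          case True
          then have "1 - d \<le> t * cmod w" by (simp add: S_def abs_if split: if_splits)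
          then have "(1 - d) * (g t)\<^sup>2 \<le> (t * cmod w) * (g t)\<^sup>2" by (intro mult_right_mono) auto
          then show ?thesis using True by (simp add: i_def mult_ac)
        qed (use elim in \<open>simp add: i_def\<close>)
      qed
    qed (use iggi itg in auto)
    then show ?thesis using iggi itg by (simp add: Y_def mult.commute)
  qed
  have Im: "Im (resolvent M w) = Im w * (LINT t|M. t * (g t)\<^sup>2)"
    using Im_resolvent[OF ws] by (simp add: g_def power_divide)
  have p0: "p \<ge> 0" by (simp add: p_def)
  have "(cmod (resolvent M w) - 1 / d)\<^sup>2 \<le> X\<^sup>2" using X N by (intro power_mono) auto
  also have "\<dots> \<le> Y * p" by (rule CS)
  finally have "(cmod (resolvent M w) - 1 / d)\<^sup>2 * (Im w / cmod w * (1 - d)) \<le> (Y * p) * (Im w / cmod w * (1 - d))"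
    using w d r by (intro mult_right_mono) auto
  also have "\<dots> = p * (Im w / cmod w) * (Y * (1 - d))" by (simp add: mult_ac)
  also have "\<dots> \<le> p * (Im w / cmod w) * (cmod w * (LINT t|M. t * (g t)\<^sup>2))"
    using Y w r p0 by (intro mult_left_mono) auto
  also have "\<dots> = p * Im (resolvent M w)" using r unfolding Im by simp
  finally show ?thesis by (simp add: p_def S_def mult_ac)
qed

text \<open>When the argument of \<open>w\<close> is \<open>O(y)\<close>, the whole window lies
  close to the pole: \<open>|1 - t w| \<le> (1 + 2 C) y\<close> for all its points, since
  \<open>t |w| \<le> 2\<close> there. As \<open>t |w| \<ge> 1/2\<close> too, the kernel of
  \<open>Im N\<close> is at least \<open>1 / (2 |w| D^2)\<close> on the window.\<close>

lemma near_mass_upper: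
  assumes w: "Im w > 0" and y: "0 < y" "y \<le> 1 / 2" and A: "Arg w \<le> C * y"
  shows "prob {t. \<bar>t * cmod w - 1\<bar> \<le> y} * (Im w / cmod w) \<le> 2 * ((1 + 2 * C) * y)\<^sup>2 * Im (resolvent M w)"
proof -
  define S where "S = {t. \<bar>t * cmod w - 1\<bar> \<le> y}"
  have Sm [measurable]: "S \<in> sets borel" unfolding S_def by measurable
  define K where "K t = t / (cmod (1 - of_real t * w))\<^sup>2" for t
  have r: "cmod w > 0" using w by auto
  note ws = slit_upper[OF w]
  have Aw: "0 < Arg w" using Arg_lt_pi[of w] w by simp
  define D where "D = (1 + 2 * C) * y"
  have Cy: "C * y > 0" using A Aw by linarith
  have D: "D > 0" using Cy y by (simp add: D_def algebra_simps)
  have pt: "1 / (2 * cmod w * D\<^sup>2) * indicat_real S t \<le> K t" if t: "0 \<le> t" for t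
  proof (cases "t \<in> S")
    case True
    then have 1: "t * cmod w \<ge> 1 / 2" "t * cmod w \<le> 2" "\<bar>t * cmod w - 1\<bar> \<le> y" using y by (auto simp: S_def abs_if split: if_splits)
    then have t2: "1 / (2 * cmod w) \<le> t" using r by (simp add: field_simps)
    have "1 - of_real t * w = (1 - of_real (t * cmod w)) + of_real t * (of_real (cmod w) - w)"
      by (simp add: algebra_simps)
    then have "cmod (1 - of_real t * w) \<le> cmod (of_real (1 - t * cmod w)) + cmod (of_real t * (of_real (cmod w) - w))"
      by (metis norm_triangle_ineq of_real_1 of_real_diff)
    also have "\<dots> \<le> y + t * (cmod w * Arg w)"
      using 1 t cmod_minus_modulus_le[OF w] by (intro add_mono) (auto simp: norm_mult mult_left_mono simp del: of_real_diff)
    also have "t * (cmod w * Arg w) \<le> 2 * (C * y)"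
      using mult_mono[OF 1(2) A] Aw Cy by (simp add: mult.assoc)
    finally have le: "cmod (1 - of_real t * w) \<le> D" by (simp add: D_def algebra_simps)
    have pos: "0 < cmod (1 - of_real t * w)" using slit_denom[OF ws t] by simp
    have "1 / (2 * cmod w * D\<^sup>2) = (1 / (2 * cmod w)) / D\<^sup>2" by simp
    also have "\<dots> \<le> t / (cmod (1 - of_real t * w))\<^sup>2"
      using t2 t le pos by (intro frac_le) (auto intro: power_mono)
    finally show ?thesis using True by (simp add: K_def)
  qed (use that in \<open>simp add: K_def\<close>)
  have "1 / (2 * cmod w * D\<^sup>2) * prob S = (LINT t|M. 1 / (2 * cmod w * D\<^sup>2) * indicat_real S t)"
    by simp
  also have "\<dots> \<le> (LINT t|M. K t)"
  proof (rule integral_mono_AE)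
    show "AE t in M. 1 / (2 * cmod w * D\<^sup>2) * indicat_real S t \<le> K t"
      using AE_nonneg by eventually_elim (rule pt)
    show "integrable M K" unfolding K_def[abs_def] by (rule integrable_kernel[OF ws])
    show "integrable M (\<lambda>t. 1 / (2 * cmod w * D\<^sup>2) * indicat_real S t)"
      by (intro integrable_mult_right integrable_real_indicator) (auto simp: emeasure_finite less_top[symmetric])
  qed
  finally have "Im w * (1 / (2 * cmod w * D\<^sup>2) * prob S) \<le> Im (resolvent M w)"
    using w unfolding Im_resolvent[OF ws] K_def by (intro mult_left_mono) auto
  then have "(2 * D\<^sup>2) * (Im w * (1 / (2 * cmod w * D\<^sup>2) * prob S)) \<le> 2 * D\<^sup>2 * Im (resolvent M w)"
    using D by (intro mult_left_mono) auto
  moreover have "(2 * D\<^sup>2) * (Im w * (1 / (2 * cmod w * D\<^sup>2) * prob S)) = prob S * (Im w / cmod w)"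
    using D r by (simp add: field_simps)
  ultimately show ?thesis by (simp add: S_def D_def)
qed

lemma atom_from_limit:
  assumes "\<And>n. 0 \<le> e n" "decseq e" "e \<longlonglongrightarrow> (0::real)"
  shows "(\<lambda>n. prob (cball a (e n))) \<longlonglongrightarrow> prob {a}"
proof -
  have "(\<lambda>n. prob (cball a (e n))) \<longlonglongrightarrow> prob (\<Inter>n. cball a (e n))"
    using assms(2) by (intro finite_Lim_measure_decseq) (force simp: decseq_def)+
  also have "(\<Inter>n. cball a (e n)) = {a}"
  proof (intro equalityI subsetI)
    fix x assume "x \<in> (\<Inter>n. cball a (e n))"
    then have "dist a x \<le> e n" for n by auto
    then have "dist a x \<le> 0" using LIMSEQ_le_const[OF assms(3)] by blast
    then show "x \<in> {a}" by simp
  qed (use assms in auto)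
  finally show ?thesis .
qed

text \<open>If \<open>r < 1 / T\<close>, the window lies beyond \<open>n\<close>; if
  \<open>r > T\<close>, it lies in \<open>(0, 1 / (n + 1))\<close>. Both sets have mass below
  \<open>c\<close> for large \<open>n\<close>. An atom at 0 does no harm because no window contains
  0.\<close>

lemma tight_radius:
  assumes "c > 0"
  obtains T where "T > 0" "\<And>r. r > 0 \<Longrightarrow> prob {t. \<bar>t * r - 1\<bar> < 1 / 2} \<ge> c \<Longrightarrow> 1 / T \<le> r \<and> r \<le> T"
proof -
  have "(\<lambda>n. prob {real n<..}) \<longlonglongrightarrow> prob (\<Inter>n. {real n<..})"
    by (intro finite_Lim_measure_decseq) (auto simp: decseq_def)
  moreover have "(\<Inter>n. {real n<..}) = {}"
  proof (rule equals0I)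
    fix x assume x: "x \<in> (\<Inter>n. {real n<..})"
    obtain n where "x \<le> real n" using real_arch_simple by blast
    moreover have "x \<in> {real n<..}" using x by blast
    ultimately show False by simp
  qed
  ultimately have "(\<lambda>n. prob {real n<..}) \<longlonglongrightarrow> 0" by simp
  then have ev1: "\<forall>\<^sub>F n in sequentially. prob {real n<..} < c" using assms by (rule order_tendstoD)
  have "(\<lambda>n. prob {0<..<1 / real (Suc n)}) \<longlonglongrightarrow> prob (\<Inter>n. {0<..<1 / real (Suc n)})"
  proof (intro finite_Lim_measure_decseq)
    have sub: "{0<..<a} \<subseteq> {0<..<b}" if "a \<le> b" for a b :: real using that by auto
    show "decseq (\<lambda>n. {0<..<1 / real (Suc n)})" by (rule decseq_SucI, rule sub, rule frac_le) auto
  qed auto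
  moreover have "(\<Inter>n. {0<..<1 / real (Suc n)}) = {}"
  proof (rule equals0I)
    fix x assume x: "x \<in> (\<Inter>n. {0<..<1 / real (Suc n)})"
    have xn: "x \<in> {0<..<1 / real (Suc n)}" for n by (rule INT_D[OF x UNIV_I])
    then have "x > 0" using greaterThanLessThan_iff by metis
    from reals_Archimedean[OF this] obtain n where "inverse (real (Suc n)) < x" ..
    with xn[of n] show False by (simp add: inverse_eq_divide)
  qed
  ultimately have "(\<lambda>n. prob {0<..<1 / real (Suc n)}) \<longlonglongrightarrow> 0" by simp
  then have "\<forall>\<^sub>F n in sequentially. prob {0<..<1 / real (Suc n)} < c" using assms by (rule order_tendstoD)
  with ev1 have "\<forall>\<^sub>F n in sequentially. prob {real n<..} < c \<and> prob {0<..<1 / real (Suc n)} < c"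
    by (rule eventually_conj)
  then obtain n where n: "prob {real n<..} < c" "prob {0<..<1 / real (Suc n)} < c"
    using eventually_happens'[OF sequentially_bot] by blast
  define T where "T = 2 * real (Suc n)"
  have T: "T > 0" by (simp add: T_def)
  show thesis
  proof (rule that[OF T])
    fix r :: real assume r: "r > 0" and P: "prob {t. \<bar>t * r - 1\<bar> < 1 / 2} \<ge> c"
    have "1 / T \<le> r"
    proof (rule ccontr)
      assume "\<not> 1 / T \<le> r"
      then have rT: "r * T < 1" using T by (simp add: field_simps)
      have "{t. \<bar>t * r - 1\<bar> < 1 / 2} \<subseteq> {real n<..}"
      proof
        fix t assume "t \<in> {t. \<bar>t * r - 1\<bar> < 1 / 2}"
        then have "1 / 2 < t * r" by (auto simp: abs_if split: if_splits)
        moreover have "r * (2 * real n) \<le> r * T" using r by (simp add: T_def)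
        ultimately have "r * (2 * real n) < r * (2 * t)" using rT by (simp add: mult.commute)
        then show "t \<in> {real n<..}" using r by simp
      qed
      then have "prob {t. \<bar>t * r - 1\<bar> < 1 / 2} \<le> prob {real n<..}" by (intro finite_measure_mono) auto
      then show False using P n by linarith
    qed
    moreover have "r \<le> T"
    proof (rule ccontr)
      assume rT: "\<not> r \<le> T"
      have "{t. \<bar>t * r - 1\<bar> < 1 / 2} \<subseteq> {0<..<1 / real (Suc n)}"
      proof
        fix t assume "t \<in> {t. \<bar>t * r - 1\<bar> < 1 / 2}"
        then have t: "1 / 2 < t * r" "t * r < 2" by (auto simp: abs_if split: if_splits)
        then have "0 < t * r" by linarith
        then have t0: "t > 0" using r by (simp add: zero_less_mult_iff)
        have "t * T < t * r" by (rule mult_strict_left_mono) (use rT t0 in auto)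
        then have "t * T < 2" using t by linarith
        then show "t \<in> {0<..<1 / real (Suc n)}" using t0 by (simp add: T_def field_simps)
      qed
      then have "prob {t. \<bar>t * r - 1\<bar> < 1 / 2} \<le> prob {0<..<1 / real (Suc n)}" by (intro finite_measure_mono) auto
      then show False using P n by linarith
    qed
    ultimately show "1 / T \<le> r \<and> r \<le> T" by simp
  qed
qed

end

section \<open>Arguments of the subordination functions and their limits at an endpoint\<close>

lemma Arg_mono_cone:
  assumes z: "Im z > 0" and w: "Im w > 0" and c: "Im (w * cnj z) \<ge> 0"
  shows "Arg z \<le> Arg w"
proof -
  have nz: "z \<noteq> 0" "w \<noteq> 0" using z w by auto
  have "0 < Arg z" "Arg z < pi" "0 < Arg w" "Arg w < pi" using Arg_lt_pi z w by blast+
  then have "Arg (w / z) = Arg w - Arg z" using Arg_divide'[OF nz(2,1)] by simp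
  moreover have "w / z = (w * cnj z) / of_real ((cmod z)\<^sup>2)" by (subst complex_div_cnj) simp
  then have "Im (w / z) \<ge> 0" using c by simp
  then have "0 \<le> Arg (w / z)" by (simp add: Arg_less_0)
  ultimately show ?thesis by simp
qed

context subord
begin

lemma swap: "subord \<mu>2 \<mu>1 \<nu> o2 o1"
  using cont1 cont2 upper1 upper2 cone1 cone2 resolvent1 resolvent2 o_prod
  by unfold_locales (auto simp: mult.commute)

text \<open>The product formula is read as \<open>o1 z / z = \<eta> / o2 z\<close>: all four
  arguments lie in \<open>(0, pi)\<close>, so both quotients have the difference of arguments as
  principal argument and no multiple of \<open>2 pi\<close> can intervene.\<close>

lemma Arg_facts:
  assumes z: "Im z > 0"
  shows "Arg z \<le> Arg (o1 z)" "Arg z \<le> Arg (o2 z)"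
    "Arg (o1 z) + Arg (o2 z) = Arg z + Arg (eta_transform \<nu> z)"
    "Arg (o1 z) \<le> Arg (eta_transform \<nu> z)" "Arg (o2 z) \<le> Arg (eta_transform \<nu> z)"
    "0 < Arg z"
proof -
  show 1: "Arg z \<le> Arg (o1 z)" by (rule Arg_mono_cone[OF z upper1[OF z] cone1[OF z]])
  show 2: "Arg z \<le> Arg (o2 z)" by (rule Arg_mono_cone[OF z upper2[OF z] cone2[OF z]])
  define e where "e = eta_transform \<nu> z"
  have e: "Im e > 0" unfolding e_def by (rule C.Im_eta_pos[OF z])
  have nz: "z \<noteq> 0" "e \<noteq> 0" "o1 z \<noteq> 0" "o2 z \<noteq> 0" using z e upper1[OF z] upper2[OF z] by auto
  have a: "0 < Arg z" "Arg z < pi" "0 < Arg (o1 z)" "Arg (o1 z) < pi" "0 < Arg (o2 z)" "Arg (o2 z) < pi" "0 < Arg e" "Arg e < pi"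
    using Arg_lt_pi z e upper1[OF z] upper2[OF z] by blast+
  have "o1 z / z = e / o2 z" using nz o_prod[OF z] by (simp add: e_def field_simps)
  moreover have "Arg (o1 z / z) = Arg (o1 z) - Arg z" using Arg_divide'[OF nz(3,1)] a by simp
  moreover have "Arg (e / o2 z) = Arg e - Arg (o2 z)" using Arg_divide'[OF nz(2,4)] a by simp
  ultimately show 3: "Arg (o1 z) + Arg (o2 z) = Arg z + Arg (eta_transform \<nu> z)" by (simp add: e_def)
  show "Arg (o1 z) \<le> Arg (eta_transform \<nu> z)" "Arg (o2 z) \<le> Arg (eta_transform \<nu> z)" using 1 2 3 by linarith+
  show "0 < Arg z" by (rule a)
qed

text \<open>The arguments of \<open>\<omega>\<^sub>1\<close> and \<open>\<omega>\<^sub>2\<close> add up to \<open>arg z + arg \<eta>\<^sub>\<nu>(z)\<close>: the second summand contributes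
  mass \<open>1\<close>, and \<open>k\<close> bounds the contribution of the first one from below.\<close>

lemma mass_sum_lower:
  assumes z: "Im z > 0" and d: "0 < d" "d < 1"
    and N: "cmod (resolvent \<nu> z) \<ge> 1 / d\<^sup>2"
    and Ad: "Arg (eta_transform \<nu> z) \<le> d" and ed: "cmod (eta_transform \<nu> z) * (1 - d) \<le> 1"
    and k: "k * cmod z * Im (resolvent \<nu> z) \<le> Im z * (cmod (resolvent \<nu> z))\<^sup>2"
  shows "(1 - d) ^ 4 * (k + 1 - d) \<le> A.prob {t. \<bar>t * cmod (o1 z) - 1\<bar> < d} + B.prob {t. \<bar>t * cmod (o2 z) - 1\<bar> < d}"
proof -
  define n where "n = cmod (resolvent \<nu> z)"
  define I where "I = Im (resolvent \<nu> z)"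
  define e where "e = eta_transform \<nu> z"
  define s1 where "s1 = Im (o1 z) / cmod (o1 z)"
  define s2 where "s2 = Im (o2 z) / cmod (o2 z)"
  define p1 where "p1 = A.prob {t. \<bar>t * cmod (o1 z) - 1\<bar> < d}"
  define p2 where "p2 = B.prob {t. \<bar>t * cmod (o2 z) - 1\<bar> < d}"
  have I: "I > 0" unfolding I_def by (rule C.Im_resolvent_pos[OF z])
  have zs: "cmod z > 0" using z by auto
  have e0: "Im e > 0" unfolding e_def by (rule C.Im_eta_pos[OF z])
  then have ec: "cmod e > 0" by auto
  have d2: "1 / d \<le> 1 / d\<^sup>2" using d by (intro frac_le) (auto simp: power2_eq_square mult_left_le)
  have n1: "1 / d \<le> n" using N d2 by (simp add: n_def)
  \<comment> \<open>The size \<open>1 / d^2\<close> of the resolvent is chosen so that the part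
    outside the window, at most \<open>1 / d\<close>, costs only a factor
    \<open>1 - d\<close>.\<close>
  have "1 / d = d * (1 / d\<^sup>2)" using d by (simp add: power2_eq_square)
  also have "\<dots> \<le> d * n" using N d by (intro mult_left_mono) (auto simp: n_def)
  finally have "(1 - d) * n \<le> n - 1 / d" by (simp add: algebra_simps)
  then have sq: "((1 - d) * n)\<^sup>2 \<le> (n - 1 / d)\<^sup>2" using d by (intro power_mono) (auto simp: n_def)
  have le1: "(n - 1 / d)\<^sup>2 * s1 * (1 - d) \<le> p1 * I"
    using A.near_mass_lower[OF upper1[OF z] d] n1 resolvent1[OF z] by (simp add: n_def I_def s1_def p1_def)
  have le2: "(n - 1 / d)\<^sup>2 * s2 * (1 - d) \<le> p2 * I"
    using B.near_mass_lower[OF upper2[OF z] d] n1 resolvent2[OF z] by (simp add: n_def I_def s2_def p2_def)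
  note af = Arg_facts[OF z]
  have low: "(1 - d) * Arg w \<le> sin (Arg w)" if "0 \<le> Arg w" "Arg w \<le> d" for w
  proof -
    have "(1 - d) * Arg w \<le> (1 - Arg w) * Arg w" using that by (intro mult_right_mono) auto
    also have "\<dots> \<le> sin (Arg w)" using that d by (intro sin_lower_bound) auto
    finally show ?thesis .
  qed
  have s1: "(1 - d) * Arg (o1 z) \<le> s1" using low[of "o1 z"] af Ad sin_Arg[of "o1 z"] upper1[OF z] by (force simp: s1_def)
  have s2: "(1 - d) * Arg (o2 z) \<le> s2" using low[of "o2 z"] af Ad sin_Arg[of "o2 z"] upper2[OF z] by (force simp: s2_def)
  have "Im z / cmod z = sin (Arg z)" using sin_Arg[of z] zs by auto
  also have "\<dots> \<le> Arg z" using af by (intro sin_x_le_x) auto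
  finally have az: "Im z / cmod z \<le> Arg z" .
  have "Im e / cmod e = sin (Arg e)" using sin_Arg[of e] ec by auto
  also have "\<dots> \<le> Arg e" using Arg_lt_pi[of e] e0 by (intro sin_x_le_x) auto
  finally have ae: "Im e / cmod e \<le> Arg e" .
  have n0: "n > 0" using n1 d by (smt (verit) divide_pos_pos)
  have Ie: "n\<^sup>2 * Im e = I" using C.Im_eta[OF slit_upper[OF z]] n0 by (simp add: e_def I_def n_def)
  have "1 - d \<le> 1 / cmod e" using ed ec by (simp add: e_def field_simps)
  then have "I * (1 - d) \<le> I * (1 / cmod e)" using I by (intro mult_left_mono) auto
  then have 2: "(1 - d) * I \<le> n\<^sup>2 * (Im e / cmod e)" by (simp add: mult.commute flip: Ie)
  have 1: "k * I \<le> n\<^sup>2 * (Im z / cmod z)" using k zs by (simp add: n_def I_def field_simps)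
  have "(k + 1 - d) * I \<le> n\<^sup>2 * (Im z / cmod z + Im e / cmod e)" using 1 2 by (simp add: algebra_simps)
  also have "\<dots> \<le> n\<^sup>2 * (Arg z + Arg e)" using az ae by (intro mult_left_mono) auto
  also have "\<dots> = n\<^sup>2 * (Arg (o1 z) + Arg (o2 z))" using af(3) by (simp add: e_def)
  finally have key: "(k + 1 - d) * I \<le> n\<^sup>2 * (Arg (o1 z) + Arg (o2 z))" .
  \<comment> \<open>Two factors \<open>1 - d\<close> pay for the square of \<open>n - 1 / d\<close>,
    one for replacing arguments by sines, and one for \<open>t |w| > 1 - d\<close> on the
    windows.\<close>
  have "(1 - d) ^ 4 * ((k + 1 - d) * I) \<le> (1 - d) ^ 4 * (n\<^sup>2 * (Arg (o1 z) + Arg (o2 z)))"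
    using key by (intro mult_left_mono) auto
  also have "\<dots> = ((1 - d) * n)\<^sup>2 * ((1 - d) * Arg (o1 z) + (1 - d) * Arg (o2 z)) * (1 - d)"
    by (simp add: power2_eq_square power4_eq_xxxx algebra_simps)
  also have "\<dots> \<le> (n - 1 / d)\<^sup>2 * (s1 + s2) * (1 - d)"
    using sq s1 s2 d af by (intro mult_right_mono mult_mono add_mono) auto
  also have "\<dots> \<le> (p1 + p2) * I" using le1 le2 by (simp add: algebra_simps)
  finally have "((1 - d) ^ 4 * (k + 1 - d)) * I \<le> (p1 + p2) * I" by (simp add: mult.assoc)
  then show ?thesis using I by (simp add: p1_def p2_def)
qed

text \<open>As the resolvent blows up, \<eta> tends to 1 and the arguments to 0, so the two windows
  have total mass above \<open>1 + k / 2\<close> for a small \<open>d\<close>. The second mass is at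
  most 1; hence the first is at least \<open>k / 2\<close>, which confines \<open>|o1|\<close> to a
  compact subset of the positive axis. Along a convergent subsequence \<open>|o2|\<close> converges
  as well, by the product formula, and letting \<open>d\<close> tend to 0 gives atoms of total mass
  at least \<open>1 + k\<close>.\<close>

lemma endpoint_subseq:
  assumes Z: "\<And>n. Im (Z n) > 0" and lim: "Z \<longlonglongrightarrow> complex_of_real c" and c: "c > 0"
    and inf: "filterlim (\<lambda>n. cmod (resolvent \<nu> (Z n))) at_top sequentially"
    and k: "k > 0" "\<And>n. k * cmod (Z n) * Im (resolvent \<nu> (Z n)) \<le> Im (Z n) * (cmod (resolvent \<nu> (Z n)))\<^sup>2"
  obtains a b r where "a > 0" "b > 0" "a * b = 1 / c" "A.prob {a} + B.prob {b} > 1" "strict_mono (r :: nat \<Rightarrow> nat)"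
    "(\<lambda>n. cmod (o1 (Z (r n)))) \<longlonglongrightarrow> 1 / a" "(\<lambda>n. cmod (o2 (Z (r n)))) \<longlonglongrightarrow> 1 / b"
proof -
  define E where "E n = eta_transform \<nu> (Z n)" for n
  have "filterlim (\<lambda>n. resolvent \<nu> (Z n)) at_infinity sequentially"
    by (rule filterlim_norm_at_top_imp_at_infinity[OF inf])
  then have "(\<lambda>n. 1 - inverse (resolvent \<nu> (Z n))) \<longlonglongrightarrow> 1 - 0"
    by (intro tendsto_intros filterlim_compose[OF tendsto_inverse_0])
  then have E1: "E \<longlonglongrightarrow> 1" unfolding E_def[abs_def] by (simp add: C.eta_eq'[OF slit_upper[OF Z]] inverse_eq_divide)
  have "isCont Arg 1" by (rule continuous_at_Arg) (auto simp: complex_nonpos_Reals_iff)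
  then have "(\<lambda>n. Arg (E n)) \<longlonglongrightarrow> Arg 1" using E1 isCont_tendsto_compose by blast
  then have Arg0: "(\<lambda>n. Arg (E n)) \<longlonglongrightarrow> 0" by simp
  have cE: "(\<lambda>n. cmod (E n)) \<longlonglongrightarrow> 1" using tendsto_norm[OF E1] by simp
  define P1 where "P1 d n = A.prob {t. \<bar>t * cmod (o1 (Z n)) - 1\<bar> < d}" for d n
  define P2 where "P2 d n = B.prob {t. \<bar>t * cmod (o2 (Z n)) - 1\<bar> < d}" for d n
  have ev: "\<forall>\<^sub>F n in sequentially. (1 - d) ^ 4 * (k + 1 - d) \<le> P1 d n + P2 d n" if d: "0 < d" "d < 1" for d
  proof -
    have "(\<lambda>n. cmod (E n) * (1 - d)) \<longlonglongrightarrow> 1 * (1 - d)" by (intro tendsto_intros cE)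
    from order_tendstoD(2)[OF this, of 1] have "\<forall>\<^sub>F n in sequentially. cmod (E n) * (1 - d) < 1" using d by simp
    moreover have "\<forall>\<^sub>F n in sequentially. Arg (E n) < d" using d by (intro order_tendstoD(2)[OF Arg0])
    moreover have "\<forall>\<^sub>F n in sequentially. 1 / d\<^sup>2 \<le> cmod (resolvent \<nu> (Z n))"
      using inf by (simp add: filterlim_at_top)
    ultimately show ?thesis
    proof eventually_elim
      case (elim n)
      then show ?case unfolding P1_def P2_def using d k(2) Z
        by (intro mass_sum_lower) (auto simp: E_def)
    qed
  qed
  have "((\<lambda>d. (1 - d) ^ 4 * (k + 1 - d)) \<longlongrightarrow> (1 - 0) ^ 4 * (k + 1 - 0)) (at_right 0)" by (intro tendsto_intros)
  then have "\<forall>\<^sub>F d in at_right 0. (1 - d) ^ 4 * (k + 1 - d) > 1 + k / 2" using k by (intro order_tendstoD(1)) auto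
  moreover have "\<forall>\<^sub>F d in at_right 0. d < (1/2::real)" by (auto simp: eventually_at_right_field intro: exI[of _ "1/2"])
  moreover have "\<forall>\<^sub>F d in at_right 0. (0::real) < d" by (rule eventually_at_right_less)
  ultimately have "\<forall>\<^sub>F d in at_right (0::real). (1 - d) ^ 4 * (k + 1 - d) > 1 + k / 2 \<and> d < 1 / 2 \<and> 0 < d"
    by eventually_elim auto
  then obtain d where d: "(1 - d) ^ 4 * (k + 1 - d) > 1 + k / 2" "d < 1 / 2" "0 < d"
    using eventually_happens'[OF trivial_limit_at_right_real] by blast
  have d1: "d < 1" using d by simp
  obtain T1 where T1: "T1 > 0" "\<And>r. r > 0 \<Longrightarrow> A.prob {t. \<bar>t * r - 1\<bar> < 1 / 2} \<ge> k / 2 \<Longrightarrow> 1 / T1 \<le> r \<and> r \<le> T1"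
    using A.tight_radius[of "k / 2"] k by auto
  have r1pos: "cmod (o1 (Z n)) > 0" for n using upper1[OF Z[of n]] by auto
  have "\<forall>\<^sub>F n in sequentially. cmod (o1 (Z n)) \<in> {1 / T1 .. T1}"
    using ev[OF d(3) d1]
  proof (eventually_elim)
    case (elim n)
    have "P2 d n \<le> 1" by (simp add: P2_def)
    then have "P1 d n \<ge> k / 2" using elim d by linarith
    moreover have "P1 d n \<le> P1 (1/2) n" unfolding P1_def using d by (intro A.finite_measure_mono) auto
    ultimately show ?case using T1(2)[OF r1pos[of n]] by (auto simp: P1_def)
  qed
  then obtain n0 where n0: "\<And>n. n \<ge> n0 \<Longrightarrow> cmod (o1 (Z n)) \<in> {1 / T1 .. T1}"
    unfolding eventually_sequentially by blast
  have "\<forall>n. cmod (o1 (Z (n + n0))) \<in> {1 / T1 .. T1}" using n0 by simp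
  then obtain l r0 where l: "l \<in> {1 / T1 .. T1}" "strict_mono (r0 :: nat \<Rightarrow> nat)" "((\<lambda>n. cmod (o1 (Z (n + n0)))) \<circ> r0) \<longlonglongrightarrow> l"
    using compact_imp_seq_compact[OF compact_Icc] unfolding seq_compact_def by metis
  define r where "r n = r0 n + n0" for n
  have r: "strict_mono r" using l(2) by (simp add: strict_mono_def r_def)
  have l0: "l > 0" using l(1) T1(1) by (smt (verit) atLeastAtMost_iff divide_pos_pos)
  have lim1: "(\<lambda>n. cmod (o1 (Z (r n)))) \<longlonglongrightarrow> l" using l(3) by (simp add: o_def r_def)
  have Zr: "(\<lambda>n. cmod (Z (r n))) \<longlonglongrightarrow> c"
    using tendsto_norm[OF LIMSEQ_subseq_LIMSEQ[OF lim r]] c by (simp add: o_def)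
  have Er: "(\<lambda>n. cmod (E (r n))) \<longlonglongrightarrow> 1" using LIMSEQ_subseq_LIMSEQ[OF cE r] by (simp add: o_def)
  have "(\<lambda>n. cmod (Z (r n)) * cmod (E (r n)) / cmod (o1 (Z (r n)))) \<longlonglongrightarrow> c * 1 / l"
    using l0 by (intro tendsto_intros Zr Er lim1) auto
  moreover have "cmod (Z (r n)) * cmod (E (r n)) / cmod (o1 (Z (r n))) = cmod (o2 (Z (r n)))" for n
    using arg_cong[OF o_prod[OF Z[of "r n"]], of cmod] r1pos[of "r n"] by (simp add: norm_mult E_def field_simps)
  ultimately have lim2: "(\<lambda>n. cmod (o2 (Z (r n)))) \<longlonglongrightarrow> c / l" by simp
  define a where "a = 1 / l"
  define b where "b = l / c"
  have ab: "a > 0" "b > 0" "a * b = 1 / c" using l0 c by (auto simp: a_def b_def)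
  \<comment> \<open>Replaces the moving windows by one fixed ball:
    \<open>|t - 1 / R| = |t R - 1| / R\<close> is at most \<open>2 m d\<close>, and
    \<open>1 / R\<close> is within \<open>d\<close> of \<open>m\<close>.\<close>
  have near: "\<forall>\<^sub>F n in sequentially. \<forall>t. \<bar>t * R n - 1\<bar> < d \<longrightarrow> dist m t \<le> d * (1 + 2 * m)"
    if R: "R \<longlonglongrightarrow> 1 / m" and m: "m > 0" and d: "0 < d" for R :: "nat \<Rightarrow> real" and m d
  proof -
    have "(\<lambda>n. 1 / R n) \<longlonglongrightarrow> 1 / (1 / m)" using m by (intro tendsto_intros R) auto
    then have "(\<lambda>n. 1 / R n) \<longlonglongrightarrow> m" using m by simp
    then have "\<forall>\<^sub>F n in sequentially. dist (1 / R n) m < d" using d by (rule tendstoD)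
    moreover have "\<forall>\<^sub>F n in sequentially. R n > 1 / (2 * m)" using m by (intro order_tendstoD(1)[OF R]) (simp add: field_simps)
    ultimately show ?thesis
    proof eventually_elim
      case (elim n)
      have Rp: "R n > 0" using elim(2) m by (smt (verit) divide_pos_pos)
      have R2: "1 / R n \<le> 2 * m" using elim(2) Rp m by (simp add: field_simps)
      show ?case
      proof (intro allI impI)
        fix t assume t: "\<bar>t * R n - 1\<bar> < d"
        have "\<bar>t - 1 / R n\<bar> = \<bar>t * R n - 1\<bar> * (1 / R n)"
          using Rp by (simp add: abs_div_pos diff_divide_distrib)
        also have "\<dots> \<le> d * (2 * m)" using t R2 Rp d by (intro mult_mono) auto
        finally show "dist m t \<le> d * (1 + 2 * m)" using elim(1) by (simp add: dist_real_def algebra_simps)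
      qed
    qed
  qed
  have masses: "(1 - d) ^ 4 * (k + 1 - d) \<le> A.prob (cball a (d * (1 + 2 * a))) + B.prob (cball b (d * (1 + 2 * b)))"
    if d: "0 < d" "d < 1" for d
  proof -
    have R1: "(\<lambda>n. cmod (o1 (Z (r n)))) \<longlonglongrightarrow> 1 / a" using lim1 by (simp add: a_def)
    have R2: "(\<lambda>n. cmod (o2 (Z (r n)))) \<longlonglongrightarrow> 1 / b" using lim2 by (simp add: b_def)
    have "\<forall>\<^sub>F n in sequentially. (1 - d) ^ 4 * (k + 1 - d) \<le> P1 d (r n) + P2 d (r n)"
      using ev[OF d] r by (rule eventually_subseq[rotated])
    with near[OF R1 ab(1) d(1)] near[OF R2 ab(2) d(1)]
    have "\<forall>\<^sub>F n in sequentially. (1 - d) ^ 4 * (k + 1 - d) \<le> A.prob (cball a (d * (1 + 2 * a))) + B.prob (cball b (d * (1 + 2 * b)))"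
    proof eventually_elim
      case (elim n)
      have "P1 d (r n) \<le> A.prob (cball a (d * (1 + 2 * a)))"
        unfolding P1_def using elim(1) by (intro A.finite_measure_mono) auto
      moreover have "P2 d (r n) \<le> B.prob (cball b (d * (1 + 2 * b)))"
        unfolding P2_def using elim(2) by (intro B.finite_measure_mono) auto
      ultimately show ?case using elim(3) by linarith
    qed
    then show ?thesis by simp
  qed
  define D where "D n = 1 / (real n + 2)" for n :: nat
  have Dd: "0 < D n" "D n < 1" for n by (auto simp: D_def)
  have Dl: "D \<longlonglongrightarrow> 0" unfolding D_def by real_asymp
  have Ddec: "decseq D" unfolding decseq_def D_def by (auto intro!: frac_le)
  have De: "decseq (\<lambda>n. D n * (1 + 2 * m))" "(\<lambda>n. D n * (1 + 2 * m)) \<longlonglongrightarrow> 0" if "m > 0" for m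
  proof -
    show "decseq (\<lambda>n. D n * (1 + 2 * m))" using Ddec that by (auto simp: decseq_def intro!: mult_right_mono)
    have "(\<lambda>n. D n * (1 + 2 * m)) \<longlonglongrightarrow> 0 * (1 + 2 * m)" by (intro tendsto_intros Dl)
    then show "(\<lambda>n. D n * (1 + 2 * m)) \<longlonglongrightarrow> 0" by simp
  qed
  have l1: "(\<lambda>n. A.prob (cball a (D n * (1 + 2 * a))) + B.prob (cball b (D n * (1 + 2 * b)))) \<longlonglongrightarrow> A.prob {a} + B.prob {b}"
    using Dd ab by (intro tendsto_add A.atom_from_limit B.atom_from_limit De) (auto intro!: mult_nonneg_nonneg less_imp_le[OF Dd(1)])
  have l2: "(\<lambda>n. (1 - D n) ^ 4 * (k + 1 - D n)) \<longlonglongrightarrow> (1 - 0) ^ 4 * (k + 1 - 0)"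
    by (intro tendsto_intros Dl)
  have "(1 - 0) ^ 4 * (k + 1 - 0) \<le> A.prob {a} + B.prob {b}"
    by (rule LIMSEQ_le[OF l2 l1]) (intro exI allI impI masses Dd)
  then have "A.prob {a} + B.prob {b} > 1" using k by simp
  then show thesis using that[OF ab _ r] lim1 lim2 by (simp add: a_def b_def)
qed

end

text \<open>Otherwise the indices at which \<open>X\<close> stays away from \<open>L\<close> form an
  infinite set, and no subsequence of its enumeration leads to \<open>L\<close>.\<close>

lemma subseq_criterion:
  fixes X :: "nat \<Rightarrow> real"
  assumes "\<And>r. strict_mono r \<Longrightarrow> \<exists>s. strict_mono (s :: nat \<Rightarrow> nat) \<and> (\<lambda>n. X (r (s n))) \<longlonglongrightarrow> L"
  shows "X \<longlonglongrightarrow> L"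
proof (rule ccontr)
  assume "\<not> X \<longlonglongrightarrow> L"
  then obtain e where e: "e > 0" "\<not> (\<forall>\<^sub>F n in sequentially. dist (X n) L < e)"
    unfolding tendsto_iff by blast
  define A where "A = {n. \<not> dist (X n) L < e}"
  have "infinite A"
    unfolding infinite_nat_iff_unbounded_le using e(2) by (auto simp: eventually_sequentially A_def)
  then have r: "strict_mono (enumerate A)" "enumerate A n \<in> A" for n
    by (auto intro: strict_mono_enumerate enumerate_in_set)
  obtain s where s: "strict_mono (s :: nat \<Rightarrow> nat)" "(\<lambda>n. X (enumerate A (s n))) \<longlonglongrightarrow> L"
    using assms[OF r(1)] by blast
  have "\<forall>\<^sub>F n in sequentially. dist (X (enumerate A (s n))) L < e"
    using s(2) e(1) by (rule tendstoD)
  then obtain n where "dist (X (enumerate A (s n))) L < e"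
    using eventually_happens'[OF sequentially_bot] by blast
  then show False using r(2)[of "s n"] by (simp add: A_def)
qed

lemma (in prob_space) atoms_le_1:
  assumes "{a} \<in> events" "{b} \<in> events" "a \<noteq> b"
  shows "prob {a} + prob {b} \<le> 1"
  using finite_measure_Union[of "{a}" "{b}"] assms prob_le_1[of "{a} \<union> {b}"] by simp

context subord
begin

lemma atom_pair_unique:
  assumes "A.prob {a} + B.prob {b} > 1" "A.prob {a'} + B.prob {b'} > 1"
  shows "a = a' \<or> b = b'"
  using A.atoms_le_1[of a a'] B.atoms_le_1[of b b'] assms by fastforce

text \<open>Each sequence has a subsequence with limits given by some heavy pair of atoms. Two such
  pairs share a coordinate and have the same product \<open>1 / c\<close>, hence coincide; so the
  limit is independent of the subsequence.\<close>

lemma endpoint_limit: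
  assumes D: "\<And>z. z \<in> D \<Longrightarrow> Im z > 0" and c: "c > 0"
    and inf: "filterlim (\<lambda>z. cmod (resolvent \<nu> z)) at_top (at (complex_of_real c) within D)"
    and k: "k > 0" "\<And>z. z \<in> D \<Longrightarrow> k * cmod z * Im (resolvent \<nu> z) \<le> Im z * (cmod (resolvent \<nu> z))\<^sup>2"
    and isl: "complex_of_real c islimpt D"
  obtains a b where "a > 0" "b > 0" "a * b = 1 / c" "A.prob {a} + B.prob {b} > 1"
    "((\<lambda>z. cmod (o1 z)) \<longlongrightarrow> 1 / a) (at (complex_of_real c) within D)"
    "((\<lambda>z. cmod (o2 z)) \<longlongrightarrow> 1 / b) (at (complex_of_real c) within D)"
proof -
  have sub: "\<exists>a b r. a > 0 \<and> b > 0 \<and> a * b = 1 / c \<and> A.prob {a} + B.prob {b} > 1 \<and> strict_mono (r :: nat \<Rightarrow> nat)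
      \<and> (\<lambda>n. cmod (o1 (Z (r n)))) \<longlonglongrightarrow> 1 / a \<and> (\<lambda>n. cmod (o2 (Z (r n)))) \<longlonglongrightarrow> 1 / b"
    if Z: "\<And>n. Z n \<in> D" "Z \<longlonglongrightarrow> complex_of_real c" for Z :: "nat \<Rightarrow> complex"
  proof -
    have ne: "Z n \<noteq> complex_of_real c" for n using D[OF Z(1)[of n]] by auto
    have "filterlim Z (at (complex_of_real c) within D) sequentially"
      unfolding filterlim_at using Z ne by auto
    from filterlim_compose[OF inf this]
    have inf': "filterlim (\<lambda>n. cmod (resolvent \<nu> (Z n))) at_top sequentially" .
    show ?thesis
      by (rule endpoint_subseq[of Z c k, OF D[OF Z(1)] Z(2) c inf' k(1) k(2)[OF Z(1)]]) blast
  qed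
  obtain Z0 where Z0: "\<And>n. Z0 n \<in> D - {complex_of_real c}" "Z0 \<longlonglongrightarrow> complex_of_real c"
    using isl unfolding islimpt_sequential by blast
  then obtain a b where ab: "a > 0" "b > 0" "a * b = 1 / c" "A.prob {a} + B.prob {b} > 1"
    using sub[of Z0] by blast
  have uniq: "a' = a \<and> b' = b" if "a' > 0" "b' > 0" "a' * b' = 1 / c" "A.prob {a'} + B.prob {b'} > 1" for a' b'
  proof -
    have "a = a' \<or> b = b'" using atom_pair_unique ab that by blast
    moreover have "a' * b' = a * b" using that ab by simp
    ultimately show ?thesis using ab that by (metis less_irrefl mult_cancel_left mult_cancel_right)
  qed
  have sub': "\<exists>r. strict_mono (r :: nat \<Rightarrow> nat)
      \<and> (\<lambda>n. cmod (o1 (Z (r n)))) \<longlonglongrightarrow> 1 / a \<and> (\<lambda>n. cmod (o2 (Z (r n)))) \<longlonglongrightarrow> 1 / b"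
    if Z: "\<And>n. Z n \<in> D" "Z \<longlonglongrightarrow> complex_of_real c" for Z :: "nat \<Rightarrow> complex"
    using sub[OF Z] uniq by metis
  have sub'': "\<exists>s. strict_mono (s :: nat \<Rightarrow> nat)
      \<and> (\<lambda>n. cmod (o1 (X (r (s n))))) \<longlonglongrightarrow> 1 / a \<and> (\<lambda>n. cmod (o2 (X (r (s n))))) \<longlonglongrightarrow> 1 / b"
    if X: "\<forall>i. X i \<in> D - {complex_of_real c}" "X \<longlonglongrightarrow> complex_of_real c" and r: "strict_mono r" for X :: "nat \<Rightarrow> complex" and r
    using sub'[of "\<lambda>n. X (r n)"] X LIMSEQ_subseq_LIMSEQ[OF X(2) r] by (auto simp: o_def)
  have "((\<lambda>z. cmod (o1 z)) \<longlongrightarrow> 1 / a) (at (complex_of_real c) within D)"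
    unfolding tendsto_at_iff_sequentially o_def
    by (intro allI impI subseq_criterion) (use sub'' in blast)
  moreover have "((\<lambda>z. cmod (o2 z)) \<longlongrightarrow> 1 / b) (at (complex_of_real c) within D)"
    unfolding tendsto_at_iff_sequentially o_def
    by (intro allI impI subseq_criterion) (use sub'' in blast)
  ultimately show thesis using that ab by blast
qed

end

section \<open>A gap between two atoms\<close>

locale gap_dist = nontrivial_dist +
  fixes \<alpha> \<beta> :: real
  assumes pos: "0 < \<alpha>" and less: "\<alpha> < \<beta>" and gap: "emeasure M {\<alpha><..<\<beta>} = 0"
begin

definition gap_inv :: "real set" where "gap_inv = {1 / \<beta> <..< 1 / \<alpha>}"
text \<open>The boundary value of the resolvent at a real point whose reciprocal lies in the
  gap.\<close>

definition gap_value :: "real \<Rightarrow> real" where "gap_value x = (LINT t|M. 1 / (1 - t * x))"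
text \<open>The values of \<open>t / (1 - t x)^2\<close> at the two edges of the gap, added. This
  bounds the function for all \<open>t\<close> outside the gap, and its growth at either endpoint of
  \<open>gap_inv\<close> can be read off.\<close>

definition gap_bound :: "real \<Rightarrow> real" where "gap_bound x = \<alpha> / (1 - \<alpha> * x)\<^sup>2 + \<beta> / (\<beta> * x - 1)\<^sup>2"

lemma gap_inv_facts:
  assumes "x \<in> gap_inv" shows "x > 0" "1 - \<alpha> * x > 0" "\<beta> * x - 1 > 0" "\<beta> > 0" "x < 1 / \<alpha>" "1 / \<beta> < x"
proof -
  show b: "\<beta> > 0" using pos less by simp
  show x: "x < 1 / \<alpha>" "1 / \<beta> < x" using assms by (auto simp: gap_inv_def)
  then show "1 - \<alpha> * x > 0" "\<beta> * x - 1 > 0" using pos b by (auto simp: field_simps)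
  have "1 / \<beta> > 0" using b by simp
  then show "x > 0" using x by linarith
qed

lemma AE_gap: "AE t in M. 0 \<le> t \<and> (t \<le> \<alpha> \<or> \<beta> \<le> t)"
proof -
  have "AE t in M. t \<notin> {\<alpha><..<\<beta>}" using gap by (intro AE_not_in) (auto simp: null_sets_def)
  then show ?thesis using AE_nonneg by eventually_elim auto
qed

lemma gap_pointwise:
  assumes x: "x \<in> gap_inv" and t: "0 \<le> t" "t \<le> \<alpha> \<or> \<beta> \<le> t"
  shows "1 - t * x \<noteq> 0" "t / (1 - t * x)\<^sup>2 \<le> gap_bound x"
    "\<bar>1 / (1 - t * x)\<bar> \<le> 1 / (1 - \<alpha> * x) + 1 / (\<beta> * x - 1)"
    "t \<le> \<alpha> \<Longrightarrow> 0 \<le> 1 / (1 - t * x) \<and> 1 / (1 - t * x) \<le> 1 / (1 - \<alpha> * x)"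
    "\<beta> \<le> t \<Longrightarrow> 1 / (1 - t * x) \<le> 0 \<and> - (1 / (\<beta> * x - 1)) \<le> 1 / (1 - t * x)"
proof -
  note f = gap_inv_facts[OF x]
  have low: "1 - t * x \<ge> 1 - \<alpha> * x" if "t \<le> \<alpha>" using that f by simp
  have high: "t * x - 1 \<ge> \<beta> * x - 1" if "\<beta> \<le> t" using that f by simp
  show "1 - t * x \<noteq> 0" using t low high f by linarith
  show L: "0 \<le> 1 / (1 - t * x) \<and> 1 / (1 - t * x) \<le> 1 / (1 - \<alpha> * x)" if "t \<le> \<alpha>"
  proof -
    have d: "0 < 1 - t * x" using low[OF that] f by linarith
    moreover have "1 / (1 - t * x) \<le> 1 / (1 - \<alpha> * x)"
      by (rule frac_le) (use low[OF that] f in \<open>linarith+\<close>)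
    ultimately show ?thesis by simp
  qed
  have H0: "1 / (1 - t * x) = - (1 / (t * x - 1))" by (metis minus_diff_eq minus_divide_right)
  show H: "1 / (1 - t * x) \<le> 0 \<and> - (1 / (\<beta> * x - 1)) \<le> 1 / (1 - t * x)" if "\<beta> \<le> t"
  proof -
    have "0 < t * x - 1" using high[OF that] f by linarith
    then have "0 \<le> 1 / (t * x - 1)" by simp
    moreover have "1 / (t * x - 1) \<le> 1 / (\<beta> * x - 1)"
      by (rule frac_le) (use high[OF that] f in \<open>linarith+\<close>)
    ultimately have "0 \<le> 1 / (t * x - 1)" "1 / (t * x - 1) \<le> 1 / (\<beta> * x - 1)" .
    then show ?thesis unfolding H0 by simp
  qed
  have "0 < 1 / (1 - \<alpha> * x)" "0 < 1 / (\<beta> * x - 1)" using f by simp_all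
  then show "\<bar>1 / (1 - t * x)\<bar> \<le> 1 / (1 - \<alpha> * x) + 1 / (\<beta> * x - 1)"
    using L H t(2) unfolding abs_le_iff by linarith
  have g: "0 \<le> \<alpha> / (1 - \<alpha> * x)\<^sup>2" "0 \<le> \<beta> / (\<beta> * x - 1)\<^sup>2" using pos f by auto
  show "t / (1 - t * x)\<^sup>2 \<le> gap_bound x"
  proof (cases "t \<le> \<alpha>")
    case True
    have "t / (1 - t * x)\<^sup>2 \<le> \<alpha> / (1 - \<alpha> * x)\<^sup>2"
      using low[OF True] f pos t True by (intro frac_le power_mono) auto
    then show ?thesis using g by (simp add: gap_bound_def)
  next
    case False
    then have tb: "\<beta> \<le> t" using t by simp
    \<comment> \<open>Beyond \<open>1 / x\<close> the function \<open>t / (t x - 1)^2\<close>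
      decreases. After clearing denominators this is the factorisation into
      \<open>t - \<beta>\<close> and \<open>\<beta> t x^2 - 1\<close>, both nonnegative
      here.\<close>
    have "1 * 1 \<le> (\<beta> * x) * (t * x)" using high[OF tb] f by (intro mult_mono) linarith+
    then have "0 \<le> (t - \<beta>) * (\<beta> * t * x\<^sup>2 - 1)" using tb by (simp add: power2_eq_square mult_ac)
    also have "\<dots> = \<beta> * (1 - t * x)\<^sup>2 - t * (\<beta> * x - 1)\<^sup>2" by (simp add: power2_eq_square algebra_simps)
    finally have le: "t * (\<beta> * x - 1)\<^sup>2 \<le> \<beta> * (1 - t * x)\<^sup>2" by simp
    have "1 - t * x \<noteq> 0" "\<beta> * x - 1 \<noteq> 0" using high[OF tb] f by linarith+
    then have "(1 - t * x)\<^sup>2 > 0" "(\<beta> * x - 1)\<^sup>2 > 0" by simp_all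
    then have "t / (1 - t * x)\<^sup>2 \<le> \<beta> / (\<beta> * x - 1)\<^sup>2" using le by (simp add: divide_simps mult.commute)
    then show ?thesis using g by (simp add: gap_bound_def)
  qed
qed

lemma gap_bound_pos: "x \<in> gap_inv \<Longrightarrow> gap_bound x > 0"
  using gap_inv_facts[of x] pos by (auto simp: gap_bound_def intro!: add_pos_pos divide_pos_pos zero_less_power)

lemma integrable_gap_value: "x \<in> gap_inv \<Longrightarrow> integrable M (\<lambda>t. 1 / (1 - t * x))"
proof -
  assume x: "x \<in> gap_inv"
  have "AE t in M. norm (1 / (1 - t * x)) \<le> 1 / (1 - \<alpha> * x) + 1 / (\<beta> * x - 1)"
    using AE_gap by eventually_elim (use gap_pointwise(3)[OF x] in auto)
  then show ?thesis by (rule integrable_const_bound) simp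
qed

text \<open>The kernels at \<open>x + i y\<close> and \<open>x\<close> differ by
  \<open>i t y / ((1 - t z) (1 - t x))\<close>, and \<open>|1 - t z| \<ge> |1 - t x|\<close>; both
  estimates reduce to the pointwise bound on \<open>t / (1 - t x)^2\<close>.\<close>

lemma resolvent_near_gap_value:
  assumes x: "x \<in> gap_inv" and y: "y > 0"
  shows "cmod (resolvent M (Complex x y) - of_real (gap_value x)) \<le> y * gap_bound x"
    and "Im (resolvent M (Complex x y)) \<le> y * gap_bound x"
proof -
  define z where "z = Complex x y"
  have zs: "z \<in> slit" using y by (simp add: slit_upper z_def)
  have mod: "\<bar>1 - t * x\<bar> \<le> cmod (1 - of_real t * z)" for t
    using abs_Re_le_cmod[of "1 - of_real t * z"] by (simp add: z_def)
  have i: "integrable M (\<lambda>t. complex_of_real (1 / (1 - t * x)))"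
    unfolding complex_of_real_integrable_eq by (rule integrable_gap_value[OF x])
  have "resolvent M z - of_real (gap_value x) = (LINT t|M. 1 / (1 - of_real t * z) - complex_of_real (1 / (1 - t * x)))"
    unfolding resolvent_def gap_value_def integral_complex_of_real[symmetric]
    by (rule Bochner_Integration.integral_diff[symmetric, OF integrable_resolvent(1)[OF zs] i])
  also have "cmod \<dots> \<le> (LINT t|M. cmod (1 / (1 - of_real t * z) - complex_of_real (1 / (1 - t * x))))"
    by (rule integral_norm_bound)
  also have "\<dots> \<le> (LINT t|M. y * gap_bound x)"
  proof (rule integral_mono_AE)
    show "integrable M (\<lambda>t. cmod (1 / (1 - of_real t * z) - complex_of_real (1 / (1 - t * x))))"
      by (intro integrable_norm Bochner_Integration.integrable_diff i integrable_resolvent[OF zs])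
    show "AE t in M. cmod (1 / (1 - of_real t * z) - complex_of_real (1 / (1 - t * x))) \<le> y * gap_bound x"
      using AE_gap
    proof eventually_elim
      case (elim t)
      note gp = gap_pointwise[OF x, of t]
      have n1: "1 - of_real t * z \<noteq> 0" using slit_denom[OF zs] elim by blast
      have n2: "1 - t * x \<noteq> 0" using gp elim by blast
      have c1: "complex_of_real t * z \<noteq> 1" using n1 by auto
      have "1 / (1 - of_real t * z) - complex_of_real (1 / (1 - t * x)) =
        (of_real (1 - t * x) - (1 - of_real t * z)) / ((1 - of_real t * z) * of_real (1 - t * x))"
      proof -
        have "1 / p - 1 / q = (q - p) / (p * q)" if "p \<noteq> 0" "q \<noteq> 0" for p q :: complex
          using that by (simp add: divide_simps)
        then show ?thesis using n1 n2 by (simp only: of_real_divide of_real_1 of_real_eq_0_iff not_False_eq_True)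
      qed
      also have "of_real (1 - t * x) - (1 - of_real t * z) = of_real (t * y) * \<i>"
        by (simp add: z_def complex_eq_iff)
      finally have "cmod (1 / (1 - of_real t * z) - complex_of_real (1 / (1 - t * x)))
        = t * y / (cmod (1 - of_real t * z) * \<bar>1 - t * x\<bar>)"
        using elim y by (simp add: norm_divide norm_mult del: of_real_diff)
      also have "\<dots> \<le> t * y / (\<bar>1 - t * x\<bar> * \<bar>1 - t * x\<bar>)"
        using mod[of t] n2 c1 elim y by (intro divide_left_mono mult_right_mono mult_pos_pos) auto
      also have "\<dots> = y * (t / (1 - t * x)\<^sup>2)" by (simp add: power2_eq_square)
      also have "\<dots> \<le> y * gap_bound x" using gp elim y by (intro mult_left_mono) auto
      finally show ?case .
    qed
  qed auto
  finally show "cmod (resolvent M (Complex x y) - of_real (gap_value x)) \<le> y * gap_bound x" by (simp add: z_def)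
  have "(LINT t|M. t / (cmod (1 - of_real t * z))\<^sup>2) \<le> (LINT t|M. gap_bound x)"
  proof (rule integral_mono_AE[OF integrable_kernel(2)[OF zs]])
    show "AE t in M. t / (cmod (1 - of_real t * z))\<^sup>2 \<le> gap_bound x" using AE_gap
    proof eventually_elim
      case (elim t)
      note gp = gap_pointwise[OF x, of t]
      have n2: "1 - t * x \<noteq> 0" using gp elim by blast
      have "\<bar>1 - t * x\<bar>\<^sup>2 \<le> (cmod (1 - of_real t * z))\<^sup>2" using mod by (intro power_mono) auto
      then have "t / (cmod (1 - of_real t * z))\<^sup>2 \<le> t / (1 - t * x)\<^sup>2"
        using n2 elim by (intro divide_left_mono mult_pos_pos) (auto intro!: less_le_trans[of 0 "\<bar>1 - t * x\<bar>\<^sup>2"])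
      then show ?case using gp elim by linarith
    qed
  qed auto
  then show "Im (resolvent M (Complex x y)) \<le> y * gap_bound x"
    using y unfolding z_def[symmetric] Im_resolvent[OF zs] by (simp add: z_def)
qed

text \<open>Only the atom at one edge is kept; the remaining mass on its side contributes with a
  favourable sign, and the mass on the other side is bounded by the kernel at the other edge. Thus
  the value tends to plus infinity at \<open>1 / \<alpha>\<close> and to minus infinity at
  \<open>1 / \<beta>\<close> when both edges are atoms.\<close>

lemma gap_value_bounds:
  assumes x: "x \<in> gap_inv"
  shows "gap_value x \<ge> prob {\<alpha>} / (1 - \<alpha> * x) - 1 / (\<beta> * x - 1)"
    and "gap_value x \<le> 1 / (1 - \<alpha> * x) - prob {\<beta>} / (\<beta> * x - 1)"
proof -
  note f = gap_inv_facts[OF x]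
  have i: "integrable M (\<lambda>t. indicat_real {c} t * d)" for c d
    by (intro integrable_mult_left integrable_real_indicator) (auto simp: emeasure_finite less_top[symmetric])
  have "(LINT t|M. indicat_real {\<alpha>} t * (1 / (1 - \<alpha> * x)) - 1 / (\<beta> * x - 1)) \<le> gap_value x"
    unfolding gap_value_def
  proof (rule integral_mono_AE[OF _ integrable_gap_value[OF x]])
    show "AE t in M. indicat_real {\<alpha>} t * (1 / (1 - \<alpha> * x)) - (1 / (\<beta> * x - 1)) \<le> 1 / (1 - t * x)"
      using AE_gap
    proof eventually_elim
      case (elim t)
      have "0 < 1 / (\<beta> * x - 1)" using f by simp
      moreover have "- (1 / (\<beta> * x - 1)) \<le> 1 / (1 - t * x)"
        using gap_pointwise(4,5)[OF x, of t] elim calculation by linarith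
      ultimately show ?case by (cases "t = \<alpha>") auto
    qed
  qed (intro Bochner_Integration.integrable_diff i integrable_const)
  then show "gap_value x \<ge> prob {\<alpha>} / (1 - \<alpha> * x) - 1 / (\<beta> * x - 1)"
    using i[of \<alpha> "1 / (1 - \<alpha> * x)"] by simp
  have "gap_value x \<le> (LINT t|M. 1 / (1 - \<alpha> * x) - indicat_real {\<beta>} t * (1 / (\<beta> * x - 1)))"
    unfolding gap_value_def
  proof (rule integral_mono_AE[OF integrable_gap_value[OF x]])
    show "AE t in M. 1 / (1 - t * x) \<le> 1 / (1 - \<alpha> * x) - indicat_real {\<beta>} t * (1 / (\<beta> * x - 1))"
      using AE_gap
    proof eventually_elim
      case (elim t)
      have p: "0 < 1 / (1 - \<alpha> * x)" using f by simp
      show ?case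
      proof (cases "t = \<beta>")
        case True
        have "1 / (1 - \<beta> * x) = - (1 / (\<beta> * x - 1))" by (metis minus_diff_eq minus_divide_right)
        then show ?thesis using True p by simp
      next
        case False
        have "1 / (1 - t * x) \<le> 1 / (1 - \<alpha> * x)"
          using gap_pointwise(4,5)[OF x, of t] elim p by linarith
        then show ?thesis using False by simp
      qed
    qed
  qed (intro Bochner_Integration.integrable_diff i integrable_const)
  then show "gap_value x \<le> 1 / (1 - \<alpha> * x) - prob {\<beta>} / (\<beta> * x - 1)"
    using i[of \<beta> "1 / (\<beta> * x - 1)"] by simp
qed

lemma gap_value_mono:
  assumes "x \<in> gap_inv" "x' \<in> gap_inv" "x \<le> x'" shows "gap_value x \<le> gap_value x'"
  unfolding gap_value_def
proof (rule integral_mono_AE[OF integrable_gap_value integrable_gap_value])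
  show "AE t in M. 1 / (1 - t * x) \<le> 1 / (1 - t * x')" using AE_gap
  proof eventually_elim
    case (elim t)
    note f = gap_inv_facts[OF assms(1)] and f' = gap_inv_facts[OF assms(2)]
    have tx: "t * x \<le> t * x'" using elim assms by (intro mult_left_mono) auto
    show ?case
    proof (cases "t \<le> \<alpha>")
      case True
      then have "t * x' \<le> \<alpha> * x'" using f' by simp
      then show ?thesis using tx f' by (intro frac_le) linarith+
    next
      case False
      then have "\<beta> * x \<le> t * x" using f elim by simp
      then have "1 / (t * x' - 1) \<le> 1 / (t * x - 1)" using tx f by (intro frac_le) linarith+
      moreover have "1 / (1 - s) = - (1 / (s - 1))" for s :: real by (metis minus_diff_eq minus_divide_right)
      ultimately show ?thesis by simp
    qed
  qed
qed (use assms in auto)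

lemma gap_value_continuous: "continuous_on gap_inv gap_value"
  unfolding continuous_on_def
proof
  fix x assume x: "x \<in> gap_inv"
  have bound: "\<bar>gap_value x' - gap_value x\<bar> \<le> \<bar>x' - x\<bar> * (gap_bound x + gap_bound x')" if x': "x' \<in> gap_inv" for x'
  proof -
    have "gap_value x' - gap_value x = (LINT t|M. 1 / (1 - t * x') - 1 / (1 - t * x))"
      unfolding gap_value_def using integrable_gap_value x x' by simp
    also have "\<bar>\<dots>\<bar> \<le> (LINT t|M. \<bar>1 / (1 - t * x') - 1 / (1 - t * x)\<bar>)" by (rule integral_abs_bound)
    also have "\<dots> \<le> (LINT t|M. \<bar>x' - x\<bar> * (gap_bound x + gap_bound x'))"
    proof (rule integral_mono_AE)
      show "AE t in M. \<bar>1 / (1 - t * x') - 1 / (1 - t * x)\<bar> \<le> \<bar>x' - x\<bar> * (gap_bound x + gap_bound x')" using AE_gap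
      proof eventually_elim
        case (elim t)
        define p q where "p = 1 - t * x" and "q = 1 - t * x'"
        have nz: "p \<noteq> 0" "q \<noteq> 0" using gap_pointwise(1) x x' elim by (auto simp: p_def q_def)
        have "1 / q - 1 / p = t * (x' - x) * (1 / p * (1 / q))"
          using nz by (simp add: divide_simps) (simp add: p_def q_def algebra_simps)
        then have "\<bar>1 / q - 1 / p\<bar> = t * \<bar>x' - x\<bar> * (\<bar>1 / p\<bar> * \<bar>1 / q\<bar>)"
          using elim by (simp add: abs_mult)
        also have "\<bar>1 / p\<bar> * \<bar>1 / q\<bar> \<le> \<bar>1 / p\<bar>\<^sup>2 + \<bar>1 / q\<bar>\<^sup>2"
        proof -
          have uv: "u * v \<le> u\<^sup>2 + v\<^sup>2" if "0 \<le> u" "0 \<le> v" for u v :: real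
            using sum_squares_bound[of u v] mult_nonneg_nonneg[OF that] by linarith
          show ?thesis by (rule uv) simp_all
        qed
        finally have "\<bar>1 / q - 1 / p\<bar> \<le> t * \<bar>x' - x\<bar> * (\<bar>1 / p\<bar>\<^sup>2 + \<bar>1 / q\<bar>\<^sup>2)"
          using elim by (simp add: mult_left_mono)
        also have "\<dots> = \<bar>x' - x\<bar> * (t / p\<^sup>2 + t / q\<^sup>2)"
          by (simp add: power_divide algebra_simps)
        also have "\<dots> \<le> \<bar>x' - x\<bar> * (gap_bound x + gap_bound x')"
          using gap_pointwise(2) x x' elim by (intro mult_left_mono add_mono) (auto simp: p_def q_def)
        finally show ?case by (simp add: p_def q_def)
      qed
      show "integrable M (\<lambda>t. \<bar>1 / (1 - t * x') - 1 / (1 - t * x)\<bar>)"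
        by (intro integrable_abs Bochner_Integration.integrable_diff integrable_gap_value x x')
    qed auto
    finally show ?thesis by simp
  qed
  note f = gap_inv_facts[OF x]
  have "((\<lambda>x'. \<bar>x' - x\<bar> * (gap_bound x + gap_bound x')) \<longlongrightarrow> \<bar>x - x\<bar> * (gap_bound x + gap_bound x)) (at x within gap_inv)"
    using f unfolding gap_bound_def by (intro tendsto_intros) auto
  then have "((\<lambda>x'. \<bar>x' - x\<bar> * (gap_bound x + gap_bound x')) \<longlongrightarrow> 0) (at x within gap_inv)" by simp
  then have "((\<lambda>x'. gap_value x' - gap_value x) \<longlongrightarrow> 0) (at x within gap_inv)"
    by (rule Lim_null_comparison[rotated]) (auto simp: eventually_at_filter bound)
  then show "(gap_value \<longlongrightarrow> gap_value x) (at x within gap_inv)" by (simp add: LIM_zero_iff)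
qed

end

lemma arctan_le_self: "0 \<le> x \<Longrightarrow> arctan x \<le> x"
proof (cases "x = 0")
  case False
  assume "0 \<le> x"
  then have x: "0 < x" using False by simp
  obtain y where y: "0 < y" "y < x" "arctan x - arctan 0 = (x - 0) * inverse (1 + y\<^sup>2)"
    using MVT2[of 0 x arctan "\<lambda>y. inverse (1 + y\<^sup>2)"] x DERIV_arctan by blast
  have "inverse (1 + y\<^sup>2) \<le> 1" by (simp add: inverse_le_1_iff)
  then have "x * inverse (1 + y\<^sup>2) \<le> x * 1" using x by (intro mult_left_mono) auto
  then show ?thesis using y by simp
qed simp

lemma eventually_at_right_0_small: "0 < b \<Longrightarrow> \<forall>\<^sub>F y in at_right (0::real). 0 < y \<and> y < b"
  by (auto simp: eventually_at_right_field)

section \<open>Null intervals from windows of quadratically small mass\<close>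

context nonneg_dist
begin

text \<open>About \<open>n\<close> windows of relative width \<open>1 / n\<close>, centred at the
  reciprocals of equally spaced \<open>w\<close>, cover the interval. Each has mass
  \<open>O(1 / n^2)\<close>, so the total is \<open>O(1 / n)\<close>.\<close>

lemma null_interval_cover:
  assumes w: "0 < w1" "w1 \<le> w2"
    and ev: "\<forall>\<^sub>F y in at_right 0. \<forall>w\<in>{w1..w2}. prob {t. \<bar>t * w - 1\<bar> \<le> y} \<le> C * y\<^sup>2"
  shows "prob {1 / w2 .. 1 / w1} = 0"
proof -
  \<comment> \<open>A deviation of \<open>(w2 - w1) / N\<close> in \<open>w\<close>, multiplied by
    \<open>t \<le> 1 / w1\<close>, stays below \<open>L / N\<close>. The summand 1 keeps
    \<open>L\<close> positive when \<open>w1 = w2\<close>.\<close>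
  define L where "L = (w2 - w1) / w1 + 1"
  have L: "L > 0" using w by (simp add: L_def add_nonneg_pos)
  have "filterlim (\<lambda>n. L / real (Suc n)) (at_right 0) sequentially"
    unfolding filterlim_at
  proof
    show "\<forall>\<^sub>F n in sequentially. L / real (Suc n) \<in> {0<..} \<and> L / real (Suc n) \<noteq> 0" using L by simp
    show "(\<lambda>n. L / real (Suc n)) \<longlonglongrightarrow> 0" by real_asymp
  qed
  from filterlim_iff[THEN iffD1, OF this, rule_format, OF ev]
  have evn: "\<forall>\<^sub>F n in sequentially. \<forall>w\<in>{w1..w2}. prob {t. \<bar>t * w - 1\<bar> \<le> L / real (Suc n)} \<le> C * (L / real (Suc n))\<^sup>2" .
  have "\<forall>\<^sub>F n in sequentially. prob {1 / w2 .. 1 / w1} \<le> (real (Suc n) + 1) * (C * (L / real (Suc n))\<^sup>2)"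
    using evn
  proof eventually_elim
    case (elim n)
    define N where "N = Suc n"
    define W where "W i = w1 + (w2 - w1) * (real i / real N)" for i
    have N: "real N > 0" by (simp add: N_def)
    have Win: "W i \<in> {w1..w2}" if "i \<le> N" for i
    proof -
      have i: "0 \<le> real i / real N" "real i / real N \<le> 1" using that N by auto
      have "0 \<le> (w2 - w1) * (real i / real N)" by (rule mult_nonneg_nonneg[OF _ i(1)]) (use w in simp)
      moreover have "(w2 - w1) * (real i / real N) \<le> (w2 - w1) * 1" by (rule mult_left_mono[OF i(2)]) (use w in simp)
      ultimately have "0 \<le> (w2 - w1) * (real i / real N)" "(w2 - w1) * (real i / real N) \<le> (w2 - w1) * 1" .
      then show ?thesis by (simp add: W_def)
    qed
    have "{1 / w2 .. 1 / w1} \<subseteq> (\<Union>i\<in>{..N}. {t. \<bar>t * W i - 1\<bar> \<le> L / real N})"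
    proof
      fix t assume t: "t \<in> {1 / w2 .. 1 / w1}"
      have w2: "w2 > 0" using w by linarith
      then have t0: "t > 0" using t by (auto intro: less_le_trans[of 0 "1 / w2"])
      have v: "w1 \<le> 1 / t" "1 / t \<le> w2" using t t0 w w2 by (auto simp: field_simps)
      have "\<exists>i\<le>N. \<bar>1 / t - W i\<bar> \<le> (w2 - w1) / real N"
      proof (cases "w1 = w2")
        case True
        then show ?thesis using v by (intro exI[of _ 0]) (auto simp: W_def)
      next
        case False
        then have d: "w2 - w1 > 0" using w by simp
        define q where "q = (1 / t - w1) / (w2 - w1) * real N"
        have "0 \<le> (1 / t - w1) / (w2 - w1)" "(1 / t - w1) / (w2 - w1) \<le> 1" using v d by simp_all
        from this(1) mult_right_mono[OF this(2), of "real N"] have q: "0 \<le> q" "q \<le> real N"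
          using N by (simp_all add: q_def del: times_divide_eq_left)
        define i where "i = nat \<lfloor>q\<rfloor>"
        have i: "real i \<le> q" "q < real i + 1" using q by (auto simp: i_def)
        have iN: "i \<le> N" using i q by linarith
        have "1 / t = w1 + (w2 - w1) * (q / real N)" using d N by (simp add: q_def)
        then have "1 / t - W i = (w2 - w1) / real N * (q - real i)"
          by (simp add: W_def algebra_simps diff_divide_distrib)
        also have "\<bar>\<dots>\<bar> \<le> (w2 - w1) / real N * 1"
          unfolding abs_mult using d N i by (intro mult_mono) auto
        finally show ?thesis using iN by auto
      qed
      then obtain i where i: "i \<le> N" "\<bar>1 / t - W i\<bar> \<le> (w2 - w1) / real N" by blast
      have "t * W i - 1 = - (t * (1 / t - W i))" using t0 by (simp add: algebra_simps)
      then have "\<bar>t * W i - 1\<bar> = t * \<bar>1 / t - W i\<bar>" using t0 by (simp add: abs_mult)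
      also have "\<dots> \<le> (1 / w1) * ((w2 - w1) / real N)" using i t t0 w by (intro mult_mono) auto
      also have "\<dots> \<le> L / real N" using N by (simp add: L_def add_divide_distrib)
      finally show "t \<in> (\<Union>i\<in>{..N}. {t. \<bar>t * W i - 1\<bar> \<le> L / real N})" using i(1) by auto
    qed
    then have "prob {1 / w2 .. 1 / w1} \<le> prob (\<Union>i\<in>{..N}. {t. \<bar>t * W i - 1\<bar> \<le> L / real N})"
      by (intro finite_measure_mono) auto
    also have "\<dots> \<le> (\<Sum>i\<in>{..N}. prob {t. \<bar>t * W i - 1\<bar> \<le> L / real N})"
      by (intro finite_measure_subadditive_finite) auto
    also have "\<dots> \<le> (\<Sum>i\<in>{..N}. C * (L / real N)\<^sup>2)"
      using elim Win by (intro sum_mono) (auto simp: N_def)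
    also have "\<dots> = (real N + 1) * (C * (L / real N)\<^sup>2)" by simp
    finally show ?case by (simp add: N_def)
  qed
  moreover have "(\<lambda>n. (real (Suc n) + 1) * (C * (L / real (Suc n))\<^sup>2)) \<longlonglongrightarrow> 0"
  proof -
    have "(\<lambda>n. (real (Suc n) + 1) / (real (Suc n))\<^sup>2) \<longlonglongrightarrow> 0" by real_asymp
    from tendsto_mult_left[OF this, of "C * L\<^sup>2"] show ?thesis
      by (simp add: power_divide mult_ac)
  qed
  ultimately have "prob {1 / w2 .. 1 / w1} \<le> 0"
    by (intro tendsto_le[OF sequentially_bot _ tendsto_const]) auto
  then show ?thesis by (simp add: measure_le_0_iff)
qed

end

section \<open>Approach to the ends of the gap\<close>

context gap_dist
begin

lemma resolvent_tendsto_gap_value: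
  assumes x: "x \<in> gap_inv"
  shows "((\<lambda>y. resolvent M (Complex x y)) \<longlongrightarrow> of_real (gap_value x)) (at_right 0)"
proof -
  have "((\<lambda>y. y * gap_bound x) \<longlongrightarrow> 0 * gap_bound x) (at_right 0)" by (intro tendsto_intros)
  then have "((\<lambda>y. y * gap_bound x) \<longlongrightarrow> 0) (at_right 0)" by simp
  moreover have "\<forall>\<^sub>F y in at_right 0. cmod (resolvent M (Complex x y) - of_real (gap_value x)) \<le> y * gap_bound x"
    using eventually_at_right_less[of 0] by eventually_elim (rule resolvent_near_gap_value[OF x])
  ultimately have "((\<lambda>y. resolvent M (Complex x y) - of_real (gap_value x)) \<longlongrightarrow> 0) (at_right 0)"
    by (rule Lim_null_comparison[rotated])
  then show ?thesis by (simp add: LIM_zero_iff)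
qed

text \<open>In the uses \<open>\<sigma>\<close> vanishes to first order at \<open>c\<close>. For
  heights up to its square, the error \<open>y * gap_bound x\<close> stays bounded while
  \<open>gap_value\<close> grows like \<open>1 / \<sigma>\<close>, so the resolvent blows up along
  the whole region.\<close>

definition approach :: "(real \<Rightarrow> real) \<Rightarrow> real \<Rightarrow> real \<Rightarrow> complex set" where
  "approach \<sigma> c s = {z. Im z > 0 \<and> Re z \<in> gap_inv \<and> Im z \<le> (\<sigma> (Re z))\<^sup>2 \<and> dist z (complex_of_real c) < s}"

text \<open>Near \<open>c\<close> one has \<open>|N| > m / (2 \<sigma>)\<close>, and
  \<open>|z| Im N \<le> 2 y / \<sigma>^2\<close>. Since
  \<open>|N|^2 \<ge> m^2 / (4 \<sigma>^2)\<close>, the constant \<open>m^2 / 8\<close> is what these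
  two bounds leave.\<close>

lemma endpoint_growth:
  fixes \<sigma> h g :: "real \<Rightarrow> real"
  assumes \<sigma>pos: "\<And>x. x \<in> gap_inv \<Longrightarrow> \<sigma> x > 0"
    and low: "\<And>x. x \<in> gap_inv \<Longrightarrow> m / \<sigma> x - h x \<le> \<bar>gap_value x\<bar>"
    and gap_bound\<sigma>: "\<And>x. x \<in> gap_inv \<Longrightarrow> (\<sigma> x)\<^sup>2 * gap_bound x = A + (\<sigma> x)\<^sup>2 * g x"
    and cont: "isCont \<sigma> c" "isCont h c" "isCont g c" and \<sigma>0: "\<sigma> c = 0"
    and m: "m > 0" and c: "c > 0" "c * A = 1"
    and near: "\<And>e. e > 0 \<Longrightarrow> \<exists>x\<in>gap_inv. \<bar>x - c\<bar> < e"
  obtains s where "s > 0"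
    "filterlim (\<lambda>z. cmod (resolvent M z)) at_top (at (complex_of_real c) within approach \<sigma> c s)"
    "\<And>z. z \<in> approach \<sigma> c s \<Longrightarrow> (m\<^sup>2 / 8) * cmod z * Im (resolvent M z) \<le> Im z * (cmod (resolvent M z))\<^sup>2"
    "complex_of_real c islimpt approach \<sigma> c s"
proof -
  \<comment> \<open>\<open>u\<close> is \<open>\<sigma>\<close> times the lower bound for the
    modulus of the resolvent and tends to \<open>m\<close>; \<open>v\<close> is
    \<open>|z| \<sigma>^2 gap_bound\<close> and tends to \<open>c A = 1\<close>.\<close>
  define u where "u z = m - \<sigma> (Re z) * h (Re z) - \<sigma> (Re z) * (A + (\<sigma> (Re z))\<^sup>2 * g (Re z))" for z
  define v where "v z = cmod z * (A + (\<sigma> (Re z))\<^sup>2 * g (Re z))" for z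
  have Re: "(Re \<longlongrightarrow> c) (nhds (complex_of_real c))"
    using tendsto_Re[OF filterlim_ident, of "complex_of_real c"] by simp
  have t: "((\<lambda>z. \<sigma> (Re z)) \<longlongrightarrow> 0) (nhds (complex_of_real c))" "((\<lambda>z. h (Re z)) \<longlongrightarrow> h c) (nhds (complex_of_real c))"
     "((\<lambda>z. g (Re z)) \<longlongrightarrow> g c) (nhds (complex_of_real c))"
    using isCont_tendsto_compose[OF cont(1) Re] isCont_tendsto_compose[OF cont(2) Re] isCont_tendsto_compose[OF cont(3) Re] \<sigma>0 by auto
  have n: "(cmod \<longlongrightarrow> c) (nhds (complex_of_real c))"
    using tendsto_norm[OF filterlim_ident, of "complex_of_real c"] c by simp
  have "(u \<longlongrightarrow> m - 0 * h c - 0 * (A + 0\<^sup>2 * g c)) (nhds (complex_of_real c))"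
    unfolding u_def by (intro tendsto_intros t)
  then have "\<forall>\<^sub>F z in nhds (complex_of_real c). m / 2 < u z" using m by (intro order_tendstoD(1)) auto
  moreover have "(v \<longlongrightarrow> c * (A + 0\<^sup>2 * g c)) (nhds (complex_of_real c))"
    unfolding v_def by (intro tendsto_intros t n)
  then have "\<forall>\<^sub>F z in nhds (complex_of_real c). v z < 2" using c by (intro order_tendstoD(2)) auto
  ultimately have "\<forall>\<^sub>F z in nhds (complex_of_real c). m / 2 < u z \<and> v z < 2" by (rule eventually_conj)
  then obtain s where s: "s > 0" "\<And>z. dist z (complex_of_real c) < s \<Longrightarrow> m / 2 < u z \<and> v z < 2"
    unfolding eventually_nhds_metric by blast
  have main: "m / 2 < \<sigma> (Re z) * cmod (resolvent M z) \<and>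
      (m\<^sup>2 / 8) * cmod z * Im (resolvent M z) \<le> Im z * (cmod (resolvent M z))\<^sup>2"
    if z: "Im z > 0" "Re z \<in> gap_inv" "Im z \<le> (\<sigma> (Re z))\<^sup>2" "dist z (complex_of_real c) < s" for z
  proof -
    define x y where "x = Re z" and "y = Im z"
    have zc: "Complex x y = z" by (simp add: x_def y_def)
    have x: "x \<in> gap_inv" and y: "y > 0" "y \<le> (\<sigma> x)\<^sup>2" using z by (auto simp: x_def y_def)
    note nf = resolvent_near_gap_value[OF x y(1), unfolded zc]
    define n where "n = cmod (resolvent M z)"
    have sp: "\<sigma> x > 0" by (rule \<sigma>pos[OF x])
    have gap_bound: "gap_bound x > 0" by (rule gap_bound_pos[OF x])
    have uv: "m / 2 < u z" "v z < 2" using s(2)[OF z(4)] by auto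
    have "\<bar>gap_value x\<bar> - n \<le> y * gap_bound x"
      using nf(1) norm_triangle_ineq2[of "of_real (gap_value x)" "resolvent M z"] by (simp add: n_def norm_minus_commute)
    moreover have "y * gap_bound x \<le> (\<sigma> x)\<^sup>2 * gap_bound x" using y gap_bound by (intro mult_right_mono) auto
    ultimately have "m / \<sigma> x - h x - (\<sigma> x)\<^sup>2 * gap_bound x \<le> n" using low[OF x] by linarith
    then have "\<sigma> x * (m / \<sigma> x - h x - (\<sigma> x)\<^sup>2 * gap_bound x) \<le> \<sigma> x * n" using sp by (intro mult_left_mono) auto
    moreover have "\<sigma> x * (m / \<sigma> x - h x - (\<sigma> x)\<^sup>2 * gap_bound x) = u z"
      using sp by (simp add: u_def gap_bound\<sigma>[OF x] x_def[symmetric] right_diff_distrib)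
    ultimately have 1: "m / 2 < \<sigma> x * n" using uv by linarith
    have "(m / 2)\<^sup>2 \<le> (\<sigma> x * n)\<^sup>2" using 1 m by (intro power_mono) auto
    then have sq: "m\<^sup>2 / 4 \<le> (\<sigma> x)\<^sup>2 * n\<^sup>2" by (simp add: power_mult_distrib power_divide)
    have vz: "cmod z * ((\<sigma> x)\<^sup>2 * gap_bound x) < 2" using uv(2) by (simp add: v_def gap_bound\<sigma>[OF x] x_def[symmetric])
    have "((m\<^sup>2 / 8) * cmod z * Im (resolvent M z)) * (\<sigma> x)\<^sup>2 \<le> ((m\<^sup>2 / 8) * cmod z * (y * gap_bound x)) * (\<sigma> x)\<^sup>2"
      using nf(2) by (intro mult_right_mono mult_left_mono) auto
    also have "\<dots> = (m\<^sup>2 / 8) * y * (cmod z * ((\<sigma> x)\<^sup>2 * gap_bound x))" by (simp add: mult_ac)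
    also have "\<dots> \<le> (m\<^sup>2 / 8) * y * 2" using vz y by (intro mult_left_mono) auto
    also have "\<dots> = y * (m\<^sup>2 / 4)" by simp
    also have "\<dots> \<le> y * ((\<sigma> x)\<^sup>2 * n\<^sup>2)" using sq y by (intro mult_left_mono) auto
    also have "\<dots> = (y * n\<^sup>2) * (\<sigma> x)\<^sup>2" by simp
    finally have "(m\<^sup>2 / 8) * cmod z * Im (resolvent M z) \<le> y * n\<^sup>2"
      using sp by (simp add: mult_le_cancel_right)
    then show ?thesis using 1 by (simp add: x_def y_def n_def)
  qed
  show thesis
  proof (rule that[OF s(1)])
    let ?D = "approach \<sigma> c s"
    note D = approach_def
    have wD: "\<forall>\<^sub>F z in at (complex_of_real c) within ?D. z \<in> ?D" by (simp add: eventually_at_filter)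
    show "filterlim (\<lambda>z. cmod (resolvent M z)) at_top (at (complex_of_real c) within ?D)"
    proof (rule filterlim_at_top_mono)
      have "((\<lambda>z. \<sigma> (Re z)) \<longlongrightarrow> 0) (at (complex_of_real c) within ?D)"
        using t(1) by (rule tendsto_mono[rotated]) (simp add: at_within_def)
      moreover have "\<forall>\<^sub>F z in at (complex_of_real c) within ?D. 0 < \<sigma> (Re z)"
        using wD by eventually_elim (simp add: D \<sigma>pos)
      ultimately have "filterlim (\<lambda>z. inverse (\<sigma> (Re z))) at_top (at (complex_of_real c) within ?D)"
        by (rule filterlim_inverse_at_top)
      then show "filterlim (\<lambda>z. (m / 2) * inverse (\<sigma> (Re z))) at_top (at (complex_of_real c) within ?D)"
        using m by (intro filterlim_tendsto_pos_mult_at_top[OF tendsto_const]) auto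
      show "\<forall>\<^sub>F z in at (complex_of_real c) within ?D. (m / 2) * inverse (\<sigma> (Re z)) \<le> cmod (resolvent M z)"
        using wD
      proof eventually_elim
        case (elim z)
        then have "m / 2 < \<sigma> (Re z) * cmod (resolvent M z)" "\<sigma> (Re z) > 0" using main[of z] \<sigma>pos by (auto simp: D)
        then show ?case by (simp add: field_simps)
      qed
    qed
    show "(m\<^sup>2 / 8) * cmod z * Im (resolvent M z) \<le> Im z * (cmod (resolvent M z))\<^sup>2" if "z \<in> ?D" for z
      using main[of z] that by (auto simp: D)
    show "complex_of_real c islimpt ?D"
      unfolding islimpt_approachable
    proof (intro allI impI)
      fix e :: real assume e: "e > 0"
      define e' where "e' = min e s / 2"
      have e': "e' > 0" "2 * e' \<le> e" "2 * e' \<le> s" using e s by (auto simp: e'_def)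
      obtain x where x: "x \<in> gap_inv" "\<bar>x - c\<bar> < e'" using near[OF e'(1)] by blast
      define y where "y = min ((\<sigma> x)\<^sup>2) (e' / 2)"
      have y: "y > 0" "y \<le> (\<sigma> x)\<^sup>2" "y < e'" using \<sigma>pos[OF x(1)] e' by (auto simp: y_def)
      have "dist (Complex x y) (complex_of_real c) \<le> \<bar>x - c\<bar> + \<bar>y\<bar>"
        using cmod_le[of "Complex x y - complex_of_real c"] by (simp add: dist_norm)
      also have "\<dots> < 2 * e'" using x y by simp
      finally have "dist (Complex x y) (complex_of_real c) < 2 * e'" .
      then show "\<exists>x'\<in>?D. x' \<noteq> complex_of_real c \<and> dist x' (complex_of_real c) < e"
        using x y e' by (intro bexI[of _ "Complex x y"]) (auto simp: D complex_eq_iff)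
    qed
  qed
qed

text \<open>An iterated limit: the height goes to 0 first, with a threshold that may depend on
  \<open>x\<close>. The sweeps need exactly this, because they fix the abscissae before the height
  tends to 0.\<close>

definition vertical_lim :: "(complex \<Rightarrow> real) \<Rightarrow> real \<Rightarrow> real \<Rightarrow> bool" where
  "vertical_lim F c L \<longleftrightarrow> (\<forall>e>0. \<exists>d>0. \<forall>x\<in>gap_inv. \<bar>x - c\<bar> < d \<longrightarrow>
     (\<forall>\<^sub>F y in at_right 0. \<bar>F (Complex x y) - L\<bar> < e))"

lemma vertical_limI:
  fixes \<sigma> :: "real \<Rightarrow> real"
  assumes lim: "(F \<longlongrightarrow> (L::real)) (at (complex_of_real c) within approach \<sigma> c s)"
    and \<sigma>pos: "\<And>x. x \<in> gap_inv \<Longrightarrow> \<sigma> x > 0" and s: "s > 0"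
  shows "vertical_lim F c L"
  unfolding vertical_lim_def
proof (intro allI impI)
  fix e :: real assume e: "e > 0"
  obtain d where d: "d > 0" "\<And>z. Im z > 0 \<Longrightarrow> Re z \<in> gap_inv \<Longrightarrow> Im z \<le> (\<sigma> (Re z))\<^sup>2 \<Longrightarrow> dist z (complex_of_real c) < s
     \<Longrightarrow> z \<noteq> complex_of_real c \<Longrightarrow> dist z (complex_of_real c) < d \<Longrightarrow> dist (F z) L < e"
    using tendstoD[OF lim e] unfolding eventually_at approach_def by auto
  define d' where "d' = min d s / 2"
  have d': "d' > 0" "2 * d' \<le> d" "2 * d' \<le> s" using d s by (auto simp: d'_def)
  show "\<exists>d>0. \<forall>x\<in>gap_inv. \<bar>x - c\<bar> < d \<longrightarrow> (\<forall>\<^sub>F y in at_right 0. \<bar>F (Complex x y) - L\<bar> < e)"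
  proof (intro exI[of _ d'] conjI ballI impI d')
    fix x assume x: "x \<in> gap_inv" "\<bar>x - c\<bar> < d'"
    have "0 < min ((\<sigma> x)\<^sup>2) d'" using \<sigma>pos[OF x(1)] d' by simp
    from eventually_at_right_0_small[OF this]
    show "\<forall>\<^sub>F y in at_right 0. \<bar>F (Complex x y) - L\<bar> < e"
    proof eventually_elim
      case (elim y)
      have "dist (Complex x y) (complex_of_real c) \<le> \<bar>x - c\<bar> + \<bar>y\<bar>"
        using cmod_le[of "Complex x y - complex_of_real c"] by (simp add: dist_norm)
      also have "\<dots> < 2 * d'" using x elim by simp
      finally have *: "dist (Complex x y) (complex_of_real c) < 2 * d'" .
      have "dist (F (Complex x y)) L < e"
        by (rule d(2)) (use elim x * d' in \<open>auto simp: complex_eq_iff\<close>)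
      then show ?case by (simp add: dist_real_def)
    qed
  qed
qed

lemma near_right: "e > 0 \<Longrightarrow> \<exists>x\<in>gap_inv. \<bar>x - 1 / \<alpha>\<bar> < e"
  and near_left: "e > 0 \<Longrightarrow> \<exists>x\<in>gap_inv. \<bar>x - 1 / \<beta>\<bar> < e"
proof -
  have l: "1 / \<beta> < 1 / \<alpha>" using pos less by (simp add: frac_less2)
  define w where "w = 1 / \<alpha> - 1 / \<beta>"
  assume e: "e > 0"
  define q where "q = min e w / 2"
  have q: "0 < q" "q < e" "q < w" using e l by (auto simp: q_def w_def)
  show "\<exists>x\<in>gap_inv. \<bar>x - 1 / \<alpha>\<bar> < e"
    using q by (intro bexI[of _ "1 / \<alpha> - q"]) (auto simp: gap_inv_def w_def)
  show "\<exists>x\<in>gap_inv. \<bar>x - 1 / \<beta>\<bar> < e"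
    using q by (intro bexI[of _ "1 / \<beta> + q"]) (auto simp: gap_inv_def w_def)
qed

lemma gap_value_large_right:
  assumes "prob {\<alpha>} > 0" "d > 0" shows "\<exists>x\<in>gap_inv. \<bar>x - 1 / \<alpha>\<bar> < d \<and> gap_value x > R"
proof -
  have l: "1 / \<beta> < 1 / \<alpha>" "\<beta> > 0" using pos less by (simp_all add: frac_less2)
  have "((\<lambda>x. prob {\<alpha>} - (1 - \<alpha> * x) * (1 / (\<beta> * x - 1) + R)) \<longlongrightarrow> prob {\<alpha>} - (1 - \<alpha> * (1 / \<alpha>)) * (1 / (\<beta> * (1 / \<alpha>) - 1) + R)) (at_left (1 / \<alpha>))"
    using pos less by (intro tendsto_intros) auto
  then have "\<forall>\<^sub>F x in at_left (1 / \<alpha>). prob {\<alpha>} - (1 - \<alpha> * x) * (1 / (\<beta> * x - 1) + R) > 0"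
    using assms pos by (intro order_tendstoD(1)) auto
  moreover have "\<forall>\<^sub>F x in at_left (1 / \<alpha>). x > max (1 / \<beta>) (1 / \<alpha> - d)"
    using l assms by (intro eventually_at_leftI[of "max (1 / \<beta>) (1 / \<alpha> - d)"]) auto
  moreover have "\<forall>\<^sub>F x in at_left (1 / \<alpha>). x < 1 / \<alpha>" by (simp add: eventually_at_filter)
  ultimately have "\<forall>\<^sub>F x in at_left (1 / \<alpha>). x \<in> gap_inv \<and> \<bar>x - 1 / \<alpha>\<bar> < d \<and> gap_value x > R"
  proof eventually_elim
    case (elim x)
    then have x: "x \<in> gap_inv" by (simp add: gap_inv_def)
    note f = gap_inv_facts[OF x]
    have "1 / (\<beta> * x - 1) + R < prob {\<alpha>} / (1 - \<alpha> * x)" using elim(1) f by (simp add: pos_less_divide_eq mult.commute)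
    then have "R < gap_value x" using gap_value_bounds(1)[OF x] by linarith
    then show ?case using x elim by auto
  qed
  then show ?thesis using eventually_happens'[OF trivial_limit_at_left_real] by blast
qed

lemma gap_value_large_left:
  assumes "prob {\<beta>} > 0" "d > 0" shows "\<exists>x\<in>gap_inv. \<bar>x - 1 / \<beta>\<bar> < d \<and> gap_value x < R"
proof -
  have l: "1 / \<beta> < 1 / \<alpha>" "\<beta> > 0" using pos less by (simp_all add: frac_less2)
  have "((\<lambda>x. prob {\<beta>} - (\<beta> * x - 1) * (1 / (1 - \<alpha> * x) - R)) \<longlongrightarrow> prob {\<beta>} - (\<beta> * (1 / \<beta>) - 1) * (1 / (1 - \<alpha> * (1 / \<beta>)) - R)) (at_right (1 / \<beta>))"
    using pos less by (intro tendsto_intros) auto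
  then have "\<forall>\<^sub>F x in at_right (1 / \<beta>). prob {\<beta>} - (\<beta> * x - 1) * (1 / (1 - \<alpha> * x) - R) > 0"
    using assms l by (intro order_tendstoD(1)) auto
  moreover have "\<forall>\<^sub>F x in at_right (1 / \<beta>). x < min (1 / \<alpha>) (1 / \<beta> + d)"
    using l assms by (intro eventually_at_rightI[of _ "min (1 / \<alpha>) (1 / \<beta> + d)"]) auto
  moreover have "\<forall>\<^sub>F x in at_right (1 / \<beta>). x > 1 / \<beta>" by (simp add: eventually_at_filter)
  ultimately have "\<forall>\<^sub>F x in at_right (1 / \<beta>). x \<in> gap_inv \<and> \<bar>x - 1 / \<beta>\<bar> < d \<and> gap_value x < R"
  proof eventually_elim
    case (elim x)
    then have x: "x \<in> gap_inv" by (simp add: gap_inv_def)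
    note f = gap_inv_facts[OF x]
    have "1 / (1 - \<alpha> * x) - R < prob {\<beta>} / (\<beta> * x - 1)" using elim(1) f by (simp add: pos_less_divide_eq mult.commute)
    then have "gap_value x < R" using gap_value_bounds(2)[OF x] by linarith
    then show ?case using x elim by auto
  qed
  then show ?thesis using eventually_happens'[OF trivial_limit_at_right_real] by blast
qed

end

locale subord_gap = subord \<mu>1 \<mu>2 \<nu> o1 o2 + gp: gap_dist \<nu> \<alpha> \<beta>
  for \<mu>1 \<mu>2 \<nu> :: "real measure" and o1 o2 :: "complex \<Rightarrow> complex" and \<alpha> \<beta> :: real
begin

text \<open>Treats both ends at once: \<open>A\<close> is the edge of the gap and
  \<open>\<sigma>\<close> is \<open>1 - \<alpha> x\<close> or \<open>\<beta> x - 1\<close>. In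
  either case \<open>\<sigma>^2\<close> removes the singular term of \<open>gap_bound\<close> and
  leaves the constant \<open>A\<close>, while \<open>g\<close> is the term of the other edge,
  continuous at \<open>1 / A\<close>.\<close>

lemma endpoint_atoms:
  fixes \<sigma> h g :: "real \<Rightarrow> real"
  assumes \<sigma>pos: "\<And>x. x \<in> gp.gap_inv \<Longrightarrow> \<sigma> x > 0"
    and low: "\<And>x. x \<in> gp.gap_inv \<Longrightarrow> m / \<sigma> x - h x \<le> \<bar>gp.gap_value x\<bar>"
    and gap_bound\<sigma>: "\<And>x. x \<in> gp.gap_inv \<Longrightarrow> (\<sigma> x)\<^sup>2 * gp.gap_bound x = A + (\<sigma> x)\<^sup>2 * g x"
    and cont: "isCont \<sigma> (1 / A)" "isCont h (1 / A)" "isCont g (1 / A)" and \<sigma>0: "\<sigma> (1 / A) = 0"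
    and m: "m > 0" and A: "A > 0" and near: "\<And>e. e > 0 \<Longrightarrow> \<exists>x\<in>gp.gap_inv. \<bar>x - 1 / A\<bar> < e"
  obtains a b where "a > 0" "b > 0" "a * b = A" "A.prob {a} + B.prob {b} > 1"
    "gp.vertical_lim (\<lambda>z. cmod (o1 z)) (1 / A) (1 / a)" "gp.vertical_lim (\<lambda>z. cmod (o2 z)) (1 / A) (1 / b)"
proof -
  have c: "1 / A > 0" "1 / A * A = 1" using A by simp_all
  obtain s where s: "s > 0"
    "filterlim (\<lambda>z. cmod (resolvent \<nu> z)) at_top (at (complex_of_real (1 / A)) within gp.approach \<sigma> (1 / A) s)"
    "\<And>z. z \<in> gp.approach \<sigma> (1 / A) s \<Longrightarrow> (m\<^sup>2 / 8) * cmod z * Im (resolvent \<nu> z) \<le> Im z * (cmod (resolvent \<nu> z))\<^sup>2"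
    "complex_of_real (1 / A) islimpt gp.approach \<sigma> (1 / A) s"
    by (rule gp.endpoint_growth[OF \<sigma>pos low gap_bound\<sigma> cont \<sigma>0 m c near]) blast+
  have k: "m\<^sup>2 / 8 > 0" using m by simp
  have up: "\<And>z. z \<in> gp.approach \<sigma> (1 / A) s \<Longrightarrow> Im z > 0" by (simp add: gp.approach_def)
  obtain a b where ab: "a > 0" "b > 0" "a * b = 1 / (1 / A)" "A.prob {a} + B.prob {b} > 1"
    "((\<lambda>z. cmod (o1 z)) \<longlongrightarrow> 1 / a) (at (complex_of_real (1 / A)) within gp.approach \<sigma> (1 / A) s)"
    "((\<lambda>z. cmod (o2 z)) \<longlongrightarrow> 1 / b) (at (complex_of_real (1 / A)) within gp.approach \<sigma> (1 / A) s)"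
    by (rule endpoint_limit[OF up c(1) s(2) k s(3,4)])
  show thesis
    by (rule that[OF ab(1,2) _ ab(4) gp.vertical_limI[OF ab(5) \<sigma>pos s(1)] gp.vertical_limI[OF ab(6) \<sigma>pos s(1)]])
      (use ab(3) in simp_all)
qed

lemma right_end:
  assumes at: "C.prob {\<alpha>} > 0"
  obtains a b where "a > 0" "b > 0" "a * b = \<alpha>" "A.prob {a} + B.prob {b} > 1"
    "gp.vertical_lim (\<lambda>z. cmod (o1 z)) (1 / \<alpha>) (1 / a)" "gp.vertical_lim (\<lambda>z. cmod (o2 z)) (1 / \<alpha>) (1 / b)"
proof -
  have ne: "\<beta> / \<alpha> - 1 \<noteq> 0" using gp.pos gp.less by simp
  have \<sigma>p: "\<And>x. x \<in> gp.gap_inv \<Longrightarrow> 1 - \<alpha> * x > 0" using gp.gap_inv_facts by blast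
  show thesis
  proof (rule endpoint_atoms[where \<sigma> = "\<lambda>x. 1 - \<alpha> * x" and h = "\<lambda>x. 1 / (\<beta> * x - 1)"
      and g = "\<lambda>x. \<beta> / (\<beta> * x - 1)\<^sup>2" and A = \<alpha>, OF \<sigma>p _ _ _ _ _ _ at _ gp.near_right])
    show "C.prob {\<alpha>} / (1 - \<alpha> * x) - 1 / (\<beta> * x - 1) \<le> \<bar>gp.gap_value x\<bar>" if "x \<in> gp.gap_inv" for x
      using gp.gap_value_bounds(1)[OF that] by linarith
    show "(1 - \<alpha> * x)\<^sup>2 * gp.gap_bound x = \<alpha> + (1 - \<alpha> * x)\<^sup>2 * (\<beta> / (\<beta> * x - 1)\<^sup>2)" if "x \<in> gp.gap_inv" for x
      using \<sigma>p[OF that] by (simp add: gp.gap_bound_def distrib_left)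
  qed (use ne gp.pos that in \<open>auto intro!: continuous_intros\<close>)
qed

lemma left_end:
  assumes at: "C.prob {\<beta>} > 0"
  obtains a b where "a > 0" "b > 0" "a * b = \<beta>" "A.prob {a} + B.prob {b} > 1"
    "gp.vertical_lim (\<lambda>z. cmod (o1 z)) (1 / \<beta>) (1 / a)" "gp.vertical_lim (\<lambda>z. cmod (o2 z)) (1 / \<beta>) (1 / b)"
proof -
  have bp: "\<beta> > 0" using gp.pos gp.less by simp
  have ne: "1 - \<alpha> / \<beta> \<noteq> 0" using gp.pos gp.less by simp
  have \<sigma>p: "\<And>x. x \<in> gp.gap_inv \<Longrightarrow> \<beta> * x - 1 > 0" using gp.gap_inv_facts by blast
  show thesis
  proof (rule endpoint_atoms[where \<sigma> = "\<lambda>x. \<beta> * x - 1" and h = "\<lambda>x. 1 / (1 - \<alpha> * x)"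
      and g = "\<lambda>x. \<alpha> / (1 - \<alpha> * x)\<^sup>2" and A = \<beta>, OF \<sigma>p _ _ _ _ _ _ at _ gp.near_left])
    show "C.prob {\<beta>} / (\<beta> * x - 1) - 1 / (1 - \<alpha> * x) \<le> \<bar>gp.gap_value x\<bar>" if "x \<in> gp.gap_inv" for x
      using gp.gap_value_bounds(2)[OF that] by linarith
    show "(\<beta> * x - 1)\<^sup>2 * gp.gap_bound x = \<beta> + (\<beta> * x - 1)\<^sup>2 * (\<alpha> / (1 - \<alpha> * x)\<^sup>2)" if "x \<in> gp.gap_inv" for x
      using \<sigma>p[OF that] by (simp add: gp.gap_bound_def distrib_left)
  qed (use ne bp that in \<open>auto intro!: continuous_intros\<close>)
qed

end

section \<open>Sweeping the moduli across parts of the gap\<close>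

lemma ivt_between:
  fixes f :: "real \<Rightarrow> real"
  assumes "continuous_on {p..q} f" "p \<le> q" "f p \<le> w \<and> w \<le> f q \<or> f q \<le> w \<and> w \<le> f p"
  shows "\<exists>x\<in>{p..q}. f x = w"
  using assms(3)
proof
  assume "f p \<le> w \<and> w \<le> f q"
  then show ?thesis using IVT'[of f p w q] assms by auto
next
  assume "f q \<le> w \<and> w \<le> f p"
  then show ?thesis using IVT2'[of f q w p] assms by auto
qed

context subord_gap
begin

lemma swap_gap: "subord_gap \<mu>2 \<mu>1 \<nu> o2 o1 \<alpha> \<beta>"
proof -
  interpret s: subord \<mu>2 \<mu>1 \<nu> o2 o1 by (rule swap)
  show ?thesis by unfold_locales
qed

lemma continuous_horizontal:
  assumes "y > 0" shows "continuous_on S (\<lambda>x. cmod (o1 (Complex x y)))" "continuous_on S (\<lambda>x. cmod (o2 (Complex x y)))"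
proof -
  have "continuous_on S (\<lambda>x. complex_of_real x + \<i> * complex_of_real y)"
    by (rule continuous_on_add[OF continuous_on_of_real[OF continuous_on_id] continuous_on_const])
  then have c: "continuous_on S (\<lambda>x. Complex x y)" by (simp only: Complex_eq)
  show "continuous_on S (\<lambda>x. cmod (o1 (Complex x y)))"
    by (rule continuous_on_norm, rule continuous_on_compose2[OF cont1 c]) (use assms in auto)
  show "continuous_on S (\<lambda>x. cmod (o2 (Complex x y)))"
    by (rule continuous_on_norm, rule continuous_on_compose2[OF cont2 c]) (use assms in auto)
qed

text \<open>On these parts \<eta> of \<nu> has real part bounded away from 0 and imaginary part
  \<open>O(y)\<close>, so its argument, and with it that of \<open>o1\<close>, is
  \<open>O(y)\<close>. Conversely the argument of \<open>o1\<close> is at least that of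
  \<open>z\<close>, whose sine is \<open>y / |z|\<close>. Since \<open>Im N\<close> is
  \<open>O(y)\<close>, \<open>near_mass_upper\<close> yields
  \<open>p y / |z| = O(y^3)\<close>.\<close>

lemma sweep_bound:
  assumes K: "xl \<in> gp.gap_inv" "xr \<in> gp.gap_inv" "xl \<le> xr" and e: "e > 0"
    and off: "(\<forall>x\<in>{xl..xr}. 1 + e \<le> gp.gap_value x) \<or> (\<forall>x\<in>{xl..xr}. gp.gap_value x \<le> - e)"
  shows "\<exists>C. \<forall>\<^sub>F y in at_right 0. \<forall>x\<in>{xl..xr}.
    A.prob {t. \<bar>t * cmod (o1 (Complex x y)) - 1\<bar> \<le> y} \<le> C * y\<^sup>2"
proof -
  define g where "g = \<alpha> / (1 - \<alpha> * xr)\<^sup>2 + \<beta> / (\<beta> * xl - 1)\<^sup>2"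
  note fl = gp.gap_inv_facts[OF K(1)] and fR = gp.gap_inv_facts[OF K(2)]
  have KI: "x \<in> gp.gap_inv" if "x \<in> {xl..xr}" for x using that K by (auto simp: gp.gap_inv_def)
  have Gg: "gp.gap_bound x \<le> g" if x: "x \<in> {xl..xr}" for x
  proof -
    have 1: "\<alpha> * x \<le> \<alpha> * xr" "\<beta> * xl \<le> \<beta> * x" using x gp.pos gp.less by (auto intro!: mult_left_mono)
    have "\<alpha> / (1 - \<alpha> * x)\<^sup>2 \<le> \<alpha> / (1 - \<alpha> * xr)\<^sup>2"
      using 1 fR gp.pos by (intro divide_left_mono power_mono mult_pos_pos zero_less_power) linarith+
    moreover have "\<beta> / (\<beta> * x - 1)\<^sup>2 \<le> \<beta> / (\<beta> * xl - 1)\<^sup>2"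
      using 1 fl by (intro divide_left_mono power_mono mult_pos_pos zero_less_power) linarith+
    ultimately show ?thesis by (simp add: gp.gap_bound_def g_def)
  qed
  have g: "g > 0" using Gg[of xl] gp.gap_bound_pos[OF K(1)] K by auto
  \<comment> \<open>Half of the margin \<open>e\<close> is spent on the passage from
    \<open>gap_value x\<close> to the real part of the resolvent.\<close>
  define h where "h = min e 1 / 2"
  have h: "0 < h" "h < 1" "2 * h \<le> e" using e by (auto simp: h_def)
  \<comment> \<open>The quotient of the bound \<open>y g / h^2\<close> for \<open>Im E\<close> by
    the bound \<open>h / (1 + h)\<close> for \<open>Re E\<close>, without the factor
    \<open>y\<close>. In \<open>C\<close> the last factor bounds \<open>|z|\<close>.\<close>
  define C1 where "C1 = g / (h\<^sup>2 * (h / (1 + h)))"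
  have C1: "C1 > 0" using g h by (simp add: C1_def)
  define C where "C = 2 * (1 + 2 * C1)\<^sup>2 * g * (1 / \<alpha> + 1)"
  have "0 < h / g" "0 < 1 / C1" using g h C1 by auto
  then have "0 < Min {h / g, 1 / C1, 1 / 2}" by simp
  from eventually_at_right_0_small[OF this]
  have "\<forall>\<^sub>F y in at_right 0. \<forall>x\<in>{xl..xr}.
    A.prob {t. \<bar>t * cmod (o1 (Complex x y)) - 1\<bar> \<le> y} \<le> C * y\<^sup>2"
  proof eventually_elim
    case (elim y)
    then have y: "0 < y" "y < h / g" "y < 1 / C1" "y < 1 / 2" by auto
    have yg: "y * g < h" using y g by (simp add: field_simps)
    have yC: "C1 * y < 1" using y C1 by (simp add: field_simps)
    show ?case
    proof
      fix x assume x: "x \<in> {xl..xr}"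
      define z where "z = Complex x y"
      have z: "Im z > 0" using y by (simp add: z_def)
      define N where "N = resolvent \<nu> z"
      define E where "E = eta_transform \<nu> z"
      note nf = gp.resolvent_near_gap_value[OF KI[OF x] y(1), folded z_def N_def]
      have yG: "y * gp.gap_bound x \<le> y * g" using Gg[OF x] y by (intro mult_left_mono) auto
      have ReN: "\<bar>Re N - gp.gap_value x\<bar> \<le> h"
        using abs_Re_le_cmod[of "N - of_real (gp.gap_value x)"] nf(1) yG yg by simp
      have ImN: "0 < Im N" "Im N \<le> y * g" using C.Im_resolvent_pos[OF z] nf(2) yG by (auto simp: N_def)
      have E: "E = 1 - 1 / N" unfolding E_def N_def by (rule C.eta_eq'[OF slit_upper[OF z]])
      have ReE: "Re E = 1 - Re N / (cmod N)\<^sup>2" by (simp add: E Re_divide cmod_power2)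
      have ImE: "Im E = Im N / (cmod N)\<^sup>2" unfolding E_def N_def by (rule C.Im_eta[OF slit_upper[OF z]])
      have bd: "h \<le> cmod N \<and> h / (1 + h) \<le> Re E"
        using off
      proof
        assume "\<forall>x\<in>{xl..xr}. 1 + e \<le> gp.gap_value x"
        then have "1 + e \<le> gp.gap_value x" using x by blast
        then have R: "1 + h \<le> Re N" using ReN h by linarith
        then have cN: "1 + h \<le> cmod N" using complex_Re_le_cmod[of N] by linarith
        have "Re N / (cmod N)\<^sup>2 \<le> cmod N / (cmod N)\<^sup>2" using complex_Re_le_cmod by (intro divide_right_mono) auto
        also have "\<dots> = 1 / cmod N" by (simp add: power2_eq_square)
        also have "\<dots> \<le> 1 / (1 + h)" using cN h by (intro frac_le) auto
        finally have "1 - 1 / (1 + h) \<le> Re E" by (simp add: ReE)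
        moreover have "1 - 1 / (1 + h) = h / (1 + h)" using h by (simp add: field_simps)
        ultimately show ?thesis using cN h by simp
      next
        assume "\<forall>x\<in>{xl..xr}. gp.gap_value x \<le> - e"
        then have "gp.gap_value x \<le> - e" using x by blast
        then have R: "Re N \<le> - h" using ReN h by linarith
        then have cN: "h \<le> cmod N" using abs_Re_le_cmod[of N] by linarith
        have "Re N / (cmod N)\<^sup>2 \<le> 0" using R h by (intro divide_nonpos_nonneg) auto
        then have "1 \<le> Re E" by (simp add: ReE)
        moreover have "h / (1 + h) \<le> 1" using h by simp
        ultimately show ?thesis using cN by linarith
      qed
      have ReE0: "0 < Re E" using bd h by (smt (verit) divide_pos_pos)
      have ImE': "Im E \<le> y * g / h\<^sup>2" unfolding ImE
        using ImN bd h by (intro frac_le power_mono) auto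
      have "Arg E = arctan (Im E / Re E)" by (rule arg_conv_arctan[OF ReE0])
      also have "\<dots> \<le> Im E / Re E" using ImN ReE0 by (intro arctan_le_self) (auto simp: ImE)
      also have "\<dots> \<le> (y * g / h\<^sup>2) / (h / (1 + h))"
        using ImE' bd h y g by (intro frac_le) auto
      also have "\<dots> = C1 * y" by (simp add: C1_def)
      finally have AE: "Arg E \<le> C1 * y" .
      note af = Arg_facts[OF z, folded E_def]
      have Ao: "Arg (o1 z) \<le> C1 * y" using af AE by linarith
      have o1nz: "o1 z \<noteq> 0" "z \<noteq> 0" using upper1[OF z] z by auto
      have s: "sin (Arg z) \<le> sin (Arg (o1 z))"
        using af Ao yC pi_gt3 by (intro sin_monotone_2pi_le) auto
      have cz: "cmod z \<le> 1 / \<alpha> + 1"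
        using cmod_le[of z] gp.gap_inv_facts[OF KI[OF x]] y by (simp add: z_def)
      define p where "p = A.prob {t. \<bar>t * cmod (o1 z) - 1\<bar> \<le> y}"
      have "p * (y / cmod z) = p * sin (Arg z)" using sin_Arg[OF o1nz(2)] by (simp add: z_def)
      also have "\<dots> \<le> p * sin (Arg (o1 z))" using s by (intro mult_left_mono) (auto simp: p_def)
      also have "\<dots> = p * (Im (o1 z) / cmod (o1 z))" using sin_Arg[OF o1nz(1)] by simp
      also have "\<dots> \<le> 2 * ((1 + 2 * C1) * y)\<^sup>2 * Im N"
        using A.near_mass_upper[OF upper1[OF z] y(1) less_imp_le[OF y(4)] Ao] resolvent1[OF z] by (simp add: p_def N_def)
      also have "\<dots> \<le> 2 * ((1 + 2 * C1) * y)\<^sup>2 * (y * g)" using ImN by (intro mult_left_mono) auto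
      finally have "p * (y / cmod z) * cmod z \<le> 2 * ((1 + 2 * C1) * y)\<^sup>2 * (y * g) * cmod z"
        by (intro mult_right_mono) auto
      then have "p * y \<le> 2 * ((1 + 2 * C1) * y)\<^sup>2 * (y * g) * cmod z" using o1nz by simp
      also have "\<dots> \<le> 2 * ((1 + 2 * C1) * y)\<^sup>2 * (y * g) * (1 / \<alpha> + 1)"
        using cz y g by (intro mult_left_mono) auto
      also have "\<dots> = (C * y\<^sup>2) * y" by (simp add: C_def power_mult_distrib mult_ac)
      finally show "A.prob {t. \<bar>t * cmod (o1 (Complex x y)) - 1\<bar> \<le> y} \<le> C * y\<^sup>2"
        using y by (simp add: p_def z_def)
    qed
  qed
  then show ?thesis by blast
qed

lemma modulus_prod_tendsto:
  assumes x: "x \<in> gp.gap_inv" and nz: "gp.gap_value x \<noteq> 0"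
  shows "((\<lambda>y. cmod (o1 (Complex x y)) * cmod (o2 (Complex x y))) \<longlongrightarrow> x * \<bar>1 - 1 / gp.gap_value x\<bar>) (at_right 0)"
proof -
  have "((\<lambda>y. Complex x y) \<longlongrightarrow> Complex x 0) (at_right 0)"
    unfolding tendsto_complex_iff by (auto intro!: tendsto_intros)
  then have "((\<lambda>y. cmod (Complex x y * (1 - 1 / resolvent \<nu> (Complex x y)))) \<longlongrightarrow> cmod (Complex x 0 * (1 - 1 / of_real (gp.gap_value x)))) (at_right 0)"
    using nz by (intro tendsto_intros gp.resolvent_tendsto_gap_value[OF x]) auto
  moreover have "cmod (Complex x 0 * (1 - 1 / of_real (gp.gap_value x))) = x * \<bar>1 - 1 / gp.gap_value x\<bar>"
  proof -
    have "Complex x 0 * (1 - 1 / of_real (gp.gap_value x)) = of_real (x * (1 - 1 / gp.gap_value x))"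
      by (simp add: complex_eq_iff)
    then show ?thesis using gp.gap_inv_facts(1)[OF x] by (simp only: norm_of_real abs_mult abs_of_pos)
  qed
  moreover have "\<forall>\<^sub>F y in at_right 0. cmod (Complex x y * (1 - 1 / resolvent \<nu> (Complex x y))) = cmod (o1 (Complex x y)) * cmod (o2 (Complex x y))"
    using eventually_at_right_less[of 0]
  proof eventually_elim
    case (elim y)
    then have z: "Im (Complex x y) > 0" by simp
    show ?case using o_prod[OF z] C.eta_eq'[OF slit_upper[OF z]] by (metis norm_mult)
  qed
  ultimately show ?thesis using Lim_transform_eventually by force
qed

lemma gap_value_surj:
  assumes "p \<in> gp.gap_inv" "q \<in> gp.gap_inv" "p \<le> q" "gp.gap_value p \<le> w" "w \<le> gp.gap_value q"
  shows "\<exists>x\<in>gp.gap_inv. p \<le> x \<and> x \<le> q \<and> gp.gap_value x = w"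
proof -
  have sub: "{p..q} \<subseteq> gp.gap_inv" using assms by (auto simp: gp.gap_inv_def)
  have "\<exists>x. p \<le> x \<and> x \<le> q \<and> gp.gap_value x = w"
    by (rule IVT'[OF assms(4,5,3) continuous_on_subset[OF gp.gap_value_continuous sub]])
  then show ?thesis using sub by auto
qed

text \<open>Both orders are allowed, since only the intermediate value theorem is applied to the
  moduli and no monotonicity in \<open>x\<close> is known.\<close>

definition between :: "real \<Rightarrow> real \<Rightarrow> real \<Rightarrow> bool" where
  "between w p q \<longleftrightarrow> p \<le> w \<and> w \<le> q \<or> q \<le> w \<and> w \<le> p"

text \<open>If \<open>|o1|\<close> took the value \<open>1 / q\<close>, the window around the atom
  \<open>q\<close> would have mass at most \<open>C1 y^2\<close>, less than the atom for small
  \<open>y\<close>. So \<open>|o1|\<close> cannot pass. The hypothesis on \<open>|o2|\<close> is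
  conditional on this: it may use that \<open>|o1|\<close> stays on one side of
  \<open>1 / q\<close>.\<close>

lemma sweep_null:
  assumes K: "xl \<in> gp.gap_inv" "xr \<in> gp.gap_inv" "xl \<le> xr" and e: "e > 0"
    and off: "(\<forall>x\<in>{xl..xr}. 1 + e \<le> gp.gap_value x) \<or> (\<forall>x\<in>{xl..xr}. gp.gap_value x \<le> - e)"
    and q: "q > 0" "A.prob {q} > 0" and w: "0 < w1" "w1 \<le> w2"
    and ev: "\<forall>\<^sub>F y in at_right 0. \<not> between (1 / q) (cmod (o1 (Complex xl y))) (cmod (o1 (Complex xr y))) \<longrightarrow>
       (\<forall>w\<in>{w1..w2}. between w (cmod (o2 (Complex xl y))) (cmod (o2 (Complex xr y))))"
  shows "\<forall>\<^sub>F y in at_right 0. \<not> between (1 / q) (cmod (o1 (Complex xl y))) (cmod (o1 (Complex xr y)))"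
    and "B.prob {1 / w2 .. 1 / w1} = 0"
proof -
  obtain C1 where C1: "\<forall>\<^sub>F y in at_right 0. \<forall>x\<in>{xl..xr}.
    A.prob {t. \<bar>t * cmod (o1 (Complex x y)) - 1\<bar> \<le> y} \<le> C1 * y\<^sup>2"
    using sweep_bound[OF K e off] by blast
  interpret s: subord_gap \<mu>2 \<mu>1 \<nu> o2 o1 \<alpha> \<beta> by (rule swap_gap)
  obtain C2 where C2: "\<forall>\<^sub>F y in at_right 0. \<forall>x\<in>{xl..xr}.
    B.prob {t. \<bar>t * cmod (o2 (Complex x y)) - 1\<bar> \<le> y} \<le> C2 * y\<^sup>2"
    using s.sweep_bound[OF K e off] by blast
  have "((\<lambda>y. C1 * y\<^sup>2) \<longlongrightarrow> C1 * 0\<^sup>2) (at_right 0)" by (intro tendsto_intros)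
  then have sm: "\<forall>\<^sub>F y in at_right 0. C1 * y\<^sup>2 < A.prob {q}" using q by (intro order_tendstoD(2)) auto
  have pos: "\<forall>\<^sub>F y in at_right (0::real). 0 < y" by (rule eventually_at_right_less)
  show nb: "\<forall>\<^sub>F y in at_right 0. \<not> between (1 / q) (cmod (o1 (Complex xl y))) (cmod (o1 (Complex xr y)))"
    using C1 sm pos
  proof eventually_elim
    case (elim y)
    show ?case
    proof
      assume "between (1 / q) (cmod (o1 (Complex xl y))) (cmod (o1 (Complex xr y)))"
      then obtain x where x: "x \<in> {xl..xr}" "cmod (o1 (Complex x y)) = 1 / q"
        using ivt_between[OF continuous_horizontal(1)[OF elim(3)] K(3)] unfolding between_def by blast
      have "q \<in> {t. \<bar>t * cmod (o1 (Complex x y)) - 1\<bar> \<le> y}" using x q elim by simp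
      then have "A.prob {q} \<le> A.prob {t. \<bar>t * cmod (o1 (Complex x y)) - 1\<bar> \<le> y}"
        by (intro A.finite_measure_mono) auto
      then show False using elim x by fastforce
    qed
  qed
  have "\<forall>\<^sub>F y in at_right 0. \<forall>w\<in>{w1..w2}. B.prob {t. \<bar>t * w - 1\<bar> \<le> y} \<le> C2 * y\<^sup>2"
    using nb ev C2 pos
  proof eventually_elim
    case (elim y)
    show ?case
    proof
      fix w assume "w \<in> {w1..w2}"
      then have "between w (cmod (o2 (Complex xl y))) (cmod (o2 (Complex xr y)))" using elim by blast
      then obtain x where x: "x \<in> {xl..xr}" "cmod (o2 (Complex x y)) = w"
        using ivt_between[OF continuous_horizontal(2)[OF elim(4)] K(3)] unfolding between_def by blast
      then show "B.prob {t. \<bar>t * w - 1\<bar> \<le> y} \<le> C2 * y\<^sup>2" using elim(3) by blast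
    qed
  qed
  then show "B.prob {1 / w2 .. 1 / w1} = 0" by (rule B.null_interval_cover[OF w])
qed

end

text \<open>The limits \<open>1 / b\<close> of \<open>|o2|\<close> at both ends of the gap agree, those of \<open>|o1|\<close> do not.\<close>

locale common_atom = subord_gap +
  fixes a a' b :: real
  assumes atom_alpha: "C.prob {\<alpha>} > 0" and atom_beta: "C.prob {\<beta>} > 0"
    and a: "0 < a" "a < a'" and b: "0 < b"
    and A_a: "A.prob {a} > 0" "A.prob {a'} > 0"
    and R1: "gp.vertical_lim (\<lambda>z. cmod (o1 z)) (1 / \<alpha>) (1 / a)"
    and R2: "gp.vertical_lim (\<lambda>z. cmod (o2 z)) (1 / \<alpha>) (1 / b)"
    and L1: "gp.vertical_lim (\<lambda>z. cmod (o1 z)) (1 / \<beta>) (1 / a')"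
    and L2: "gp.vertical_lim (\<lambda>z. cmod (o2 z)) (1 / \<beta>) (1 / b)"
begin

lemma inv_less: "1 / a' < 1 / a"
  using a by (simp add: frac_less2)

text \<open>The sweep runs from a point near \<open>1 / \<alpha>\<close> to the point where
  \<open>gap_value\<close> is \<open>1 + e'\<close>, close to the zero of \<eta>. The barrier for
  \<open>|o1|\<close> is \<open>1 / a'\<close>: starting near \<open>1 / a\<close>, it stays above,
  so the small product must be due to \<open>|o2|\<close>.\<close>

lemma right_null:
  assumes w: "0 < w1" "w1 \<le> w2" "w2 < 1 / b"
  shows "B.prob {1 / w2 .. 1 / w1} = 0"
proof -
  \<comment> \<open>With \<open>|o1| \<ge> \<epsilon>\<close> and a product below
    \<open>\<epsilon>^2\<close>, the modulus of \<open>o2\<close> falls below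
    \<open>\<epsilon>\<close> and hence below \<open>w1\<close>.\<close>
  define \<epsilon> where "\<epsilon> = min w1 (1 / a')"
  have \<epsilon>: "\<epsilon> > 0" "\<epsilon> \<le> w1" "\<epsilon> \<le> 1 / a'" using w a by (auto simp: \<epsilon>_def)
  define e0 where "e0 = min (1 / b - w2) (1 / a - 1 / a')"
  have e0: "e0 > 0" "w2 \<le> 1 / b - e0" "1 / a' \<le> 1 / a - e0" using w inv_less by (auto simp: e0_def)
  \<comment> \<open>At \<open>xl\<close> the product of the moduli tends to
    \<open>xl e' / (1 + e')\<close>, and \<open>xl < 1 / \<alpha>\<close> makes this at most half of
    \<open>\<epsilon>^2\<close>.\<close>
  define e' where "e' = \<alpha> * \<epsilon>\<^sup>2 / 2"
  have e': "e' > 0" using gp.pos \<epsilon> by (simp add: e'_def)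
  obtain d1 where d1: "d1 > 0" "\<And>x. x \<in> gp.gap_inv \<Longrightarrow> \<bar>x - 1 / \<alpha>\<bar> < d1 \<Longrightarrow> \<forall>\<^sub>F y in at_right 0. \<bar>cmod (o1 (Complex x y)) - 1 / a\<bar> < e0"
    using R1[unfolded gp.vertical_lim_def, rule_format, OF e0(1)] by blast
  obtain d2 where d2: "d2 > 0" "\<And>x. x \<in> gp.gap_inv \<Longrightarrow> \<bar>x - 1 / \<alpha>\<bar> < d2 \<Longrightarrow> \<forall>\<^sub>F y in at_right 0. \<bar>cmod (o2 (Complex x y)) - 1 / b\<bar> < e0"
    using R2[unfolded gp.vertical_lim_def, rule_format, OF e0(1)] by blast
  obtain xr where xr: "xr \<in> gp.gap_inv" "\<bar>xr - 1 / \<alpha>\<bar> < min d1 d2" "gp.gap_value xr > 1 + e'"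
    using gp.gap_value_large_right[OF atom_alpha, of "min d1 d2" "1 + e'"] d1 d2 by auto
  obtain xp where xp: "xp \<in> gp.gap_inv" "gp.gap_value xp < 1 + e'"
    using gp.gap_value_large_left[OF atom_beta, of 1 "1 + e'"] by auto
  have "xp \<le> xr" using gp.gap_value_mono[OF xr(1) xp(1)] xr xp by linarith
  then obtain xl where xl: "xl \<in> gp.gap_inv" "xl \<le> xr" "gp.gap_value xl = 1 + e'"
    using gap_value_surj[OF xp(1) xr(1), of "1 + e'"] xr xp by auto
  have off: "\<forall>x\<in>{xl..xr}. 1 + e' \<le> gp.gap_value x"
  proof
    fix x assume x: "x \<in> {xl..xr}"
    then have "x \<in> gp.gap_inv" using xl xr by (auto simp: gp.gap_inv_def)
    then show "1 + e' \<le> gp.gap_value x" using gp.gap_value_mono[OF xl(1)] x xl by fastforce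
  qed
  note fl = gp.gap_inv_facts[OF xl(1)]
  have "xl * \<bar>1 - 1 / gp.gap_value xl\<bar> < \<epsilon>\<^sup>2"
  proof -
    have "1 - 1 / gp.gap_value xl = e' / (1 + e')" using e' xl by (simp add: field_simps)
    then have "\<bar>1 - 1 / gp.gap_value xl\<bar> = e' / (1 + e')" using e' by simp
    also have "\<dots> \<le> e'" using e' by (simp add: divide_le_eq)
    finally have "xl * \<bar>1 - 1 / gp.gap_value xl\<bar> \<le> (1 / \<alpha>) * e'" using fl e' gp.pos by (intro mult_mono) auto
    also have "\<dots> = \<epsilon>\<^sup>2 / 2" using gp.pos by (simp add: e'_def)
    also have "\<dots> < \<epsilon>\<^sup>2" using \<epsilon> by simp
    finally show ?thesis .
  qed
  then have prod: "\<forall>\<^sub>F y in at_right 0. cmod (o1 (Complex xl y)) * cmod (o2 (Complex xl y)) < \<epsilon>\<^sup>2"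
    using modulus_prod_tendsto[OF xl(1)] xl e' by (intro order_tendstoD(2)) auto
  show ?thesis
  proof (rule sweep_null(2)[OF xl(1) xr(1) xl(2) e' disjI1[OF off] _ A_a(2) w(1,2)])
    show "a' > 0" using a by simp
    have "\<forall>\<^sub>F y in at_right 0. \<bar>cmod (o1 (Complex xr y)) - 1 / a\<bar> < e0" using d1 xr by auto
    moreover have "\<forall>\<^sub>F y in at_right 0. \<bar>cmod (o2 (Complex xr y)) - 1 / b\<bar> < e0" using d2 xr by auto
    ultimately show "\<forall>\<^sub>F y in at_right 0. \<not> between (1 / a') (cmod (o1 (Complex xl y))) (cmod (o1 (Complex xr y))) \<longrightarrow>
       (\<forall>w\<in>{w1..w2}. between w (cmod (o2 (Complex xl y))) (cmod (o2 (Complex xr y))))"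
      using prod
    proof eventually_elim
      case (elim y)
      show ?case
      proof (intro impI ballI)
        assume nb: "\<not> between (1 / a') (cmod (o1 (Complex xl y))) (cmod (o1 (Complex xr y)))"
        fix w assume w: "w \<in> {w1..w2}"
        have "1 / a' \<le> cmod (o1 (Complex xr y))" "w2 \<le> cmod (o2 (Complex xr y))" using elim e0 by linarith+
        then have "\<epsilon> \<le> cmod (o1 (Complex xl y))" using nb \<epsilon> unfolding between_def by linarith
        then have "cmod (o2 (Complex xl y)) < \<epsilon>"
          using elim(3) mult_mono[of \<epsilon> "cmod (o1 (Complex xl y))" \<epsilon> "cmod (o2 (Complex xl y))"] \<epsilon>
          by (force simp: power2_eq_square not_less[symmetric])
        then show "between w (cmod (o2 (Complex xl y))) (cmod (o2 (Complex xr y)))"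
          using \<open>w2 \<le> cmod (o2 (Complex xr y))\<close> w \<epsilon> by (auto simp: between_def)
      qed
    qed
  qed
qed

text \<open>The mirror image, from \<open>1 / \<beta>\<close> towards the pole of \<eta>, with
  barrier \<open>1 / a\<close>. The second conclusion records a point at which the resolvent is
  small and \<open>|o2|\<close> large; it serves later to exclude mass at 0.\<close>

lemma left_null:
  assumes w: "1 / b < w1" "w1 \<le> w2"
  shows "B.prob {1 / w2 .. 1 / w1} = 0"
    and "\<exists>z. Im z > 0 \<and> cmod (resolvent \<nu> z) < 2 / (\<beta> * w2\<^sup>2) \<and> cmod (o2 z) > w2"
proof -
  have bp: "\<beta> > 0" using gp.pos gp.less by simp
  have w0: "w1 > 0" using w b by (smt (verit) divide_pos_pos)
  define M where "M = max w2 (1 / a)"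
  have M: "M > 0" "w2 \<le> M" "1 / a \<le> M" using w w0 by (auto simp: M_def)
  define e0 where "e0 = min (w1 - 1 / b) (1 / a - 1 / a')"
  have e0: "e0 > 0" "1 / b + e0 \<le> w1" "1 / a' + e0 \<le> 1 / a" using w inv_less by (auto simp: e0_def)
  \<comment> \<open>At \<open>gap_value xr = - e'\<close> the product of the moduli tends to
    \<open>xr (1 + 1 / e')\<close>, which exceeds \<open>M^2\<close> because
    \<open>xr > 1 / \<beta>\<close>. As \<open>|o1| \<le> M\<close>, this forces
    \<open>|o2| > M\<close>.\<close>
  define e' where "e' = 1 / (\<beta> * M\<^sup>2)"
  have e': "e' > 0" using bp M by (simp add: e'_def)
  obtain d1 where d1: "d1 > 0" "\<And>x. x \<in> gp.gap_inv \<Longrightarrow> \<bar>x - 1 / \<beta>\<bar> < d1 \<Longrightarrow> \<forall>\<^sub>F y in at_right 0. \<bar>cmod (o1 (Complex x y)) - 1 / a'\<bar> < e0"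
    using L1[unfolded gp.vertical_lim_def, rule_format, OF e0(1)] by blast
  obtain d2 where d2: "d2 > 0" "\<And>x. x \<in> gp.gap_inv \<Longrightarrow> \<bar>x - 1 / \<beta>\<bar> < d2 \<Longrightarrow> \<forall>\<^sub>F y in at_right 0. \<bar>cmod (o2 (Complex x y)) - 1 / b\<bar> < e0"
    using L2[unfolded gp.vertical_lim_def, rule_format, OF e0(1)] by blast
  obtain xl where xl: "xl \<in> gp.gap_inv" "\<bar>xl - 1 / \<beta>\<bar> < min d1 d2" "gp.gap_value xl < - e'"
    using gp.gap_value_large_left[OF atom_beta, of "min d1 d2" "- e'"] d1 d2 by auto
  obtain xq where xq: "xq \<in> gp.gap_inv" "gp.gap_value xq > - e'"
    using gp.gap_value_large_right[OF atom_alpha, of 1 "- e'"] by auto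
  have "xl \<le> xq" using gp.gap_value_mono[OF xq(1) xl(1)] xl xq by linarith
  then obtain xr where xr: "xr \<in> gp.gap_inv" "xl \<le> xr" "gp.gap_value xr = - e'"
    using gap_value_surj[OF xl(1) xq(1), of "- e'"] xl xq by auto
  have off: "\<forall>x\<in>{xl..xr}. gp.gap_value x \<le> - e'"
  proof
    fix x assume x: "x \<in> {xl..xr}"
    then have "x \<in> gp.gap_inv" using xl xr by (auto simp: gp.gap_inv_def)
    then show "gp.gap_value x \<le> - e'" using gp.gap_value_mono[OF _ xr(1)] x xr by fastforce
  qed
  note fR = gp.gap_inv_facts[OF xr(1)]
  have "M\<^sup>2 < xr * \<bar>1 - 1 / gp.gap_value xr\<bar>"
  proof -
    have "M\<^sup>2 = (1 / \<beta>) * (1 / e')" using bp M by (simp add: e'_def)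
    also have "\<dots> < xr * (1 + 1 / e')" using fR e' bp by (intro mult_strict_mono) auto
    also have "1 + 1 / e' = \<bar>1 - 1 / gp.gap_value xr\<bar>" using e' xr by simp
    finally show ?thesis .
  qed
  then have prod: "\<forall>\<^sub>F y in at_right 0. M\<^sup>2 < cmod (o1 (Complex xr y)) * cmod (o2 (Complex xr y))"
    using modulus_prod_tendsto[OF xr(1)] xr e' by (intro order_tendstoD(1)) auto
  have close: "\<forall>\<^sub>F y in at_right 0. \<bar>cmod (o1 (Complex xl y)) - 1 / a'\<bar> < e0 \<and> \<bar>cmod (o2 (Complex xl y)) - 1 / b\<bar> < e0"
    using d1 d2 xl by (intro eventually_conj) auto
  have step: "\<forall>\<^sub>F y in at_right 0. \<not> between (1 / a) (cmod (o1 (Complex xl y))) (cmod (o1 (Complex xr y))) \<longrightarrow>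
      cmod (o2 (Complex xl y)) \<le> w1 \<and> M < cmod (o2 (Complex xr y))"
    using close prod
  proof eventually_elim
    case (elim y)
    show ?case
    proof
      assume nb: "\<not> between (1 / a) (cmod (o1 (Complex xl y))) (cmod (o1 (Complex xr y)))"
      have 1: "cmod (o1 (Complex xl y)) \<le> 1 / a" "cmod (o2 (Complex xl y)) \<le> w1" using elim e0 by linarith+
      then have "cmod (o1 (Complex xr y)) \<le> M" using nb M unfolding between_def by linarith
      then have "cmod (o1 (Complex xr y)) * cmod (o2 (Complex xr y)) \<le> M * cmod (o2 (Complex xr y))"
        by (intro mult_right_mono) auto
      then have "M * M < M * cmod (o2 (Complex xr y))" using elim by (simp add: power2_eq_square)
      then show "cmod (o2 (Complex xl y)) \<le> w1 \<and> M < cmod (o2 (Complex xr y))" using M 1 by simp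
    qed
  qed
  then have ev: "\<forall>\<^sub>F y in at_right 0. \<not> between (1 / a) (cmod (o1 (Complex xl y))) (cmod (o1 (Complex xr y))) \<longrightarrow>
       (\<forall>w\<in>{w1..w2}. between w (cmod (o2 (Complex xl y))) (cmod (o2 (Complex xr y))))"
    by eventually_elim (use M in \<open>auto simp: between_def\<close>)
  note sn = sweep_null[OF xl(1) xr(1,2) e' disjI2[OF off] a(1) A_a(1) w0 w(2) ev]
  show "B.prob {1 / w2 .. 1 / w1} = 0" by (rule sn(2))
  have "((\<lambda>y. cmod (resolvent \<nu> (Complex xr y))) \<longlongrightarrow> cmod (of_real (gp.gap_value xr))) (at_right 0)"
    by (intro tendsto_norm gp.resolvent_tendsto_gap_value xr)
  then have "\<forall>\<^sub>F y in at_right 0. cmod (resolvent \<nu> (Complex xr y)) < 2 * e'"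
    using xr e' by (intro order_tendstoD(2)) auto
  with sn(1) step eventually_at_right_less[of 0]
  have "\<forall>\<^sub>F y in at_right 0. y > 0 \<and> cmod (resolvent \<nu> (Complex xr y)) < 2 * e' \<and> cmod (o2 (Complex xr y)) > M"
    by eventually_elim blast
  then obtain y where y: "y > 0" "cmod (resolvent \<nu> (Complex xr y)) < 2 * e'" "cmod (o2 (Complex xr y)) > M"
    using eventually_happens'[OF trivial_limit_at_right_real] by blast
  have "w2\<^sup>2 \<le> M\<^sup>2" using M w w0 by (intro power_mono) auto
  then have "2 * e' \<le> 2 / (\<beta> * w2\<^sup>2)" using bp w w0 M unfolding e'_def by (simp add: frac_le)
  then show "\<exists>z. Im z > 0 \<and> cmod (resolvent \<nu> z) < 2 / (\<beta> * w2\<^sup>2) \<and> cmod (o2 z) > w2"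
    using y M by (intro exI[of _ "Complex xr y"]) auto
qed

text \<open>Countably many closed intervals with rational ends, lying in \<open>(0, b)\<close> or
  beyond \<open>b\<close>, cover all positive points except \<open>b\<close>.\<close>

lemma AE_support: "AE t in \<mu>2. t = 0 \<or> t = b"
proof -
  have 1: "AE t in \<mu>2. t \<notin> {p..q}" if "0 < p" "p \<le> q" "q < b \<or> b < p" for p q
  proof -
    have "B.prob {1 / (1 / p) .. 1 / (1 / q)} = 0"
      using that(3)
    proof
      assume q: "q < b"
      have "1 / b < 1 / q" using that q by (simp add: frac_less2)
      moreover have "1 / q \<le> 1 / p" using that by (simp add: frac_le)
      ultimately show ?thesis by (rule left_null)
    next
      assume p: "b < p"
      have "1 / p < 1 / b" using b p by (simp add: frac_less2)
      moreover have "1 / q \<le> 1 / p" "0 < 1 / q" using that by (simp_all add: frac_le)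
      ultimately show ?thesis by (intro right_null)
    qed
    then have "B.prob {p..q} = 0" by simp
    then show ?thesis by (intro AE_not_in) (simp add: null_sets_def B.emeasure_eq_measure)
  qed
  have "AE t in \<mu>2. \<forall>pq::rat \<times> rat. (0::real) < of_rat (fst pq) \<and> of_rat (fst pq) \<le> (of_rat (snd pq) :: real) \<and>
      (of_rat (snd pq) < b \<or> b < of_rat (fst pq)) \<longrightarrow> t \<notin> {of_rat (fst pq)..of_rat (snd pq)}"
    unfolding AE_all_countable
  proof
    fix pq :: "rat \<times> rat"
    show "AE t in \<mu>2. (0::real) < of_rat (fst pq) \<and> of_rat (fst pq) \<le> (of_rat (snd pq) :: real) \<and>
      (of_rat (snd pq) < b \<or> b < of_rat (fst pq)) \<longrightarrow> t \<notin> {of_rat (fst pq)..of_rat (snd pq)}"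
      using 1[of "of_rat (fst pq)" "of_rat (snd pq)"] by (cases "(0::real) < of_rat (fst pq) \<and> of_rat (fst pq) \<le> (of_rat (snd pq) :: real) \<and>
      (of_rat (snd pq) < b \<or> b < of_rat (fst pq))") auto
  qed
  then show ?thesis using B.AE_nonneg
  proof eventually_elim
    case (elim t)
    have H: "False" if pq: "0 < (of_rat p :: real)" "of_rat p < t" "t < of_rat q" "of_rat q < b \<or> b < of_rat p" for p q
      using elim(1)[rule_format, of "(p, q)"] pq by auto
    show ?case
    proof (rule ccontr)
      assume n: "\<not> (t = 0 \<or> t = b)"
      then have t0: "0 < t" using elim by simp
      consider "t < b" | "b < t" using n by linarith
      then show False
      proof cases
        case 1
        obtain p where "(0::real) < of_rat p" "of_rat p < t" using of_rat_dense[OF t0] by blast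
        moreover obtain q where "t < of_rat q" "of_rat q < b" using of_rat_dense[OF 1] by blast
        ultimately show False using H by blast
      next
        case 2
        obtain p where p: "b < of_rat p" "of_rat p < t" using of_rat_dense[OF 2] by blast
        moreover obtain q where "t < of_rat q" using of_rat_dense[of t "t + 1"] by auto
        moreover have "0 < (of_rat p :: real)" using p b by linarith
        ultimately show False using H by blast
      qed
    qed
  qed
qed

text \<open>With support in \<open>{0, b}\<close> the resolvent is \<open>p0\<close> plus a term
  that vanishes as its argument goes to infinity. Evaluated at \<open>o2 z\<close> it equals the
  resolvent of \<nu> at \<open>z\<close>, so points with \<open>|o2 z|\<close> large and the latter
  small bound \<open>p0\<close> by quantities tending to 0.\<close>

lemma second_is_point_mass: "\<mu>2 = return borel b"
proof -
  define p0 where "p0 = B.prob {0}"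
  have N: "resolvent \<mu>2 w = of_real p0 + of_real (B.prob {b}) / (1 - of_real b * w)" if w: "Im w > 0" for w
  proof -
    have i: "integrable \<mu>2 (\<lambda>t. complex_of_real (indicat_real {c} t) * k)" for c k
      by (intro integrable_mult_left integrable_of_real integrable_real_indicator) (auto simp: B.emeasure_finite less_top[symmetric])
    have "resolvent \<mu>2 w = (LINT t|\<mu>2. complex_of_real (indicat_real {0} t) * 1 + complex_of_real (indicat_real {b} t) * (1 / (1 - of_real b * w)))"
      unfolding resolvent_def
    proof (rule integral_cong_AE)
      show "AE t in \<mu>2. 1 / (1 - complex_of_real t * w) = complex_of_real (indicat_real {0} t) * 1 + complex_of_real (indicat_real {b} t) * (1 / (1 - of_real b * w))"
        using AE_support by eventually_elim (use b in auto)
    qed auto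
    also have "\<dots> = (LINT t|\<mu>2. complex_of_real (indicat_real {0} t) * 1) + (LINT t|\<mu>2. complex_of_real (indicat_real {b} t) * (1 / (1 - of_real b * w)))"
      by (rule Bochner_Integration.integral_add[OF i i])
    also have "\<dots> = of_real p0 + of_real (B.prob {b}) / (1 - of_real b * w)"
      by (simp only: Bochner_Integration.integral_mult_left_zero integral_complex_of_real) (simp add: p0_def)
    finally show ?thesis .
  qed
  have bp: "\<beta> > 0" using gp.pos gp.less by simp
  have small: "p0 \<le> 2 / (\<beta> * w\<^sup>2) + 1 / (b * w - 1)" if w: "1 / b < w" for w
  proof -
    obtain z where z: "Im z > 0" "cmod (resolvent \<nu> z) < 2 / (\<beta> * w\<^sup>2)" "cmod (o2 z) > w"
      using left_null(2)[OF w order_refl] by blast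
    have bw: "b * w > 1" using w b by (simp add: field_simps)
    have "b * w < b * cmod (o2 z)" using z b by simp
    moreover have "cmod (of_real b * o2 z) - cmod 1 \<le> cmod (1 - of_real b * o2 z)"
      using norm_triangle_ineq2[of "of_real b * o2 z" 1] by (simp add: norm_minus_commute)
    moreover have "cmod (of_real b * o2 z) = b * cmod (o2 z)" using b by (simp add: norm_mult)
    ultimately have D: "b * w - 1 \<le> cmod (1 - of_real b * o2 z)" by simp
    have "cmod (of_real (B.prob {b}) / (1 - of_real b * o2 z)) = B.prob {b} / cmod (1 - of_real b * o2 z)"
      by (simp add: norm_divide)
    also have "\<dots> \<le> 1 / (b * w - 1)" using D bw by (intro frac_le) auto
    finally have q: "cmod (of_real (B.prob {b}) / (1 - of_real b * o2 z)) \<le> 1 / (b * w - 1)" .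
    have "complex_of_real p0 = resolvent \<nu> z - of_real (B.prob {b}) / (1 - of_real b * o2 z)"
      using N[OF upper2[OF z(1)]] resolvent2[OF z(1)] by simp
    then have "cmod (complex_of_real p0) \<le> cmod (resolvent \<nu> z) + cmod (of_real (B.prob {b}) / (1 - of_real b * o2 z))"
      by (metis norm_triangle_ineq4)
    then show ?thesis using q z by (simp add: p0_def)
  qed
  have "((\<lambda>w. 2 / (\<beta> * w\<^sup>2) + 1 / (b * w - 1)) \<longlongrightarrow> 0) at_top"
    using bp b by real_asymp
  moreover have "\<forall>\<^sub>F w in at_top. p0 \<le> 2 / (\<beta> * w\<^sup>2) + 1 / (b * w - 1)"
    using eventually_gt_at_top[of "1 / b"] by eventually_elim (rule small)
  ultimately have "p0 \<le> 0" by (rule tendsto_lowerbound) simp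
  then have "B.prob {0} = 0" by (simp add: p0_def measure_le_0_iff)
  then have "AE t in \<mu>2. t \<notin> {0}" by (intro AE_not_in) (simp add: null_sets_def B.emeasure_eq_measure)
  then have "AE t in \<mu>2. t = b" using AE_support by eventually_elim auto
  then show ?thesis by (rule measure_eq_return[OF B.real_distribution_axioms])
qed

end

theorem theorem3p2:
  fixes \<mu>1 \<mu>2 \<nu> :: "real measure" and \<alpha> \<beta> :: real
  assumes "nonneg_distribution \<mu>1" and "\<mu>1 \<noteq> return borel 0"
    and "nonneg_distribution \<mu>2" and "\<mu>2 \<noteq> return borel 0"
    and "free_mult_convolution \<mu>1 \<mu>2 \<nu>"
    and "0 < \<alpha>" and "\<alpha> < \<beta>"
    and "atom \<nu> \<alpha>" and "atom \<nu> \<beta>"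
    and "emeasure \<nu> {\<alpha><..<\<beta>} = 0"
  shows "point_mass \<mu>1 \<or> point_mass \<mu>2"
proof -
  have \<nu>: "nonneg_distribution \<nu>" "\<nu> \<noteq> return borel 0"
    using assms(5) by (auto simp: free_mult_convolution_def)
  interpret mult_conv \<mu>1 \<mu>2 \<nu>
    by unfold_locales (use assms \<nu> in \<open>auto\<close>)
  obtain o1 o2 where o: "subord \<mu>1 \<mu>2 \<nu> o1 o2" using subord_exists by blast
  interpret subord \<mu>1 \<mu>2 \<nu> o1 o2 by (rule o)
  interpret sg: subord_gap \<mu>1 \<mu>2 \<nu> o1 o2 \<alpha> \<beta>
    by unfold_locales (use assms in auto)
  have at: "C.prob {\<alpha>} > 0" "C.prob {\<beta>} > 0"
    using assms by (auto simp: atom_def C.emeasure_eq_measure)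
  obtain a b where ab: "a > 0" "b > 0" "a * b = \<alpha>" "A.prob {a} + B.prob {b} > 1"
    and R: "sg.gp.vertical_lim (\<lambda>z. cmod (o1 z)) (1 / \<alpha>) (1 / a)"
    "sg.gp.vertical_lim (\<lambda>z. cmod (o2 z)) (1 / \<alpha>) (1 / b)"
    using sg.right_end[OF at(1)] by blast
  obtain a' b' where ab': "a' > 0" "b' > 0" "a' * b' = \<beta>" "A.prob {a'} + B.prob {b'} > 1"
    and L: "sg.gp.vertical_lim (\<lambda>z. cmod (o1 z)) (1 / \<beta>) (1 / a')"
    "sg.gp.vertical_lim (\<lambda>z. cmod (o2 z)) (1 / \<beta>) (1 / b')"
    using sg.left_end[OF at(2)] by blast
  have "A.prob {a} \<le> 1" "A.prob {a'} \<le> 1" "B.prob {b} \<le> 1" "B.prob {b'} \<le> 1" by simp_all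
  then have pos: "A.prob {a} > 0" "A.prob {a'} > 0" "B.prob {b} > 0" "B.prob {b'} > 0"
    using ab(4) ab'(4) by linarith+
  have "a = a' \<or> b = b'" by (rule atom_pair_unique[OF ab(4) ab'(4)])
  then show ?thesis
  proof
    assume eq: "a = a'"
    then have "b < b'" using ab ab' assms by (metis mult_less_cancel_left_pos)
    \<comment> \<open>The common atom belongs to the first measure here, so the roles are exchanged
      and the measure found to be a point mass is \<open>\<mu>1\<close>.\<close>
    interpret s: subord_gap \<mu>2 \<mu>1 \<nu> o2 o1 \<alpha> \<beta> by (rule sg.swap_gap)
    interpret common_atom \<mu>2 \<mu>1 \<nu> o2 o1 \<alpha> \<beta> b b' a
      by unfold_locales (use ab at pos R L eq \<open>b < b'\<close> in auto)
    show ?thesis using second_is_point_mass by (auto simp: point_mass_def)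
  next
    assume eq: "b = b'"
    then have "a < a'" using ab ab' assms by (metis mult_less_cancel_right_pos)
    interpret common_atom \<mu>1 \<mu>2 \<nu> o1 o2 \<alpha> \<beta> a a' b
      by unfold_locales (use ab at pos R L eq \<open>a < a'\<close> in auto)
    show ?thesis using second_is_point_mass by (auto simp: point_mass_def)
  qed
qed

end
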